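(* Let $(\mathcal T,\mathcal E,(x_K)_{K\in\mathcal T})$ be an admissible mesh of $\Omega$ and $\tau>0$ a time step. For $n\ge1$, given $\boldsymbol\rho^{n-1}\in[0,1]^{\mathcal T}$, there exists a unique solution $\boldsymbol\rho^n=((\rho^n_K)_{K\in\mathcal T},(\rho^n_\sigma)_{\sigma\in\mathcal E_{\rm ext}})\in(0,1)^{\mathcal T\cup\mathcal E_{\rm ext}}$ to the nonlinear system given by the SQRA scheme at time step $n$. Moreover, there exists a constant $C$ depending only on $\Gamma,\alpha,\beta,\phi$ (thus not on the mesh, $\tau$, $n$ or $\rho^0$) such that the iterated solution $(\boldsymbol\rho^n)_{n\ge1}$ of the scheme started from the discretized initial datum $\boldsymbol\rho^0$ satisfies $$\mathcal F^{\,n-1}_{\mathcal T,\rm tot}\ \ge\ \mathcal F^{\,n}_{\mathcal T,\rm tot}\ \ge\ -C\,t_n,\qquad n\ge1 .$$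
   Context: Data. $\Omega\subset\mathbb R^d$ is a connected bounded open polyhedral set with measure $m_\Omega$ and boundary $\Gamma=\partial\Omega$. $\phi\in W^{1,\infty}(\Omega)$, $\phi\ge0$; $\alpha,\beta\in W^{1,\infty}(\Gamma)$ with $\alpha(x)>\beta(x)>0$ for all $x\in\Gamma$; $\rho^0\in L^\infty(\Omega;[0,1])$. $W^{1,\infty}$ functions are identified with their continuous representatives ($\phi$ extended to $\overline\Omega$). Admissible mesh. A triplet $(\mathcal T,\mathcal E,(x_K)_{K\in\mathcal T})$ ($\mathcal T,\mathcal E$ finite) such that: (i) each cell $K\in\mathcal T$ is non-empty, open, polyhedral and convex, distinct cells are disjoint, and $\bigcup_{K}\overline K=\overline\Omega$; (ii) each face $\sigma\in\mathcal E$ is closed, contained in a hyperplane of $\mathbb R^d$, with $m_\sigma=\mathcal H^{d-1}(\sigma)>0$; $\mathcal H^{d-1}(\sigma\cap\sigma')=0$ for $\sigma\ne\sigma'$; for each $K$ there is $\mathcal E_K\subset\mathcal E$ with $\partial K=\bigcup_{\sigma\in\mathcal E_K}\sigma$, and $\bigcup_K\mathcal E_K=\mathcal E$; for $K\neq L$, $\overline K\cap\overline L$ either is a single face of $\mathcal E$, denoted $K|L$, or has zero $\mathcal H^{d-1}$-measure; (iii) the cell centers $x_K$ are pairwise distinct points of $\Omega$, and if $K,L$ share a face $K|L$, then $x_L-x_K$ is orthogonal to $K|L$ and oriented from $K$ to $L$; (iv) for each face $\sigma\subset\partial\Omega$ (belonging to the cell $K$) there is $x_\sigma\in\sigma$ such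 that $x_\sigma-x_K$ is orthogonal to $\sigma$. It is not assumed that $x_K\in K$. $\mathcal E_{\rm int}$ is the set of faces $K|L$, $\mathcal E_{\rm ext}$ the set of faces contained in $\partial\Omega$. $m_K$ is the Lebesgue measure of $K$. $d_\sigma=|x_K-x_L|$ if $\sigma=K|L\in\mathcal E_{\rm int}$, and $d_\sigma=|x_K-x_\sigma|$ if $\sigma\in\mathcal E_{\rm ext}\cap\mathcal E_K$. Set $t_n=n\tau$. Scheme. $\rho^0_K=\frac1{m_K}\int_K\rho^0$, $\phi_K=\phi(x_K)$, $\phi_\sigma=\phi(x_\sigma)$, $\alpha_\sigma=\alpha(x_\sigma)$, $\beta_\sigma=\beta(x_\sigma)$ for $\sigma\in\mathcal E_{\rm ext}$. For $n\ge1$ the SQRA scheme is $$\frac{\rho_K^n-\rho_K^{n-1}}{\tau}m_K+\sum_{\sigma\in\mathcal E_K}m_\sigma F^n_{K\sigma}=0,\qquad K\in\mathcal T,$$ $$F^n_{K\sigma}=\frac1{d_\sigma}\Big[\rho_K^n(1-\rho_L^n)e^{\frac12(\phi_K-\phi_L)}-\rho_L^n(1-\rho_K^n)e^{\frac12(\phi_L-\phi_K)}\Big]\quad\text{for }\sigma=K|L\in\mathcal E_{\rm int},$$ $$F^n_{K\sigma}=\frac1{d_\sigma}\Big[\rho_K^n(1-\rho_\sigma^n)e^{\frac12(\phi_K-\phi_\sigma)}-\rho_\sigma^n(1-\rho_K^n)e^{\frac12(\phi_\sigma-\phi_K)}\Big]=\alpha_\sigma\rho^n_\sigma-\beta_\sigma\quad\text{for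 }\sigma\in\mathcal E_{\rm ext}\cap\mathcal E_K,$$ the last equality being equivalent to $$\rho_\sigma^n=\frac{d_\sigma\beta_\sigma+\rho_K^ne^{\frac12(\phi_K-\phi_\sigma)}}{d_\sigma\alpha_\sigma+\rho_K^ne^{\frac12(\phi_K-\phi_\sigma)}+(1-\rho_K^n)e^{-\frac12(\phi_K-\phi_\sigma)}} .$$ Discrete energies. With $h(\rho)=\rho\log\rho+(1-\rho)\log(1-\rho)+\log2$ ($0\log0=0$) and $\xi^\Gamma_\sigma=\phi_\sigma-\log(\alpha_\sigma/\beta_\sigma-1)$, $$\mathcal F_{\mathcal T}(\boldsymbol\rho^n)=\sum_{K\in\mathcal T}m_K\big(h(\rho_K^n)+\phi_K\rho_K^n\big),\qquad \mathcal F^n_{\mathcal T,\rm tot}=\mathcal F_{\mathcal T}(\boldsymbol\rho^n)+\sum_{p=1}^n\tau\sum_{\sigma\in\mathcal E_{\rm ext}}m_\sigma\,\xi^\Gamma_\sigma F^p_{K\sigma},$$ so that $\mathcal F^0_{\mathcal T,\rm tot}=\mathcal F_{\mathcal T}(\boldsymbol\rho^0)$. *)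

theory Defs
  imports "HOL-Analysis.Analysis"
begin

section \<open>Hausdorff measure\<close>

text \<open>
  The (outer) measure of integer dimension \<open>s\<close>, normalised so that it agrees with Lebesgue
  measure in dimension \<open>s\<close>. The case distinction on the empty set matters only for \<open>s = 0\<close>,
  where \<open>0 ^ 0 = 1\<close> and the result is the counting measure.
\<close>

definition hausdorff_premeasure :: "real \<Rightarrow> nat \<Rightarrow> 'a::metric_space set \<Rightarrow> ennreal" where
  "hausdorff_premeasure \<delta> s A =
     (INF U \<in> {U :: nat \<Rightarrow> 'a set. A \<subseteq> (\<Union>i. U i) \<and> (\<forall>i. bounded (U i) \<and> diameter (U i) \<le> \<delta>)}.
        \<Sum>i. if U i = {} then 0 else ennreal (unit_ball_vol (real s) * (diameter (U i) / 2) ^ s))"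

definition hausdorff_measure :: "nat \<Rightarrow> 'a::metric_space set \<Rightarrow> ennreal" where
  "hausdorff_measure s A = (SUP \<delta> \<in> {0<..}. hausdorff_premeasure \<delta> s A)"

abbreviation surface_measure :: "'a::euclidean_space set \<Rightarrow> ennreal" where
  "surface_measure \<equiv> hausdorff_measure (DIM('a) - 1)"


section \<open>Polyhedral sets and hyperplanes\<close>

text \<open>
  An open polyhedral set need not be convex. Taking the interior of a finite union of closed convex
  polyhedra makes the set lie locally on one side of each flat piece of its boundary, so that slits
  and punctures are excluded.
\<close>

definition open_polyhedral :: "'a::euclidean_space set \<Rightarrow> bool" where
  "open_polyhedral S \<longleftrightarrow> (\<exists>P. finite P \<and> (\<forall>p\<in>P. polyhedron p) \<and> S = interior (\<Union>P))"

definition hyperplane :: "'a::euclidean_space set \<Rightarrow> bool" where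
  "hyperplane P \<longleftrightarrow> (\<exists>a b. a \<noteq> 0 \<and> P = {x. a \<bullet> x = b})"

definition orthogonal_to_set :: "'a::euclidean_space \<Rightarrow> 'a set \<Rightarrow> bool" where
  "orthogonal_to_set v S \<longleftrightarrow> (\<forall>y\<in>S. \<forall>z\<in>S. orthogonal v (y - z))"


section \<open>Sobolev spaces\<close>

primrec C_k :: "nat \<Rightarrow> ('a::euclidean_space \<Rightarrow> real) \<Rightarrow> bool" where
  "C_k 0 f \<longleftrightarrow> continuous_on UNIV f"
| "C_k (Suc k) f \<longleftrightarrow> (\<forall>x. f differentiable (at x)) \<and>
     (\<forall>i\<in>Basis. C_k k (\<lambda>x. frechet_derivative f (at x) i))"

definition test_function :: "'a::euclidean_space set \<Rightarrow> ('a \<Rightarrow> real) \<Rightarrow> bool" where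
  "test_function U \<psi> \<longleftrightarrow> (\<forall>k. C_k k \<psi>) \<and>
     compact (closure {x. \<psi> x \<noteq> 0}) \<and> closure {x. \<psi> x \<noteq> 0} \<subseteq> U"

definition L_inf :: "'a::euclidean_space set \<Rightarrow> ('a \<Rightarrow> real) \<Rightarrow> bool" where
  "L_inf U f \<longleftrightarrow> set_borel_measurable lebesgue U f \<and>
     (\<exists>B. AE x in lebesgue. x \<in> U \<longrightarrow> \<bar>f x\<bar> \<le> B)"

definition weak_partial ::
  "'a::euclidean_space set \<Rightarrow> 'a \<Rightarrow> ('a \<Rightarrow> real) \<Rightarrow> ('a \<Rightarrow> real) \<Rightarrow> bool" where
  "weak_partial U i f g \<longleftrightarrow> (\<forall>\<psi>. test_function U \<psi> \<longrightarrow>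
     (LINT x:U|lebesgue. f x * frechet_derivative \<psi> (at x) i) =
     - (LINT x:U|lebesgue. g x * \<psi> x))"

definition W1_inf :: "'a::euclidean_space set \<Rightarrow> ('a \<Rightarrow> real) \<Rightarrow> bool" where
  "W1_inf U f \<longleftrightarrow> L_inf U f \<and> (\<forall>i\<in>Basis. \<exists>g. L_inf U g \<and> weak_partial U i f g)"

text \<open>
  The space on the boundary \<open>G\<close> of a polyhedral set, for continuous representatives: a continuous
  function on \<open>G\<close> that has bounded weak tangential derivatives on every flat piece of \<open>G\<close>, i.e. on
  the relative interior of \<open>G \<inter> P\<close> in each hyperplane \<open>P\<close>. A function on a relatively open subset
  of \<open>P\<close> is handled through its extension to the cylinder over that subset that is constant in the
  direction normal to \<open>P\<close>. When \<open>G\<close> is a Lipschitz surface these are the Lipschitz functions on \<open>G\<close>.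
\<close>

definition W1_inf_boundary :: "'a::euclidean_space set \<Rightarrow> ('a \<Rightarrow> real) \<Rightarrow> bool" where
  "W1_inf_boundary G f \<longleftrightarrow> continuous_on G f \<and>
     (\<forall>P. hyperplane P \<longrightarrow>
        W1_inf {x. closest_point P x \<in> (top_of_set P) interior_of (G \<inter> P)}
          (\<lambda>x. f (closest_point P x)))"


section \<open>Admissible meshes\<close>

text \<open>
  Besides the cells, the faces and the cell centers, the record carries the sets of faces of the
  cells and the points \<open>x_\<sigma>\<close> on the boundary faces, whose existence is part of admissibility.
  Admissibility determines both of them (\<open>face_center\<close> only on boundary faces).
\<close>

record 'a mesh =
  cells :: "'a set set"
  faces :: "'a set set"
  center :: "'a set \<Rightarrow> 'a"
  cell_faces :: "'a set \<Rightarrow> 'a set set"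
  face_center :: "'a set \<Rightarrow> 'a"

definition int_faces :: "'a::euclidean_space mesh \<Rightarrow> 'a set set" where
  "int_faces M = {\<sigma> \<in> faces M. \<exists>K\<in>cells M. \<exists>L\<in>cells M. K \<noteq> L \<and> \<sigma> = closure K \<inter> closure L}"

definition ext_faces :: "'a::euclidean_space set \<Rightarrow> 'a mesh \<Rightarrow> 'a set set" where
  "ext_faces \<Omega> M = {\<sigma> \<in> faces M. \<sigma> \<subseteq> frontier \<Omega>}"

text \<open>
  The clause \<open>faces M = int_faces M \<union> ext_faces \<Omega> M\<close> is the convention that every face is either
  of the form \<open>K|L\<close> or a boundary face; the fluxes are only defined on these two kinds. It rules
  out closed sets \<open>\<sigma>\<close> consisting of a piece of the boundary together with a null set reaching
  into \<open>\<Omega>\<close>.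
\<close>

definition admissible_mesh :: "'a::euclidean_space set \<Rightarrow> 'a mesh \<Rightarrow> bool" where
  "admissible_mesh \<Omega> M \<longleftrightarrow>
     finite (cells M) \<and> finite (faces M) \<and>
     (\<forall>K\<in>cells M. K \<noteq> {} \<and> open K \<and> open_polyhedral K \<and> convex K) \<and>
     (\<forall>K\<in>cells M. \<forall>L\<in>cells M. K \<noteq> L \<longrightarrow> K \<inter> L = {}) \<and>
     (\<Union>K\<in>cells M. closure K) = closure \<Omega> \<and>
     (\<forall>\<sigma>\<in>faces M. closed \<sigma> \<and> (\<exists>P. hyperplane P \<and> \<sigma> \<subseteq> P) \<and> surface_measure \<sigma> > 0) \<and>
     (\<forall>\<sigma>\<in>faces M. \<forall>\<sigma>'\<in>faces M. \<sigma> \<noteq> \<sigma>' \<longrightarrow> surface_measure (\<sigma> \<inter> \<sigma>') = 0) \<and>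
     (\<forall>K\<in>cells M. cell_faces M K \<subseteq> faces M \<and> frontier K = \<Union>(cell_faces M K)) \<and>
     (\<Union>K\<in>cells M. cell_faces M K) = faces M \<and>
     (\<forall>K\<in>cells M. \<forall>L\<in>cells M. K \<noteq> L \<longrightarrow>
        closure K \<inter> closure L \<in> faces M \<or> surface_measure (closure K \<inter> closure L) = 0) \<and>
     faces M = int_faces M \<union> ext_faces \<Omega> M \<and>
     inj_on (center M) (cells M) \<and>
     (\<forall>K\<in>cells M. center M K \<in> \<Omega>) \<and>
     (\<forall>K\<in>cells M. \<forall>L\<in>cells M. K \<noteq> L \<and> closure K \<inter> closure L \<in> faces M \<longrightarrow>
        orthogonal_to_set (center M L - center M K) (closure K \<inter> closure L) \<and>
        (\<forall>y \<in> closure K \<inter> closure L.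
           (\<forall>p\<in>K. (center M L - center M K) \<bullet> (p - y) < 0) \<and>
           (\<forall>q\<in>L. (center M L - center M K) \<bullet> (q - y) > 0))) \<and>
     (\<forall>K\<in>cells M. \<forall>\<sigma> \<in> cell_faces M K \<inter> ext_faces \<Omega> M.
        face_center M \<sigma> \<in> \<sigma> \<and> orthogonal_to_set (face_center M \<sigma> - center M K) \<sigma>)"

definition cell_measure :: "'a::euclidean_space set \<Rightarrow> real" where
  "cell_measure K = measure lebesgue K"

definition face_measure :: "'a::euclidean_space set \<Rightarrow> real" where
  "face_measure \<sigma> = enn2real (surface_measure \<sigma>)"

text \<open>\<open>neighbour M K \<sigma>\<close> is the cell \<open>L\<close> with \<open>\<sigma> = K|L\<close>; \<open>owner M \<sigma>\<close> is the cell
  to which a boundary face belongs.\<close>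

definition neighbour :: "'a::euclidean_space mesh \<Rightarrow> 'a set \<Rightarrow> 'a set \<Rightarrow> 'a set" where
  "neighbour M K \<sigma> = (THE L. L \<in> cells M \<and> L \<noteq> K \<and> \<sigma> = closure K \<inter> closure L)"

definition owner :: "'a::euclidean_space mesh \<Rightarrow> 'a set \<Rightarrow> 'a set" where
  "owner M \<sigma> = (THE K. K \<in> cells M \<and> \<sigma> \<in> cell_faces M K)"


section \<open>The SQRA scheme\<close>

definition sqra :: "real \<Rightarrow> real \<Rightarrow> real \<Rightarrow> real \<Rightarrow> real \<Rightarrow> real" where
  "sqra d a b p q =
     (1 / d) * (a * (1 - b) * exp ((p - q) / 2) - b * (1 - a) * exp ((q - p) / 2))"

text \<open>The unknowns are the cell values \<open>u\<close> and the values \<open>w\<close> on the boundary faces.\<close>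

definition flux ::
  "'a::euclidean_space mesh \<Rightarrow> ('a \<Rightarrow> real) \<Rightarrow> ('a set \<Rightarrow> real) \<Rightarrow> ('a set \<Rightarrow> real)
     \<Rightarrow> 'a set \<Rightarrow> 'a set \<Rightarrow> real" where
  "flux M \<phi> u w K \<sigma> =
     (if \<sigma> \<in> int_faces M then
        (let L = neighbour M K \<sigma> in
           sqra (dist (center M K) (center M L)) (u K) (u L) (\<phi> (center M K)) (\<phi> (center M L)))
      else
        sqra (dist (center M K) (face_center M \<sigma>)) (u K) (w \<sigma>)
          (\<phi> (center M K)) (\<phi> (face_center M \<sigma>)))"

definition sqra_step ::
  "'a::euclidean_space set \<Rightarrow> ('a \<Rightarrow> real) \<Rightarrow> ('a \<Rightarrow> real) \<Rightarrow> ('a \<Rightarrow> real) \<Rightarrow> 'a mesh \<Rightarrow> real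
     \<Rightarrow> ('a set \<Rightarrow> real) \<Rightarrow> ('a set \<Rightarrow> real) \<Rightarrow> ('a set \<Rightarrow> real) \<Rightarrow> bool" where
  "sqra_step \<Omega> \<phi> \<alpha> \<beta> M \<tau> u\<^sub>p\<^sub>r\<^sub>e\<^sub>v u w \<longleftrightarrow>
     (\<forall>K\<in>cells M. (u K - u\<^sub>p\<^sub>r\<^sub>e\<^sub>v K) / \<tau> * cell_measure K
        + (\<Sum>\<sigma>\<in>cell_faces M K. face_measure \<sigma> * flux M \<phi> u w K \<sigma>) = 0) \<and>
     (\<forall>K\<in>cells M. \<forall>\<sigma> \<in> cell_faces M K \<inter> ext_faces \<Omega> M.
        flux M \<phi> u w K \<sigma> = \<alpha> (face_center M \<sigma>) * w \<sigma> - \<beta> (face_center M \<sigma>))"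

definition sqra_solution ::
  "'a::euclidean_space set \<Rightarrow> ('a \<Rightarrow> real) \<Rightarrow> ('a \<Rightarrow> real) \<Rightarrow> ('a \<Rightarrow> real) \<Rightarrow> 'a mesh \<Rightarrow> real
     \<Rightarrow> ('a \<Rightarrow> real) \<Rightarrow> (nat \<Rightarrow> 'a set \<Rightarrow> real) \<Rightarrow> (nat \<Rightarrow> 'a set \<Rightarrow> real) \<Rightarrow> bool" where
  "sqra_solution \<Omega> \<phi> \<alpha> \<beta> M \<tau> \<rho>\<^sub>0 u w \<longleftrightarrow>
     (\<forall>K\<in>cells M. u 0 K = 1 / cell_measure K * (LINT x:K|lebesgue. \<rho>\<^sub>0 x)) \<and>
     (\<forall>n\<ge>1. (\<forall>K\<in>cells M. u n K \<in> {0<..<1}) \<and> (\<forall>\<sigma>\<in>ext_faces \<Omega> M. w n \<sigma> \<in> {0<..<1}) \<and>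
        sqra_step \<Omega> \<phi> \<alpha> \<beta> M \<tau> (u (n - 1)) (u n) (w n))"


section \<open>Discrete energies\<close>

text \<open>Since \<open>ln 0 = 0\<close>, the convention \<open>0 log 0 = 0\<close> is built in.\<close>

definition entropy :: "real \<Rightarrow> real" where
  "entropy r = r * ln r + (1 - r) * ln (1 - r) + ln 2"

definition energy :: "('a::euclidean_space \<Rightarrow> real) \<Rightarrow> 'a mesh \<Rightarrow> ('a set \<Rightarrow> real) \<Rightarrow> real" where
  "energy \<phi> M u = (\<Sum>K\<in>cells M. cell_measure K * (entropy (u K) + \<phi> (center M K) * u K))"

definition boundary_potential ::
  "('a::euclidean_space \<Rightarrow> real) \<Rightarrow> ('a \<Rightarrow> real) \<Rightarrow> ('a \<Rightarrow> real) \<Rightarrow> 'a mesh \<Rightarrow> 'a set \<Rightarrow> real" where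
  "boundary_potential \<phi> \<alpha> \<beta> M \<sigma> =
     \<phi> (face_center M \<sigma>) - ln (\<alpha> (face_center M \<sigma>) / \<beta> (face_center M \<sigma>) - 1)"

definition total_energy ::
  "'a::euclidean_space set \<Rightarrow> ('a \<Rightarrow> real) \<Rightarrow> ('a \<Rightarrow> real) \<Rightarrow> ('a \<Rightarrow> real) \<Rightarrow> 'a mesh \<Rightarrow> real
     \<Rightarrow> (nat \<Rightarrow> 'a set \<Rightarrow> real) \<Rightarrow> (nat \<Rightarrow> 'a set \<Rightarrow> real) \<Rightarrow> nat \<Rightarrow> real" where
  "total_energy \<Omega> \<phi> \<alpha> \<beta> M \<tau> u w n =
     energy \<phi> M (u n) +
     (\<Sum>p=1..n. \<tau> * (\<Sum>\<sigma>\<in>ext_faces \<Omega> M.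
        face_measure \<sigma> * boundary_potential \<phi> \<alpha> \<beta> M \<sigma> * flux M \<phi> (u p) (w p) (owner M \<sigma>) \<sigma>))"

end

theory Submission
  imports Defs
begin

text \<open>
  The scheme at one time step is a finite system with one equation per cell and one per boundary
  face. The flux \<open>sqra\<close> increases in the value on its own side and decreases in the
  value on the other side, so each equation increases in its own unknown and decreases in all
  others, and the constants \<open>0\<close> and \<open>1\<close> are a sub- and a
  supersolution. The componentwise supremum of all subsolutions with values in \<open>[0,
  1]\<close> is then a solution (\<open>monotone_system_solvable\<close>,
  \<open>step_exists_closed\<close>). Uniqueness is a discrete \<open>L\<^sup>1\<close>
  contraction: summing the difference of two solutions over the cells where the first one is
  larger, the fluxes between two such cells cancel and the remaining ones have a sign
  (\<open>step_le\<close>). A solution with the value \<open>0\<close> or \<open>1\<close> in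
  one cell has this value in the adjacent cells, because the fluxes around the cell all vanish;
  the value then spreads over the whole mesh and reaches a boundary face, where \<open>0 <
  \<beta> < \<alpha>\<close> forbids it (\<open>step_avoids_extreme\<close>).

  The energy decays because the entropy is convex and because each flux has the sign of the drop
  of the chemical potential \<open>\<xi> = log (\<rho> / (1 - \<rho>)) + \<phi>\<close> across
  its face. The value on a boundary face splits the drop towards
  \<open>\<xi>\<^sup>\<Gamma>\<close> into two parts, and both give a nonnegative product with
  the flux (\<open>sqra_dissipative\<close>, \<open>robin_dissipative\<close>,
  \<open>energy_step\<close>). For the lower bound, the energy itself is nonnegative, and the
  boundary terms of one time step are at most a bound for \<open>\<xi>\<^sup>\<Gamma>\<close> on
  \<open>\<Gamma>\<close>, times a bound for \<open>\<alpha>\<close>, times the total area of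
  the boundary faces. It remains to bound this area independently of the mesh
  (\<open>boundary_area_bound\<close>).

  All these arguments use facts about admissible meshes that are geometrically plausible but not
  part of their definition: faces have finite area, an interior face separates exactly two cells
  and is a face of both, no interior face lies on the boundary, some face lies on the boundary,
  and any two cells are joined by a chain of cells with common faces. They have to be derived
  from the Hausdorff measure of faces that need not be polyhedral. The bridge to Lebesgue
  measure is the slab of height \<open>1\<close> over a subset of a hyperplane: the surface
  measure of a compact set is at most a constant times the volume of its slab
  (\<open>surface_measure_le_slabs\<close>), and over a set of surface measure zero the slab,
  and more generally every Lipschitz family of curves starting there, is negligible
  (\<open>negligible_lipschitz_strip\<close>).
\<close>

section \<open>Surface measure and the volume of slabs\<close>

definition slab :: "'a::euclidean_space \<Rightarrow> 'a set \<Rightarrow> 'a set" where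
  "slab n S = (\<lambda>(s, t). s + t *\<^sub>R n) ` (S \<times> {0..1})"

lemma hausdorff_premeasure_mono:
  assumes "A \<subseteq> B"
  shows "hausdorff_premeasure \<delta> s A \<le> hausdorff_premeasure \<delta> s B"
  unfolding hausdorff_premeasure_def
  by (rule INF_superset_mono) (use assms in auto)

lemma hausdorff_measure_mono:
  assumes "A \<subseteq> B"
  shows "hausdorff_measure s A \<le> hausdorff_measure s B"
  unfolding hausdorff_measure_def
  by (rule SUP_mono) (use hausdorff_premeasure_mono[OF assms] in auto)

lemma hausdorff_premeasure_le_card:
  fixes X :: "'a::euclidean_space set"
  assumes "finite X" "S \<subseteq>
      (\<Union>x\<in>X. cball x \<epsilon>)" "0 < \<epsilon>" "2 * \<epsilon> \<le> \<delta>"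
  shows "hausdorff_premeasure \<delta> s S \<le>
      ennreal (card X * (unit_ball_vol (real s) * \<epsilon> ^ s))"
proof -
  obtain f where f: "bij_betw f {..<card X} X"
    using ex_bij_betw_nat_finite[OF assms(1)] by (auto simp: lessThan_atLeast0)
  define U where "U i = (if i < card X then cball (f i) \<epsilon> else {})" for i
  define g where "g i = (if U i = {} then 0
      else ennreal (unit_ball_vol (real s) * (diameter (U i) / 2) ^ s))" for i
  have "S \<subseteq> (\<Union>i. U i)"
  proof
    fix s assume "s \<in> S"
    then obtain x where x: "x \<in> X" "s \<in> cball x \<epsilon>" using assms(2) by blast
    have "x \<in> f ` {..<card X}" using f x(1) by (simp add: bij_betw_def)
    then obtain i where "i < card X" "f i = x" by auto
    then show "s \<in> (\<Union>i. U i)" using x by (auto simp: U_def intro!: exI[of _ i])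
  qed
  moreover have "bounded (U i) \<and> diameter (U i) \<le> \<delta>" for i
    using assms(3,4) by (auto simp: U_def diameter_cball)
  ultimately have "hausdorff_premeasure \<delta> s S \<le> (\<Sum>i. g i)"
    unfolding hausdorff_premeasure_def g_def by (intro INF_lower) auto
  also have "(\<Sum>i. g i) = (\<Sum>i<card X. g i)"
    by (rule suminf_finite) (auto simp: g_def U_def)
  also have "\<dots> = (\<Sum>i<card X. ennreal (unit_ball_vol (real s) * \<epsilon> ^ s))"
    using assms(3) by (intro sum.cong) (auto simp: g_def U_def diameter_cball)
  also have "\<dots> = ennreal (card X * (unit_ball_vol (real s) * \<epsilon> ^ s))"
    using assms(3) by (simp add: ennreal_mult ennreal_of_nat_eq_real_of_nat)
  finally show ?thesis .
qed

lemma compact_slab: "compact S \<Longrightarrow> compact (slab n S)"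
  unfolding slab_def
  by (intro compact_continuous_image compact_Times continuous_intros)
     (auto simp: case_prod_beta intro!: continuous_intros)

lemma lmeasurable_slab: "compact S \<Longrightarrow> slab n S \<in> lmeasurable"
  by (simp add: compact_slab lmeasurable_compact)

text \<open>
  A packing bound. Above each point of an \<open>\<epsilon>\<close>-separated subset of a
  hyperplane one can stack about \<open>1 / \<epsilon>\<close> balls of radius \<open>\<epsilon>
  / 2\<close> along the normal, and all these balls are disjoint and close to the slab. Their
  volumes thus count the points, and one power of \<open>\<epsilon>\<close> is gained, as it
  should be for a set of codimension one. Working with balls avoids coordinates adapted to the
  hyperplane.
\<close>

lemma card_separated_le_slab:
  fixes n :: "'a::euclidean_space" and \<epsilon> :: real
  assumes n: "norm n = 1" and S: "S \<subseteq> {x. n \<bullet> x = c}"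
      and X: "finite X" "X \<subseteq> S"
    and sep: "\<And>x y. x \<in> X \<Longrightarrow> y \<in> X \<Longrightarrow>
        x \<noteq> y \<Longrightarrow> \<epsilon> \<le> dist x y"
    and \<epsilon>: "0 < \<epsilon>" and V: "V \<in> lmeasurable"
        and sub: "(\<Union>y\<in>slab n S. ball y \<epsilon>) \<subseteq> V"
  shows "card X * \<epsilon> ^ (DIM('a) - 1) \<le> 2 ^ DIM('a) / unit_ball_vol DIM('a) * measure lebesgue V"
proof -
  define J where "J = nat \<lfloor>1 / \<epsilon>\<rfloor>"
  define q where "q = (\<lambda>(x, j). x + (real j * \<epsilon>) *\<^sub>R n)"
  \<comment> \<open>the ball at height \<open>j \<epsilon>\<close> above \<open>x\<close>; two
    centers differ by at least \<open>\<epsilon>\<close> in height or horizontally\<close>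
  define B where "B p = ball (q p) (\<epsilon> / 2)" for p
  have J1: "real j * \<epsilon> \<le> 1" if "j \<le> J" for j
  proof -
    have "real j \<le> 1 / \<epsilon>" using that \<epsilon> unfolding J_def
      by (simp add: le_nat_floor le_nat_iff le_floor_iff)
    then show ?thesis using \<epsilon> by (simp add: field_simps)
  qed
  have J2: "1 \<le> (real J + 1) * \<epsilon>"
  proof -
    have "1 / \<epsilon> \<le> real J + 1" using \<epsilon> unfolding J_def by linarith
    then show ?thesis using \<epsilon> by (simp add: field_simps)
  qed
  have far: "\<epsilon> \<le> dist (q (x, i)) (q (y, j))"
      if "x \<in> X" "y \<in> X" "(x, i) \<noteq> (y, j)" for x y i j
  proof -
    have nx: "n \<bullet> (x - y) = 0" using that S X(2) by (auto simp: inner_diff_right)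
    have e: "q (x, i) - q (y, j) = (x - y) + ((real i - real j) * \<epsilon>) *\<^sub>R n"
      by (simp add: q_def algebra_simps)
    have "(dist (q (x, i)) (q (y, j)))\<^sup>2 =
        (norm (x - y))\<^sup>2 + ((real i - real j) * \<epsilon>)\<^sup>2"
      unfolding dist_norm e using nx n
      by (simp only: power2_norm_eq_inner)
         (simp add: inner_add inner_commute power2_eq_square norm_eq_1)
    also have "\<dots> \<ge> \<epsilon>\<^sup>2"
    proof (cases "x = y")
      case True
      then have "1 \<le> \<bar>real i - real j\<bar>" using that by auto
      then have "1 \<le> (real i - real j)\<^sup>2"
        using power_mono[of 1 "\<bar>real i - real j\<bar>" 2] by simp
      then have "1 * \<epsilon>\<^sup>2 \<le> (real i - real j)\<^sup>2 * \<epsilon>\<^sup>2"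
        by (intro mult_right_mono) auto
      then show ?thesis by (simp add: power_mult_distrib add_increasing)
    next
      case False
      then have "\<epsilon> \<le> norm (x - y)" using sep[OF that(1,2)] by (simp add: dist_norm)
      then have "\<epsilon>\<^sup>2 \<le> (norm (x - y))\<^sup>2" using \<epsilon>
        by (intro power_mono) auto
      then show ?thesis by (simp add: add_increasing2)
    qed
    finally show ?thesis by (rule power2_le_imp_le) simp
  qed
  define P where "P = X \<times> {..J}"
  have finP: "finite P" using X(1) by (simp add: P_def)
  have disj: "disjoint_family_on B P"
    unfolding disjoint_family_on_def
  proof (intro ballI impI)
    fix a b assume *: "a \<in> P" "b \<in> P" "a \<noteq> b"
    then have d: "\<epsilon> \<le> dist (q a) (q b)" using far[of "fst a" "fst b" "snd a" "snd b"]
      by (auto simp: P_def)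
    have "False" if z: "z \<in> B a" "z \<in> B b" for z
    proof -
      have "dist (q a) z < \<epsilon> / 2" "dist (q b) z < \<epsilon> / 2" using z by (auto simp: B_def)
      then show False using d dist_triangle2[of "q a" "q b" z] by linarith
    qed
    then show "B a \<inter> B b = {}" by auto
  qed
  have "real (card P) * (unit_ball_vol DIM('a) * (\<epsilon> / 2) ^ DIM('a)) =
      (\<Sum>p\<in>P. measure lebesgue (B p))"
    using \<epsilon> by (simp add: B_def content_ball)
  also have "\<dots> = measure lebesgue (\<Union>p\<in>P. B p)"
  proof (rule measure_UNION'[symmetric, OF finP])
    show "pairwise (\<lambda>a b. disjnt (B a) (B b)) P"
      using disj by (auto simp: pairwise_def disjnt_def disjoint_family_on_def)
  qed (auto simp: B_def)
  also have "\<dots> \<le> measure lebesgue V"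
  proof (rule measure_mono_fmeasurable)
    show "(\<Union>p\<in>P. B p) \<subseteq> V"
    proof -
      have "B p \<subseteq> V" if "p \<in> P" for p
      proof -
        have "q p \<in> slab n S" using that X(2) J1[of "snd p"] \<epsilon>
          by (auto simp: P_def q_def slab_def intro!: image_eqI[where x = "(fst p, real (snd p) * \<epsilon>)"])
        then show ?thesis using sub \<epsilon> subset_ball[of "\<epsilon> / 2" \<epsilon> "q p"]
          unfolding B_def by auto
      qed
      then show ?thesis by auto
    qed
  qed (use finP V in \<open>auto simp: B_def\<close>)
  finally have 1: "real (card X) * (real J + 1) * (unit_ball_vol DIM('a) * (\<epsilon> / 2) ^ DIM('a)) \<le>
      measure lebesgue V"
    using X(1) by (simp add: P_def algebra_simps)
  obtain w where w: "w = unit_ball_vol (real DIM('a))" "w \<noteq> 0"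
    using unit_ball_vol_pos[of "real DIM('a)"] by (metis less_irrefl of_nat_0_le_iff)
  have dd: "\<epsilon> ^ DIM('a) = \<epsilon> * \<epsilon> ^ (DIM('a) - 1)" by (simp add: power_eq_if)
  have "card X * \<epsilon> ^ (DIM('a) - 1) * 1 \<le>
      card X * \<epsilon> ^ (DIM('a) - 1) * ((real J + 1) * \<epsilon>)"
    using J2 \<epsilon> by (intro mult_left_mono) auto
  also have "\<dots> = 2 ^ DIM('a) / unit_ball_vol DIM('a) *
      (real (card X) * (real J + 1) * (unit_ball_vol DIM('a) * (\<epsilon> / 2) ^ DIM('a)))"
    using w(2) \<epsilon> unfolding w(1)[symmetric] by (simp add: power_divide dd field_simps)
  also have "\<dots> \<le> 2 ^ DIM('a) / unit_ball_vol DIM('a) * measure lebesgue V"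
    using 1 by (intro mult_left_mono) auto
  finally show ?thesis by simp
qed

text \<open>
  A separated set of largest cardinality is a net: a point far from all of its members could be
  added.
\<close>

lemma maximal_net:
  fixes S :: "'a::metric_space set" and b :: nat and \<epsilon> :: real
  assumes "0 < \<epsilon>" and bd: "\<And>X. finite X \<Longrightarrow> X \<subseteq> S \<Longrightarrow>
      (\<And>x y. x \<in> X \<Longrightarrow> y \<in> X \<Longrightarrow> x \<noteq> y \<Longrightarrow> \<epsilon> \<le> dist x y) \<Longrightarrow> card X \<le> b"
  obtains X where "finite X" "X \<subseteq> S"
    "\<And>x y. x \<in> X \<Longrightarrow> y \<in> X \<Longrightarrow> x \<noteq> y \<Longrightarrow>
        \<epsilon> \<le> dist x y" "S \<subseteq> (\<Union>x\<in>X. cball x \<epsilon>)"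
proof -
  define P where "P X \<longleftrightarrow> finite X \<and> X \<subseteq> S \<and>
      (\<forall>x\<in>X. \<forall>y\<in>X. x \<noteq> y \<longrightarrow> \<epsilon> \<le> dist x y)"
      for X
  have "P {}" by (simp add: P_def)
  moreover have "\<forall>X. P X \<longrightarrow> card X < Suc b" using bd
    by (auto simp: P_def less_Suc_eq_le)
  ultimately obtain X where X: "P X" "\<And>Y. P Y \<Longrightarrow> card Y \<le> card X"
    using ex_has_greatest_nat[of P "{}" card "Suc b"] by (metis less_imp_le)
  have "S \<subseteq> (\<Union>x\<in>X. cball x \<epsilon>)"
  proof (rule ccontr)
    assume "\<not> S \<subseteq> (\<Union>x\<in>X. cball x \<epsilon>)"
    then obtain s where s: "s \<in> S" "\<And>x. x \<in> X \<Longrightarrow> \<epsilon> < dist x s"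
      by (auto simp: subset_iff not_le)
    then have "P (insert s X)" using X(1)
      by (auto simp: P_def dist_commute intro: less_imp_le)
    moreover have "s \<notin> X" using s(2)[of s] assms(1) by auto
    ultimately show False using X(2)[of "insert s X"] X(1) by (simp add: P_def)
  qed
  then show ?thesis using that X(1) by (auto simp: P_def)
qed

text \<open>
  The covering counterpart of the packing bound. The slab is compact, so by outer regularity its
  small neighbourhoods have volume close to that of the slab itself; this controls the size of a
  maximal \<open>\<epsilon>\<close>-net for all small \<open>\<epsilon>\<close>. Having it for
  all of them allows one \<open>\<epsilon>\<close> for finitely many sets.
\<close>

lemma slab_net:
  fixes n :: "'a::euclidean_space"
  assumes "compact S" "norm n = 1" "S \<subseteq> {x. n \<bullet> x = c}" "0 < e"
  shows "\<forall>\<^sub>F \<epsilon> in at_right (0::real). \<exists>X. finite X \<and> S \<subseteq>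
      (\<Union>x\<in>X. cball x \<epsilon>) \<and>
     card X * \<epsilon> ^ (DIM('a) - 1) \<le> 2 ^ DIM('a) / unit_ball_vol DIM('a) * (measure lebesgue (slab n S) + e)"
proof -
  have m: "slab n S \<in> lmeasurable" by (rule lmeasurable_slab[OF assms(1)])
  obtain V where V: "open V" "slab n S \<subseteq> V" "V - slab n S \<in> lmeasurable"
      "emeasure lebesgue (V - slab n S) < ennreal e"
    using sets_lebesgue_outer_open[OF fmeasurableD[OF m] assms(4)] by metis
  have Veq: "V = slab n S \<union> (V - slab n S)" using V(2) by auto
  have Vm: "V \<in> lmeasurable" by (subst Veq) (rule fmeasurable.Un[OF m V(3)])
  have "measure lebesgue (V - slab n S) \<le> e"
    using V(3,4) assms(4) by (simp add: emeasure_eq_measure2 ennreal_less_iff less_imp_le)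
  then have mV: "measure lebesgue V \<le> measure lebesgue (slab n S) + e"
    using measure_Un_le[OF fmeasurableD[OF m] fmeasurableD[OF V(3)]] Veq by simp
  obtain \<epsilon>0 where \<epsilon>0: "\<epsilon>0 > 0" "(\<Union>y\<in>slab n S. ball y \<epsilon>0) \<subseteq>
      V"
    using compact_subset_open_imp_ball_epsilon_subset[OF compact_slab[OF assms(1)] V(1,2)] by metis
  have main: "\<exists>X. finite X \<and> S \<subseteq> (\<Union>x\<in>X. cball x \<epsilon>) \<and>
     card X * \<epsilon> ^ (DIM('a) - 1) \<le> 2 ^ DIM('a) / unit_ball_vol DIM('a) * (measure lebesgue (slab n S) + e)"
    if \<epsilon>: "0 < \<epsilon>" "\<epsilon> < \<epsilon>0" for \<epsilon> :: real
  proof -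
    let ?c = "2 ^ DIM('a) / unit_ball_vol DIM('a) * measure lebesgue V"
    have sub: "(\<Union>y\<in>slab n S. ball y \<epsilon>) \<subseteq> V"
      by (rule order_trans[OF UN_mono[OF order_refl subset_ball[OF less_imp_le[OF \<epsilon>(2)]]] \<epsilon>0(2)])
    note bd = card_separated_le_slab[OF assms(2,3) _ _ _ \<epsilon>(1) Vm sub]
    have pw: "\<epsilon> ^ (DIM('a) - 1) > 0" using \<epsilon> by simp
    obtain X where X: "finite X" "X \<subseteq> S"
       "\<And>x y. x \<in> X \<Longrightarrow> y \<in> X \<Longrightarrow>
           x \<noteq> y \<Longrightarrow> \<epsilon> \<le> dist x y" "S \<subseteq>
   (\<Union>x\<in>X. cball x \<epsilon>)"
    proof (rule maximal_net[OF \<epsilon>(1), of S "nat \<lceil>?c / \<epsilon> ^ (DIM('a) - 1)\<rceil>"])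
      fix X assume X: "finite X" "X \<subseteq> S" "\<And>x y. x \<in> X \<Longrightarrow>
          y \<in> X \<Longrightarrow> x \<noteq> y \<Longrightarrow> \<epsilon> \<le> dist x y"
      have "real (card X) \<le> ?c / \<epsilon> ^ (DIM('a) - 1)"
        using bd[OF X] pw by (simp add: field_simps)
      then show "card X \<le> nat \<lceil>?c / \<epsilon> ^ (DIM('a) - 1)\<rceil>" by linarith
    qed auto
    have "card X * \<epsilon> ^ (DIM('a) - 1) \<le> ?c" by (rule bd[OF X(1-3)])
    also have "\<dots> \<le> 2 ^ DIM('a) / unit_ball_vol DIM('a) * (measure lebesgue (slab n S) + e)"
      using mV by (intro mult_left_mono) auto
    finally show ?thesis using X(1,4) by (intro exI[of _ X] conjI)
  qed
  show ?thesis
    unfolding eventually_at_right_field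
      by (rule exI[of _ \<epsilon>0]) (use main \<epsilon>0(1) in metis)
qed

text \<open>
  The loss comes from covering with balls of radius \<open>\<epsilon>\<close> while packing
  balls of radius \<open>\<epsilon> / 2\<close>.
\<close>

definition surface_const :: "'a::euclidean_space itself \<Rightarrow> real" where
  "surface_const _ = unit_ball_vol (DIM('a) - 1) * 2 ^ DIM('a) / unit_ball_vol DIM('a)"

lemma surface_const_pos: "surface_const TYPE('a::euclidean_space) > 0"
  using unit_ball_vol_pos[of "real DIM('a)"] unit_ball_vol_pos[of "real DIM('a) - 1"]
  by (simp add: surface_const_def of_nat_diff)

text \<open>
  The central comparison of surface and volume. It has three uses: the finiteness of the area of
  a face, the fact that a face whose slab is negligible would have area zero, and the bound on
  the total area of the boundary faces. The last one needs several hyperplanes at once, since a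
  boundary face is only known to lie in the union of the boundary hyperplanes of
  \<open>\<Omega>\<close>.
\<close>

lemma surface_measure_le_slabs:
  fixes S :: "'i \<Rightarrow> 'a::euclidean_space set"
  assumes I: "finite I" and cp: "\<And>i. i \<in> I \<Longrightarrow> compact (S i)"
      and n: "\<And>i. i \<in> I \<Longrightarrow> norm (n i) = 1"
    and hyp: "\<And>i. i \<in> I \<Longrightarrow> S i \<subseteq> {x. n i \<bullet> x = c i}"
        and T: "T \<subseteq> (\<Union>i\<in>I. S i)"
  shows "surface_measure T \<le>
      ennreal (surface_const TYPE('a) * (\<Sum>i\<in>I. measure lebesgue (slab (n i) (S i))))"
  unfolding hausdorff_measure_def
proof (rule SUP_least)
  let ?s = "DIM('a) - 1" and ?C = "surface_const TYPE('a)"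
      and ?m = "\<lambda>i. measure lebesgue (slab (n i) (S i))"
  have C: "?C > 0" by (rule surface_const_pos)
  fix \<delta> :: real assume "\<delta> \<in> {0<..}"
  then have \<delta>: "\<delta> > 0" by simp
  show "hausdorff_premeasure \<delta> ?s T \<le> ennreal (?C * (\<Sum>i\<in>I. ?m i))"
  proof (rule ennreal_le_epsilon)
    fix e :: real assume e: "0 < e"
    define e1 where "e1 = e / (?C * (card I + 1))"
    have e1: "e1 > 0" using e C by (simp add: e1_def)
    have "\<forall>\<^sub>F \<epsilon> in at_right (0::real). \<forall>i\<in>I. \<exists>X. finite X \<and>
        S i \<subseteq> (\<Union>x\<in>X. cball x \<epsilon>) \<and>
      card X * \<epsilon> ^ ?s \<le> 2 ^ DIM('a) / unit_ball_vol DIM('a) * (?m i + e1)"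
      by (intro eventually_ball_finite I ballI slab_net[OF cp n hyp e1])
    moreover have "\<forall>\<^sub>F \<epsilon> in at_right (0::real). 0 < \<epsilon> \<and>
        \<epsilon> < \<delta> / 2"
      using eventually_at_right_real[of 0 "\<delta> / 2"] \<delta> by simp
    ultimately have "\<forall>\<^sub>F \<epsilon> in at_right (0::real). (0 < \<epsilon> \<and>
        \<epsilon> < \<delta> / 2) \<and> (\<forall>i\<in>I. \<exists>X. finite X \<and>
   S i \<subseteq> (\<Union>x\<in>X. cball x \<epsilon>) \<and>
      card X * \<epsilon> ^ ?s \<le> 2 ^ DIM('a) / unit_ball_vol DIM('a) * (?m i + e1))"
      by eventually_elim simp
    from eventually_happens'[OF _ this] obtain \<epsilon> :: real where \<epsilon>: "0 < \<epsilon>" "\<epsilon> < \<delta> / 2"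
      and "\<forall>i\<in>I. \<exists>X. finite X \<and> S i \<subseteq>
          (\<Union>x\<in>X. cball x \<epsilon>) \<and>
        card X * \<epsilon> ^ ?s \<le> 2 ^ DIM('a) / unit_ball_vol DIM('a) * (?m i + e1)" by auto
    then obtain X where X: "\<And>i. i \<in> I \<Longrightarrow>
        finite (X i)" "\<And>i. i \<in> I \<Longrightarrow> S i \<subseteq>
   (\<Union>x\<in>X i. cball x \<epsilon>)"
      "\<And>i. i \<in> I \<Longrightarrow> card (X i) * \<epsilon> ^ ?s \<le>
          2 ^ DIM('a) / unit_ball_vol DIM('a) * (?m i + e1)"
        by metis
    define Y where "Y = (\<Union>i\<in>I. X i)"
    have "T \<subseteq> (\<Union>x\<in>Y. cball x \<epsilon>)"
    proof
      fix t assume "t \<in> T"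
      then obtain i where i: "i \<in> I" "t \<in> S i" using T by blast
      then obtain x where "x \<in> X i" "t \<in> cball x \<epsilon>" using X(2) by blast
      then show "t \<in> (\<Union>x\<in>Y. cball x \<epsilon>)" using i unfolding Y_def by blast
    qed
    then have "hausdorff_premeasure \<delta> ?s T \<le>
        ennreal (card Y * (unit_ball_vol (real ?s) * \<epsilon> ^ ?s))"
      by (intro hausdorff_premeasure_le_card) (use I X(1) \<epsilon> in \<open>auto simp: Y_def\<close>)
    also have "card Y * (unit_ball_vol (real ?s) * \<epsilon> ^ ?s) \<le> (\<Sum>i\<in>I. ?C * (?m i + e1))"
    proof -
      have "real (card Y) * \<epsilon> ^ ?s \<le> (\<Sum>i\<in>I. real (card (X i))) * \<epsilon> ^ ?s"
        using card_UN_le[OF I, of X] \<epsilon>(1)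
          by (intro mult_right_mono) (auto simp: Y_def simp flip: of_nat_sum)
      also have "\<dots> \<le> (\<Sum>i\<in>I. 2 ^ DIM('a) / unit_ball_vol DIM('a) * (?m i + e1))"
        unfolding sum_distrib_right by (intro sum_mono X(3))
      finally have "unit_ball_vol (real ?s) * (real (card Y) * \<epsilon> ^ ?s) \<le>
          unit_ball_vol (real ?s) * (\<Sum>i\<in>I. 2 ^ DIM('a) / unit_ball_vol DIM('a) * (?m i + e1))"
        by (intro mult_left_mono) auto
      also have "\<dots> = (\<Sum>i\<in>I. ?C * (?m i + e1))"
        by (simp add: surface_const_def sum_distrib_left of_nat_diff mult_ac)
      finally show ?thesis by (simp add: mult_ac)
    qed
    also have "(\<Sum>i\<in>I. ?C * (?m i + e1)) = ?C * (\<Sum>i\<in>I. ?m i) + ?C * card I * e1"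
      by (simp add: sum.distrib sum_distrib_left distrib_left)
    also have "?C * card I * e1 \<le> e"
    proof -
      have "?C * card I * e1 = e * (real (card I) / (real (card I) + 1))"
        using C by (simp add: e1_def mult_ac add_ac)
      also have "\<dots> \<le> e * 1" using e by (intro mult_left_mono) auto
      finally show ?thesis by simp
    qed
    finally show "hausdorff_premeasure \<delta> ?s T \<le> ennreal (?C * (\<Sum>i\<in>I. ?m i)) + ennreal e"
      using e C by (simp add: ennreal_plus[symmetric] sum_nonneg ennreal_leI del: ennreal_plus)
  qed
qed

section \<open>Lipschitz strips over sets of surface measure zero\<close>

text \<open>
  Diameters of covering sets may vanish, and \<open>0 ^ 0 = 1\<close> occurs in dimension one.
  Enlarging each diameter slightly makes it positive at an arbitrarily small cost.
\<close>

lemma power_approx_above: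
  fixes x \<eta> :: real
  assumes "0 \<le> x" "x \<le> 1" "0 < \<eta>"
  shows "\<exists>r. x \<le> r \<and> 0 < r \<and> r \<le> 2 \<and> r ^ s \<le> x ^ s + \<eta>"
proof -
  have "((\<lambda>r. r ^ s) \<longlongrightarrow> x ^ s) (at_right x)" by (intro tendsto_intros)
  then have "\<forall>\<^sub>F r in at_right x. r ^ s < x ^ s + \<eta>"
    by (rule order_tendstoD) (use assms in simp)
  moreover have "\<forall>\<^sub>F r in at_right x. x < r \<and> r < x + 1"
    using eventually_at_right_real[of x "x + 1"] by simp
  ultimately have "\<forall>\<^sub>F r in at_right x. r ^ s < x ^ s + \<eta> \<and> x < r \<and> r < x + 1"
    by eventually_elim simp
  from eventually_happens'[OF _ this] obtain r where "r ^ s < x ^ s + \<eta>" "x < r" "r < x + 1" by auto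
  then show ?thesis using assms by (intro exI[of _ r]) auto
qed

text \<open>
  Over a set of diameter at most \<open>r\<close>, about \<open>T / r\<close> balls of radius
  proportional to \<open>r\<close>, centred on the curve that starts at one point of the set,
  cover the curves that start at all the others.
\<close>

lemma lipschitz_strip_cover:
  fixes f :: "'a::euclidean_space \<Rightarrow> real \<Rightarrow> 'a"
  assumes lip: "\<And>s s' t t'. s \<in> S \<Longrightarrow> s' \<in> S \<Longrightarrow>
      t \<in> {0..T} \<Longrightarrow> t' \<in> {0..T} \<Longrightarrow>
      dist (f s t) (f s' t') \<le> B * (dist s s' + \<bar>t - t'\<bar>)"
    and B: "0 \<le> B" and T: "0 \<le> T" and r: "0 < r" "r \<le> 2"
    and U: "\<And>s s'. s \<in> S \<Longrightarrow> s' \<in> S \<Longrightarrow> dist s s' \<le> r"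
  shows "\<exists>W\<in>lmeasurable. (\<Union>s\<in>S. f s ` {0..T}) \<subseteq> W \<and>
    measure lebesgue W \<le> (T + 2) * unit_ball_vol DIM('a) * (2 * B) ^ DIM('a) * r ^ (DIM('a) - 1)"
proof (cases "S = {}")
  case True
  then show ?thesis using T B r by (intro bexI[of _ "{}"]) auto
next
  case False
  then obtain s0 where s0: "s0 \<in> S" by auto
  define J where "J = nat \<lfloor>T / r\<rfloor>"
  define W where "W = (\<Union>j\<in>{..J}. cball (f s0 (real j * r)) (2 * B * r))"
  have J1: "real j * r \<le> t" if "j \<le> nat \<lfloor>t / r\<rfloor>" "0 \<le> t" for j t
  proof -
    have "real j \<le> t / r" using that r by (simp add: le_nat_floor le_nat_iff le_floor_iff)
    then show ?thesis using r by (simp add: field_simps)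
  qed
  have Wm: "W \<in> lmeasurable" unfolding W_def by (intro fmeasurable.finite_UN) auto
  have "(\<Union>s\<in>S. f s ` {0..T}) \<subseteq> W"
  proof clarify
    fix s t assume s: "s \<in> S" and t: "t \<in> {0..T}"
    define j where "j = nat \<lfloor>t / r\<rfloor>"
    have j: "real j * r \<le> t" using J1[of j t] t by (simp add: j_def)
    have "t / r \<le> real j + 1" using t r unfolding j_def by linarith
    then have j': "t \<le> real j * r + r" using r by (simp add: field_simps)
    have "j \<le> J" using t r unfolding j_def J_def
      by (intro nat_mono floor_mono divide_right_mono) auto
    moreover have "dist (f s0 (real j * r)) (f s t) \<le> B * (dist s0 s + \<bar>real j * r - t\<bar>)"
      using s s0 t j r by (intro lip) auto
    moreover have "\<dots> \<le> B * (r + r)"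
      using U[OF s0 s] j j' B by (intro mult_left_mono add_mono) auto
    ultimately show "f s t \<in> W" unfolding W_def by (auto intro!: bexI[of _ j])
  qed
  moreover have "measure lebesgue W \<le>
      (T + 2) * unit_ball_vol DIM('a) * (2 * B) ^ DIM('a) * r ^ (DIM('a) - 1)"
  proof -
    have "measure lebesgue W \<le>
        (\<Sum>j\<le>J. measure lebesgue (cball (f s0 (real j * r)) (2 * B * r)))"
      unfolding W_def by (rule measure_UNION_le) auto
    also have "\<dots> = (real J + 1) * (unit_ball_vol DIM('a) * (2 * B * r) ^ DIM('a))"
      using B r by (simp add: content_cball)
    also have "\<dots> = ((real J + 1) * r) * (unit_ball_vol DIM('a) * (2 * B) ^ DIM('a) * r ^ (DIM('a) - 1))"
      by (simp add: power_mult_distrib power_eq_if[of r "DIM('a)"] mult_ac)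
    also have "\<dots> \<le> (T + 2) * (unit_ball_vol DIM('a) * (2 * B) ^ DIM('a) * r ^ (DIM('a) - 1))"
    proof (rule mult_right_mono)
      have "real J * r \<le> T" using J1[of J T] T by (simp add: J_def)
      then show "(real J + 1) * r \<le> T + 2" using r by (simp add: algebra_simps)
    qed (use B r in auto)
    finally show ?thesis by (simp add: mult_ac)
  qed
  ultimately show ?thesis using Wm by blast
qed

text \<open>
  Covering each set of an efficient Hausdorff cover by balls as above gives a cover of the strip
  with total volume proportional to the Hausdorff sum: the \<open>d\<close>-th powers of the
  radii times the number \<open>1 / r\<close> of balls are again \<open>(d - 1)\<close>-th
  powers.
\<close>

lemma negligible_lipschitz_strip:
  fixes f :: "'a::euclidean_space \<Rightarrow> real \<Rightarrow> 'a"
  assumes null: "surface_measure S = 0"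
    and lip: "\<And>s s' t t'. s \<in> S \<Longrightarrow> s' \<in> S \<Longrightarrow>
        t \<in> {0..T} \<Longrightarrow> t' \<in> {0..T} \<Longrightarrow>
      dist (f s t) (f s' t') \<le> B * (dist s s' + \<bar>t - t'\<bar>)"
    and B: "0 \<le> B" and T: "0 \<le> T"
  shows "negligible (\<Union>s\<in>S. f s ` {0..T})"
  unfolding negligible_outer_le
proof (intro allI impI)
  let ?s = "DIM('a) - 1"
  define \<omega> where "\<omega> = unit_ball_vol (real ?s)"
  have \<omega>: "\<omega> > 0" by (simp add: \<omega>_def)
  define K where "K = (T + 2) * unit_ball_vol DIM('a) * (2 * B) ^ DIM('a)"
  have K: "K \<ge> 0" using T B by (simp add: K_def)
  \<comment> \<open>\<open>K\<close> bounds volumes by powers of diameters, \<open>K2\<close> by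
    the terms \<open>a U\<close> of the Hausdorff sum\<close>
  define K2 where "K2 = K * 2 ^ ?s / \<omega>"
  have K2: "K2 \<ge> 0" using K \<omega> by (simp add: K2_def)
  fix e0 :: real assume e0: "0 < e0"
  define e where "e = e0 / (K2 + K + 1)"
  have e: "e > 0" using e0 K K2 by (simp add: e_def)
  define a where "a U = (if U = {} then 0 else ennreal (unit_ball_vol (real ?s) * (diameter U / 2) ^ ?s))"
    for U :: "'a set"
  have "hausdorff_premeasure 1 ?s S \<le> surface_measure S"
    unfolding hausdorff_measure_def by (rule SUP_upper) simp
  then have "hausdorff_premeasure 1 ?s S < ennreal e" using null e by simp
  then obtain U :: "nat \<Rightarrow> 'a set" where U: "S \<subseteq> (\<Union>i. U i)"
      "\<And>i. bounded (U i)" "\<And>i. diameter (U i) \<le> 1"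
          and Usum: "(\<Sum>i. a (U i)) < ennreal e"
    unfolding hausdorff_premeasure_def INF_less_iff a_def by auto
  have "\<exists>r. diameter (U i) \<le> r \<and> 0 < r \<and> r \<le> 2 \<and> r ^ ?s \<le>
      diameter (U i) ^ ?s + e * (1/2) ^ Suc i"
      for i
    using U e by (intro power_approx_above diameter_ge_0) auto
  then obtain r where r: "\<And>i. diameter (U i) \<le> r i" "\<And>i. 0 < r i" "\<And>i. r i \<le> 2"
      "\<And>i. r i ^ ?s \<le> diameter (U i) ^ ?s + e * (1/2) ^ Suc i" by metis
  have "\<exists>W\<in>lmeasurable. (\<Union>s\<in>S \<inter> U i. f s ` {0..T}) \<subseteq> W \<and>
      emeasure lebesgue W \<le>
      ennreal K2 * a (U i) + ennreal (K * e * (1/2) ^ Suc i)" for i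
  proof (cases "U i = {}")
    case True
    then show ?thesis by (intro bexI[of _ "{}"]) auto
  next
    case False
    have "\<exists>W\<in>lmeasurable. (\<Union>s\<in>S \<inter> U i. f s ` {0..T}) \<subseteq> W \<and>
        measure lebesgue W \<le> K * r i ^ ?s"
      unfolding K_def
    proof (rule lipschitz_strip_cover)
      fix s s' assume "s \<in> S \<inter> U i" "s' \<in> S \<inter> U i"
      then show "dist s s' \<le> r i" using diameter_bounded_bound[OF U(2), of s i s'] r(1)[of i] by auto
    qed (use lip B T r in auto)
    then obtain W where W: "W \<in> lmeasurable" "(\<Union>s\<in>S \<inter> U i. f s ` {0..T}) \<subseteq>
        W"
      "measure lebesgue W \<le> K * r i ^ ?s" by blast
    have "measure lebesgue W \<le> K * (diameter (U i) ^ ?s + e * (1/2) ^ Suc i)"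
      using W(3) mult_left_mono[OF r(4)[of i] K] by linarith
    also have "\<dots> = K2 * (\<omega> * (diameter (U i) / 2) ^ ?s) + K * e * (1/2) ^ Suc i"
      using \<omega> by (simp add: K2_def power_divide field_simps)
    finally have "emeasure lebesgue W \<le>
        ennreal (K2 * (\<omega> * (diameter (U i) / 2) ^ ?s) + K * e * (1/2) ^ Suc i)"
      using W(1) by (simp add: emeasure_eq_measure2 ennreal_leI)
    also have "\<dots> = ennreal K2 * a (U i) + ennreal (K * e * (1/2) ^ Suc i)"
      using False K K2 e \<omega> diameter_ge_0[OF U(2), of i]
      by (simp add: a_def ennreal_mult \<omega>_def)
    finally show ?thesis using W by blast
  qed
  then obtain W where W: "\<And>i. W i \<in> lmeasurable" "\<And>i. (\<Union>s\<in>S \<inter> U i. f s ` {0..T}) \<subseteq>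
      W i"
    "\<And>i. emeasure lebesgue (W i) \<le> ennreal K2 * a (U i) + ennreal (K * e * (1/2) ^ Suc i)"
      by metis
  have geo: "(\<Sum>i. ennreal (K * e * (1/2) ^ Suc i)) = ennreal (K * e)"
  proof -
    have "(\<lambda>i. K * e * (1/2) ^ Suc i) sums (K * e * 1)"
      by (intro sums_mult power_half_series)
    then show ?thesis using K e by (subst suminf_ennreal_eq[of _ "K * e"]) auto
  qed
  have "emeasure lebesgue (\<Union>i. W i) \<le> (\<Sum>i. emeasure lebesgue (W i))"
    by (rule emeasure_subadditive_countably) (use W(1) in auto)
  also have "\<dots> \<le> (\<Sum>i. ennreal K2 * a (U i) + ennreal (K * e * (1/2) ^ Suc i))"
    by (intro suminf_le W(3)) auto
  also have "\<dots> = ennreal K2 * (\<Sum>i. a (U i)) + ennreal (K * e)"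
    by (subst suminf_add[symmetric]) (auto simp only: geo ennreal_suminf_cmult summableI)
  also have "\<dots> \<le> ennreal K2 * ennreal e + ennreal (K * e)"
    using Usum by (intro add_right_mono mult_left_mono) auto
  also have "\<dots> = ennreal ((K2 + K) * e)"
    using K K2 e by (simp add: ennreal_mult[symmetric] ennreal_plus[symmetric] distrib_right del: ennreal_plus)
  finally have em: "emeasure lebesgue (\<Union>i. W i) \<le> ennreal ((K2 + K) * e)" .
  have lm: "(\<Union>i. W i) \<in> lmeasurable"
  proof (rule fmeasurableI)
    show "(\<Union>i. W i) \<in> sets lebesgue" using W(1) by (auto simp: fmeasurableD)
    show "emeasure lebesgue (\<Union>i. W i) < \<infinity>" using em by (simp add: order_le_less_trans)
  qed
  have "measure lebesgue (\<Union>i. W i) \<le> (K2 + K) * e"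
    using em lm K K2 e by (simp add: emeasure_eq_measure2)
  also have "\<dots> \<le> e0" using e0 K K2 by (simp add: e_def field_simps)
  finally have "measure lebesgue (\<Union>i. W i) \<le> e0" .
  moreover have "(\<Union>s\<in>S. f s ` {0..T}) \<subseteq> (\<Union>i. W i)"
  proof
    fix y assume "y \<in> (\<Union>s\<in>S. f s ` {0..T})"
    then obtain s t where s: "s \<in> S" "t \<in> {0..T}" "y = f s t" by auto
    then obtain i where "s \<in> U i" using U(1) by auto
    then show "y \<in> (\<Union>i. W i)" using s W(2)[of i] by blast
  qed
  ultimately show "\<exists>Ta. (\<Union>s\<in>S. f s ` {0..T}) \<subseteq> Ta \<and>
      Ta \<in> lmeasurable \<and> measure lebesgue Ta \<le> e0"
    using lm by blast
qed

lemma negligible_slab: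
  fixes S :: "'a::euclidean_space set"
  assumes "surface_measure S = 0"
  shows "negligible (slab n S)"
proof -
  have "slab n S = (\<Union>s\<in>S. (\<lambda>t. s + t *\<^sub>R n) ` {0..1})" by (auto simp: slab_def)
  also have "negligible \<dots>"
  proof (rule negligible_lipschitz_strip[OF assms])
    fix s s' :: 'a and t t' :: real
    have "dist (s + t *\<^sub>R n) (s' + t' *\<^sub>R n) = norm ((s - s') + (t - t') *\<^sub>R n)"
      by (simp add: dist_norm algebra_simps)
    also have "\<dots> \<le> dist s s' + \<bar>t - t'\<bar> * norm n"
      using norm_triangle_ineq[of "s - s'" "(t - t') *\<^sub>R n"] by (simp add: dist_norm)
    also have "\<dots> \<le> (1 + norm n) * (dist s s' + \<bar>t - t'\<bar>)"
      by (simp add: algebra_simps)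
    finally show "dist (s + t *\<^sub>R n) (s' + t' *\<^sub>R n) \<le>
        (1 + norm n) * (dist s s' + \<bar>t - t'\<bar>)" .
  qed auto
  finally show ?thesis .
qed

text \<open>
  The points that a set of surface measure zero hides from \<open>p\<close>. For almost every
  \<open>q\<close>, the segment from \<open>p\<close> to \<open>q\<close> therefore misses a
  given bounded set of this kind.
\<close>

lemma negligible_shadow:
  fixes S :: "'a::euclidean_space set"
  assumes "surface_measure S = 0" "bounded S"
  shows "negligible {q. \<exists>t\<in>{0<..1}. p + t *\<^sub>R (q - p) \<in> S}"
proof -
  obtain R where R: "\<And>s. s \<in> S \<Longrightarrow> norm (s - p) \<le> R" "R \<ge> 0"
  proof -
    obtain a where "\<And>s. s \<in> S \<Longrightarrow> norm s \<le> a" using assms(2)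
      by (auto simp: bounded_iff)
    then have "norm (s - p) \<le> \<bar>a\<bar> + norm p" if "s \<in> S" for s
      using norm_triangle_ineq4[of s p] that by fastforce
    then show ?thesis using that[of "\<bar>a\<bar> + norm p"] by auto
  qed
  have neg: "negligible (\<Union>s\<in>S. (\<lambda>t. p + t *\<^sub>R (s - p)) ` {0..real k})" for k
  proof (rule negligible_lipschitz_strip[OF assms(1)])
    fix s s' :: 'a and t t' :: real
    assume s: "s \<in> S" "s' \<in> S" "t \<in> {0..real k}" "t' \<in> {0..real k}"
    have "dist (p + t *\<^sub>R (s - p)) (p + t' *\<^sub>R (s' - p)) =
        norm (t *\<^sub>R (s - s') + (t - t') *\<^sub>R (s' - p))"
      by (simp add: dist_norm algebra_simps)
    also have "\<dots> \<le> t * dist s s' + \<bar>t - t'\<bar> * norm (s' - p)"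
      using norm_triangle_ineq[of "t *\<^sub>R (s - s')" "(t - t') *\<^sub>R (s' - p)"] s
        by (simp add: dist_norm)
    also have "\<dots> \<le> real k * dist s s' + \<bar>t - t'\<bar> * R"
      using s R by (intro add_mono mult_mono) auto
    also have "\<dots> \<le> (real k + R) * (dist s s' + \<bar>t - t'\<bar>)"
      using R(2) by (simp add: algebra_simps)
    finally show "dist (p + t *\<^sub>R (s - p)) (p + t' *\<^sub>R (s' - p)) \<le>
        (real k + R) * (dist s s' + \<bar>t - t'\<bar>)" .
  qed (use R in auto)
  have "negligible (\<Union>k. \<Union>s\<in>S. (\<lambda>t. p + t *\<^sub>R (s - p)) ` {0..real k})"
    by (intro negligible_countable_Union) (use neg in auto)
  moreover have "{q. \<exists>t\<in>{0<..1}. p + t *\<^sub>R (q - p) \<in> S} \<subseteq>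
      (\<Union>k. \<Union>s\<in>S. (\<lambda>t. p + t *\<^sub>R (s - p)) ` {0..real k})"
  proof clarify
    fix q and t :: real assume t: "t \<in> {0<..1}" "p + t *\<^sub>R (q - p) \<in> S"
    obtain k :: nat where k: "1 / t \<le> real k" using real_arch_simple by blast
    have "q = p + (1 / t) *\<^sub>R ((p + t *\<^sub>R (q - p)) - p)" using t by simp
    moreover have "1 / t \<in> {0..real k}" using t k by simp
    ultimately show "q \<in> (\<Union>k. \<Union>s\<in>S. (\<lambda>t. p + t *\<^sub>R (s - p)) ` {0..real k})"
      using t(2) by blast
  qed
  ultimately show ?thesis by (rule negligible_subset)
qed

section \<open>Convex sets and open polyhedral sets\<close>

lemma convex_slab:
  assumes "convex S"
  shows "convex (slab n S)"
proof -
  have "linear (\<lambda>(s, t). s + t *\<^sub>R n)"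
    by (intro linearI) (auto simp: algebra_simps)
  then show ?thesis unfolding slab_def
    by (intro convex_linear_image convex_Times assms convex_real_interval)
qed

text \<open>
  A convex set containing a flat disc around \<open>z\<close> and a point below the plane of the
  disc contains a half ball around \<open>z\<close>. A point \<open>y\<close> slightly below the
  plane is a convex combination of \<open>k\<close> and of the point where the ray from
  \<open>k\<close> through \<open>y\<close> meets the plane.
\<close>

lemma halfball_subset_convex:
  fixes n :: "'a::euclidean_space"
  assumes C: "convex C" and r: "0 < r"
      and disc: "\<And>x. n \<bullet> (x - z) = 0 \<Longrightarrow> dist z x < r \<Longrightarrow>
          x \<in> C"
    and k: "k \<in> C" "n \<bullet> (k - z) < 0"
  shows "\<exists>e>0. \<forall>y. n \<bullet> (y - z) \<le> 0 \<longrightarrow>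
      dist z y < e \<longrightarrow> y \<in> C"
proof -
  define a where "a = - (n \<bullet> (k - z))"
  have a: "a > 0" using k by (simp add: a_def)
  define M where "M = 1 + norm n * norm (k - z) / a"
  have M: "M > 0" using a by (auto simp: M_def intro!: add_pos_nonneg)
  \<comment> \<open>the first bound gives \<open>t \<le> 1 / 2\<close>, the second one keeps
    \<open>z + w\<close> in the disc\<close>
  define e where "e = min (a / (2 * (norm n + 1))) (r / (2 * M))"
  have N: "norm n + 1 > 0" by (simp add: add_nonneg_pos)
  have e: "e > 0" unfolding e_def min_less_iff_conj using a N r M by simp
  have "y \<in> C" if y: "n \<bullet> (y - z) \<le> 0" "dist z y < e" for y
  proof -
    define v where "v = y - z"
    define t where "t = - (n \<bullet> v) / a"
    have vn: "norm v < e" using y(2) by (simp add: v_def dist_norm norm_minus_commute)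
    have t0: "0 \<le> t" using y(1) a by (simp add: t_def v_def field_simps)
    have nv: "- (n \<bullet> v) \<le> norm n * norm v" using norm_cauchy_schwarz[of n "- v"] by simp
    have t1: "t \<le> norm n * norm v / a" unfolding t_def using nv a by (intro divide_right_mono) auto
    have "norm n * norm v \<le> (norm n + 1) * e" using vn e by (intro mult_mono) auto
    also have "\<dots> \<le> (norm n + 1) * (a / (2 * (norm n + 1)))"
      using N by (intro mult_left_mono) (auto simp: e_def)
    also have "\<dots> = a / 2" using N by (simp add: field_simps)
    finally have "norm n * norm v / a \<le> (a / 2) / a" using a by (intro divide_right_mono) auto
    then have t2: "t \<le> 1 / 2" using order_trans[OF t1] a by fastforce
    \<comment> \<open>the ray from \<open>k\<close> through \<open>y\<close> meets the plane at
      \<open>z + w\<close>, and \<open>y\<close> divides the segment from there to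
      \<open>k\<close> in the ratio \<open>t : 1 - t\<close>\<close>
    define w where "w = (1 / (1 - t)) *\<^sub>R (v - t *\<^sub>R (k - z))"
    have tn: "1 - t \<noteq> 0" using t2 by simp
    have "n \<bullet> (v - t *\<^sub>R (k - z)) = n \<bullet> v + t * a"
      by (simp add: inner_diff_right a_def algebra_simps)
    also have "\<dots> = 0" using a by (simp add: t_def)
    finally have nw: "n \<bullet> w = 0" by (simp add: w_def)
    have "norm (v - t *\<^sub>R (k - z)) \<le> norm v + t * norm (k - z)"
      using norm_triangle_ineq4[of v "t *\<^sub>R (k - z)"] t0 by simp
    also have "\<dots> \<le> norm v + norm n * norm v / a * norm (k - z)"
      using t1 by (intro add_left_mono mult_right_mono) auto
    also have "\<dots> = norm v * M" by (simp add: M_def algebra_simps)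
    also have "\<dots> < e * M" using vn M by simp
    also have "\<dots> \<le> r / (2 * M) * M" using M by (intro mult_right_mono) (auto simp: e_def)
    also have "\<dots> = r / 2" using M by simp
    finally have 1: "norm (v - t *\<^sub>R (k - z)) < r / 2" .
    have "norm w = norm (v - t *\<^sub>R (k - z)) / (1 - t)" using t2 by (simp add: w_def)
    also have "\<dots> \<le> norm (v - t *\<^sub>R (k - z)) / (1 / 2)" using t2
      by (intro divide_left_mono) auto
    also have "\<dots> < r" using 1 by simp
    finally have "z + w \<in> C" using nw by (intro disc) (auto simp: dist_norm)
    then have "(1 - t) *\<^sub>R (z + w) + t *\<^sub>R k \<in> C"
      using C k t0 t2 by (intro convexD_alt) auto
    moreover have "(1 - t) *\<^sub>R w = v - t *\<^sub>R (k - z)" using tn by (simp add: w_def)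
    then have "(1 - t) *\<^sub>R (z + w) + t *\<^sub>R k = y"
      by (simp add: scaleR_add_right v_def algebra_simps)
    ultimately show ?thesis by simp
  qed
  then show ?thesis using e by blast
qed

text \<open>
  A convex slab that is not negligible has an interior point, and a ball around this point
  projects to a flat disc in the base. The disc is all that is needed to fill a neighbourhood of
  a face from its two sides.
\<close>

lemma disc_of_slab:
  fixes n :: "'a::euclidean_space"
  assumes S: "convex S" and n: "norm n = 1" and hyp: "S \<subseteq> {x. n \<bullet> x = c}"
      and "\<not> negligible (slab n S)"
  obtains z r where "z \<in> S" "0 < r" "\<And>x. n \<bullet> (x - z) = 0 \<Longrightarrow>
      dist z x < r \<Longrightarrow> x \<in> S"
proof -
  obtain y where "y \<in> interior (slab n S)"
    using assms(4) negligible_convex_interior[OF convex_slab[OF S], of n] by auto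
  then obtain r where r: "0 < r" "ball y r \<subseteq> slab n S" by (auto simp: mem_interior)
  then have "y \<in> slab n S" by auto
  then obtain z t where z: "z \<in> S" "t \<in> {0..1}" "y = z + t *\<^sub>R n" by (auto simp: slab_def)
  have nn: "n \<bullet> n = 1" using n by (simp add: norm_eq_1)
  have "x \<in> S" if x: "n \<bullet> (x - z) = 0" "dist z x < r" for x
  proof -
    have "x + t *\<^sub>R n \<in> slab n S" using r x z by (auto simp: dist_norm)
    then obtain s t' where s: "s \<in> S" "x + t *\<^sub>R n = s + t' *\<^sub>R n"
      by (auto simp: slab_def)
    have "n \<bullet> x = c" using x z hyp by (auto simp: inner_diff_right)
    moreover have "n \<bullet> s = c" using s hyp by auto
    ultimately have "t = t'" using arg_cong[OF s(2), of "inner n"] nn by (simp add: inner_add_right)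
    then show ?thesis using s by simp
  qed
  then show ?thesis using that z(1) r(1) by blast
qed

lemma frontier_polyhedron_subset:
  fixes p :: "'a::euclidean_space set"
  assumes "polyhedron p"
  shows "\<exists>H. finite H \<and> (\<forall>i\<in>H. norm (fst i) = 1) \<and> frontier p \<subseteq>
      (\<Union>i\<in>H. {x. fst i \<bullet> x = snd i})"
proof -
  obtain F where F: "finite F" "p = \<Inter>F" "\<And>h. h \<in> F \<Longrightarrow>
      \<exists>a b. a \<noteq> 0 \<and> h = {x. a \<bullet> x \<le> b}"
    using assms unfolding polyhedron_def by blast
  then obtain a b where ab: "\<And>h. h \<in> F \<Longrightarrow> a h \<noteq> 0 \<and> h =
      {x. a h \<bullet> x \<le> b h}"
    by metis
  define H where "H = (\<lambda>h. ((1 / norm (a h)) *\<^sub>R a h, b h / norm (a h))) ` F"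
  have "finite H" using F by (simp add: H_def)
  moreover have "\<forall>i\<in>H. norm (fst i) = 1" using ab by (auto simp: H_def)
  moreover have "frontier p \<subseteq> (\<Union>i\<in>H. {x. fst i \<bullet> x = snd i})"
  proof
    fix x assume x: "x \<in> frontier p"
    have "closed p" using assms by (rule polyhedron_imp_closed)
    then have xp: "x \<in> p" "x \<notin> interior p" using x by (auto simp: frontier_def)
    have "(\<Inter>h\<in>F. interior h) \<subseteq> interior p"
    proof (rule interior_maximal)
      show "(\<Inter>h\<in>F. interior h) \<subseteq> p" unfolding F(2) using interior_subset by blast
      show "open (\<Inter>h\<in>F. interior h)" using F(1) by (intro open_INT) auto
    qed
    then obtain h where h: "h \<in> F" "x \<notin> interior h" using xp by auto
    have "interior h = {x. a h \<bullet> x < b h}" using ab[OF h(1)] by (metis interior_halfspace_le)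
    moreover have "a h \<bullet> x \<le> b h" using ab[OF h(1)] h(1) xp F(2) by blast
    ultimately have "a h \<bullet> x = b h" using h by auto
    then have "((1 / norm (a h)) *\<^sub>R a h) \<bullet> x = b h / norm (a h)" by simp
    then show "x \<in> (\<Union>i\<in>H. {x. fst i \<bullet> x = snd i})" using h(1) unfolding H_def
      by force
  qed
  ultimately show ?thesis by blast
qed

lemma frontier_open_polyhedral_subset:
  fixes S :: "'a::euclidean_space set"
  assumes "open_polyhedral S"
  shows "\<exists>H. finite H \<and> (\<forall>i\<in>H. norm (fst i) = 1) \<and> frontier S \<subseteq>
      (\<Union>i\<in>H. {x. fst i \<bullet> x = snd i})"
proof -
  obtain P where P: "finite P" "\<And>p. p \<in> P \<Longrightarrow> polyhedron p" "S =
      interior (\<Union>P)"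
    using assms unfolding open_polyhedral_def by blast
  have "\<forall>p\<in>P. \<exists>H. finite H \<and> (\<forall>i\<in>H. norm (fst i) = 1) \<and>
      frontier p \<subseteq> (\<Union>i\<in>H. {x. fst i \<bullet> x = snd i})"
    by (intro ballI frontier_polyhedron_subset P(2))
  from bchoice[OF this] obtain H where H: "\<forall>p\<in>P. finite (H p) \<and>
      (\<forall>i\<in>H p. norm (fst i) = 1) \<and>
      frontier p \<subseteq> (\<Union>i\<in>H p. {x. fst i \<bullet> x = snd i})" ..
  have "frontier S \<subseteq> frontier (\<Union>P)" unfolding P(3) by (rule frontier_interior_subset)
  also have "\<dots> \<subseteq> (\<Union>p\<in>P. frontier p)" by (rule frontier_Union_subset[OF P(1)])
  also have "\<dots> \<subseteq> (\<Union>p\<in>P. \<Union>i\<in>H p. {x. fst i \<bullet> x = snd i})"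
    using H by (intro UN_mono) auto
  also have "\<dots> = (\<Union>i\<in>(\<Union>p\<in>P. H p). {x. fst i \<bullet> x = snd i})" by simp
  finally have "frontier S \<subseteq> (\<Union>i\<in>(\<Union>p\<in>P. H p). {x. fst i \<bullet> x =
      snd i})" .
  moreover have "finite (\<Union>p\<in>P. H p)" using P(1) H by simp
  moreover have "\<forall>i\<in>(\<Union>p\<in>P. H p). norm (fst i) = 1" using H by blast
  ultimately show ?thesis by (intro exI[of _ "\<Union>p\<in>P. H p"] conjI)
qed

text \<open>
  An open polyhedral set has no slits or punctures. This is what forbids an interior face on the
  boundary of \<open>\<Omega>\<close>.
\<close>

lemma interior_closure_open_polyhedral:
  fixes S :: "'a::euclidean_space set"
  assumes "open_polyhedral S"
  shows "interior (closure S) = S"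
proof -
  obtain P where P: "finite P" "\<And>p. p \<in> P \<Longrightarrow> polyhedron p" "S =
      interior (\<Union>P)"
    using assms unfolding open_polyhedral_def by blast
  have "closed (\<Union>P)" using P by (intro closed_Union) (auto intro: polyhedron_imp_closed)
  then have "closure S \<subseteq> \<Union>P" unfolding P(3) by (intro closure_minimal interior_subset)
  then have "interior (closure S) \<subseteq> S" using interior_mono P(3) by metis
  moreover have "open S" using P(3) by simp
  then have "S \<subseteq> interior (closure S)" by (intro interior_maximal closure_subset)
  ultimately show ?thesis by blast
qed

section \<open>Geometry of admissible meshes\<close>

locale meshed_domain =
  fixes \<Omega> :: "'a::euclidean_space set" and M :: "'a mesh"
  assumes open_dom: "open \<Omega>" and connected_dom: "connected \<Omega>"
      and bounded_dom: "bounded \<Omega>"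
    and polyhedral_dom: "open_polyhedral \<Omega>" and admissible: "admissible_mesh \<Omega> M"
begin

lemma
  shows finite_cells: "finite (cells M)" and finite_faces: "finite (faces M)"
    and cover: "(\<Union>K\<in>cells M. closure K) = closure \<Omega>"
    and faces_Un: "faces M = int_faces M \<union> ext_faces \<Omega> M"
    and all_faces: "(\<Union>K\<in>cells M. cell_faces M K) = faces M"
    and inj_center: "inj_on (center M) (cells M)"
  using admissible unfolding admissible_mesh_def by - ((elim conjE, assumption)+)

lemma
  shows admissible_cells: "\<forall>K\<in>cells M. K \<noteq> {} \<and> open K \<and>
      open_polyhedral K \<and> convex K"
    and admissible_disjoint: "\<forall>K\<in>cells M. \<forall>L\<in>cells M. K \<noteq> L \<longrightarrow>
        K \<inter> L = {}"
    and admissible_faces: "\<forall>\<sigma>\<in>faces M. closed \<sigma> \<and>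
        (\<exists>P. hyperplane P \<and> \<sigma> \<subseteq> P) \<and> surface_measure \<sigma> > 0"
    and admissible_overlaps: "\<forall>\<sigma>\<in>faces M. \<forall>\<sigma>'\<in>faces M. \<sigma> \<noteq> \<sigma>' \<longrightarrow>
        surface_measure (\<sigma> \<inter> \<sigma>') = 0"
    and admissible_boundaries: "\<forall>K\<in>cells M. cell_faces M K \<subseteq> faces M \<and>
        frontier K = \<Union>(cell_faces M K)"
    and admissible_contacts: "\<forall>K\<in>cells M. \<forall>L\<in>cells M. K \<noteq> L \<longrightarrow>
        closure K \<inter> closure L \<in> faces M \<or> surface_measure (closure K \<inter> closure L) = 0"
    and admissible_centers: "\<forall>K\<in>cells M. center M K \<in> \<Omega>"
  using admissible unfolding admissible_mesh_def by - ((elim conjE, assumption)+)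

lemma
  assumes "K \<in> cells M"
  shows cell_nonempty: "K \<noteq> {}" and cell_open: "open K" and cell_convex: "convex K"
    and cell_faces_sub: "cell_faces M K \<subseteq> faces M"
        and frontier_cell: "frontier K = \<Union>(cell_faces M K)"
    and center_in: "center M K \<in> \<Omega>"
  using assms admissible_cells admissible_boundaries admissible_centers by metis+

lemma cells_disjoint: "K \<in> cells M \<Longrightarrow> L \<in> cells M \<Longrightarrow>
    K \<noteq> L \<Longrightarrow> K \<inter> L = {}"
  using admissible_disjoint by metis

lemma
  assumes "\<sigma> \<in> faces M"
  shows face_closed: "closed \<sigma>"
      and face_hyperplane: "\<exists>P. hyperplane P \<and> \<sigma> \<subseteq> P"
    and face_pos: "surface_measure \<sigma> > 0"
  using assms admissible_faces by metis+

lemma faces_almost_disjoint: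
  "\<sigma> \<in> faces M \<Longrightarrow> \<sigma>' \<in> faces M \<Longrightarrow>
      \<sigma> \<noteq> \<sigma>' \<Longrightarrow> surface_measure (\<sigma> \<inter> \<sigma>') = 0"
  using admissible_overlaps by metis

lemma contact_dichotomy: "K \<in> cells M \<Longrightarrow> L \<in> cells M \<Longrightarrow>
    K \<noteq> L \<Longrightarrow>
    closure K \<inter> closure L \<in> faces M \<or> surface_measure (closure K \<inter> closure L) = 0"
  using admissible_contacts by metis

text \<open>
  The centers of two adjacent cells determine a normal of the common face, and this normal tells
  on which side each of the cells lies.
\<close>

lemma contact_orthogonal:
  assumes "K \<in> cells M" "L \<in> cells M" "K \<noteq> L" "closure K \<inter> closure L \<in> faces M"
  shows "orthogonal_to_set (center M L - center M K) (closure K \<inter> closure L)"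
    and "y \<in> closure K \<inter> closure L \<Longrightarrow> p \<in> K \<Longrightarrow>
        (center M L - center M K) \<bullet> (p - y) < 0"
    and "y \<in> closure K \<inter> closure L \<Longrightarrow> q \<in> L \<Longrightarrow>
        (center M L - center M K) \<bullet> (q - y) > 0"
proof -
  have *: "\<forall>K\<in>cells M. \<forall>L\<in>cells M. K \<noteq> L \<and>
      closure K \<inter> closure L \<in> faces M \<longrightarrow>
        orthogonal_to_set (center M L - center M K) (closure K \<inter> closure L) \<and>
        (\<forall>y \<in> closure K \<inter> closure L.
           (\<forall>p\<in>K. (center M L - center M K) \<bullet> (p - y) < 0) \<and>
           (\<forall>q\<in>L. (center M L - center M K) \<bullet> (q - y) > 0))"
    using admissible unfolding admissible_mesh_def by (elim conjE)
  show "orthogonal_to_set (center M L - center M K) (closure K \<inter> closure L)"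
    and "y \<in> closure K \<inter> closure L \<Longrightarrow> p \<in> K \<Longrightarrow>
        (center M L - center M K) \<bullet> (p - y) < 0"
    and "y \<in> closure K \<inter> closure L \<Longrightarrow> q \<in> L \<Longrightarrow>
        (center M L - center M K) \<bullet> (q - y) > 0"
    using * assms by blast+
qed

lemma face_center_in:
  assumes "\<sigma> \<in> ext_faces \<Omega> M"
  shows "face_center M \<sigma> \<in> \<sigma>"
proof -
  have "\<sigma> \<in> faces M" using assms faces_Un by auto
  then obtain K where "K \<in> cells M" "\<sigma> \<in> cell_faces M K" using all_faces by blast
  moreover have "\<forall>K\<in>cells M. \<forall>\<sigma> \<in> cell_faces M K \<inter> ext_faces \<Omega> M.
        face_center M \<sigma> \<in> \<sigma> \<and> orthogonal_to_set (face_center M \<sigma> - center M K) \<sigma>"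
    using admissible unfolding admissible_mesh_def by (elim conjE)
  ultimately show ?thesis using assms by blast
qed

lemma face_center_frontier: "\<sigma> \<in> ext_faces \<Omega> M \<Longrightarrow>
    face_center M \<sigma> \<in> frontier \<Omega>"
  using face_center_in by (auto simp: ext_faces_def)

lemma closure_cell_sub: "K \<in> cells M \<Longrightarrow> closure K \<subseteq> closure \<Omega>"
  using cover by blast

lemma cell_subset:
  assumes "K \<in> cells M"
  shows "K \<subseteq> \<Omega>"
proof -
  have "K \<subseteq> interior (closure \<Omega>)"
    using closure_cell_sub[OF assms] closure_subset[of K]
      by (intro interior_maximal cell_open assms) auto
  then show ?thesis using interior_closure_open_polyhedral[OF polyhedral_dom] by simp
qed

lemma cell_bounded: "K \<in> cells M \<Longrightarrow> bounded K"
  using cell_subset bounded_dom bounded_subset by blast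

lemma cell_measure_pos:
  assumes "K \<in> cells M"
  shows "cell_measure K > 0"
proof -
  have "\<not> negligible K" using open_not_negligible[OF cell_open[OF assms] cell_nonempty[OF assms]] .
  moreover have "K \<in> lmeasurable" using cell_open[OF assms] cell_bounded[OF assms]
    by (simp add: lmeasurable_open)
  ultimately show ?thesis unfolding cell_measure_def
    using negligible_iff_measure[of K] measure_nonneg[of lebesgue K] by (metis order_le_less)
qed

lemma face_sub_closure:
  assumes "\<sigma> \<in> faces M"
  shows "\<sigma> \<subseteq> closure \<Omega>"
proof -
  obtain K where K: "K \<in> cells M" "\<sigma> \<in> cell_faces M K" using assms all_faces by blast
  then have "\<sigma> \<subseteq> closure K" using frontier_cell[OF K(1)] by (auto simp: frontier_def)
  then show ?thesis using closure_cell_sub[OF K(1)] by blast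
qed

lemma face_compact: "\<sigma> \<in> faces M \<Longrightarrow> compact \<sigma>"
  using face_closed face_sub_closure bounded_dom
  by (meson bounded_closure bounded_subset compact_eq_bounded_closed)

lemma face_plane:
  assumes "\<sigma> \<in> faces M"
  obtains n c where "norm n = 1" "\<sigma> \<subseteq> {x. n \<bullet> x = c}"
proof -
  obtain a b where ab: "a \<noteq> 0" "\<sigma> \<subseteq> {x. a \<bullet> x = b}"
    using face_hyperplane[OF assms] by (auto simp: hyperplane_def)
  have "norm ((1 / norm a) *\<^sub>R a) = 1" using ab by simp
  moreover have "\<sigma> \<subseteq> {x. ((1 / norm a) *\<^sub>R a) \<bullet> x = b / norm a}" using ab
    by auto
  ultimately show ?thesis by (rule that)
qed

lemma face_slab:
  assumes "\<sigma> \<in> faces M" "norm n = 1" "\<sigma> \<subseteq> {x. n \<bullet> x = c}"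
  shows "surface_measure \<sigma> \<le>
      ennreal (surface_const TYPE('a) * measure lebesgue (slab n \<sigma>))"
  using surface_measure_le_slabs[of "{()}" "\<lambda>_. \<sigma>" "\<lambda>_. n" "\<lambda>_. c" \<sigma>] assms face_compact
    by auto

text \<open>
  Faces are truly of codimension one. The uniqueness of normals, neighbours and owners rests on
  this.
\<close>

lemma face_slab_not_negligible:
  assumes "\<sigma> \<in> faces M" "norm n = 1" "\<sigma> \<subseteq> {x. n \<bullet> x = c}"
  shows "\<not> negligible (slab n \<sigma>)"
proof
  assume "negligible (slab n \<sigma>)"
  then have "measure lebesgue (slab n \<sigma>) = 0" by (rule negligible_imp_measure0)
  then show False using face_slab[OF assms] face_pos[OF assms(1)] by simp
qed

lemma face_measure_pos:
  assumes "\<sigma> \<in> faces M"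
  shows "face_measure \<sigma> > 0"
proof -
  obtain n c where "norm n = 1" "\<sigma> \<subseteq> {x. n \<bullet> x = c}"
    using face_plane[OF assms] .
  from face_slab[OF assms this] have "surface_measure \<sigma> < \<infinity>"
    by (simp add: order_le_less_trans)
  then show ?thesis using face_pos[OF assms] by (simp add: face_measure_def enn2real_positive_iff)
qed

lemma face_nonempty: "\<sigma> \<in> faces M \<Longrightarrow> \<sigma> \<noteq> {}"
  using face_plane[of \<sigma>] face_slab_not_negligible[of \<sigma>]
    by (metis slab_def Sigma_empty1 image_empty negligible_empty)

text \<open>
  A second normal direction would confine the face to an affine subspace of codimension two, and
  its slab to a hyperplane.
\<close>

lemma normal_parallel:
  assumes \<sigma>: "\<sigma> \<in> faces M" and n: "norm n = 1"
      and hyp: "\<sigma> \<subseteq> {x. n \<bullet> x = c}" and v: "orthogonal_to_set v \<sigma>"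
  shows "v = (v \<bullet> n) *\<^sub>R n"
proof (rule ccontr)
  assume "v \<noteq> (v \<bullet> n) *\<^sub>R n"
  \<comment> \<open>the component of \<open>v\<close> orthogonal to \<open>n\<close>; it is
    constant along the face and along \<open>n\<close>\<close>
  define w where "w = v - (v \<bullet> n) *\<^sub>R n"
  have w: "w \<noteq> 0" using \<open>v \<noteq> _\<close> by (simp add: w_def)
  obtain s0 where s0: "s0 \<in> \<sigma>" using face_nonempty[OF \<sigma>] by blast
  have wn: "w \<bullet> n = 0" using n by (simp add: w_def inner_diff_left norm_eq_1)
  have "w \<bullet> s = w \<bullet> s0" if "s \<in> \<sigma>" for s
  proof -
    have "v \<bullet> (s - s0) = 0" using v that s0 by (simp add: orthogonal_to_set_def orthogonal_def)
    moreover have "n \<bullet> (s - s0) = 0" using hyp that s0 by (auto simp: inner_diff_right)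
    ultimately have "w \<bullet> (s - s0) = 0" by (simp add: w_def inner_diff_left)
    then show ?thesis by (simp add: inner_diff_right)
  qed
  then have "slab n \<sigma> \<subseteq> {x. w \<bullet> x = w \<bullet> s0}" using wn
    by (auto simp: slab_def inner_add_right)
  moreover have "negligible {x. w \<bullet> x = w \<bullet> s0}" using w
    by (simp add: negligible_hyperplane)
  ultimately show False using face_slab_not_negligible[OF \<sigma> n hyp] negligible_subset by blast
qed

lemma face_eq_of_subset:
  assumes "\<sigma> \<in> faces M" "\<sigma>' \<in> faces M" "\<sigma> \<subseteq> \<sigma>'"
  shows "\<sigma> = \<sigma>'"
proof (rule ccontr)
  assume "\<sigma> \<noteq> \<sigma>'"
  then have "surface_measure (\<sigma> \<inter> \<sigma>') = 0" using faces_almost_disjoint assms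
    by blast
  then show False using face_pos[OF assms(1)] assms(3) by (simp add: Int_absorb2)
qed

text \<open>
  A face touched by two cells is their whole contact set: by almost disjointness of distinct
  faces, a face of positive area cannot be a proper part of another one.
\<close>

lemma face_eq_contact:
  assumes "\<sigma> \<in> faces M" "K \<in> cells M" "L \<in> cells M" "K \<noteq> L" "\<sigma> \<subseteq>
      closure K" "\<sigma> \<subseteq> closure L"
  shows "\<sigma> = closure K \<inter> closure L"
proof -
  have "surface_measure \<sigma> \<le> surface_measure (closure K \<inter> closure L)"
    using assms by (intro hausdorff_measure_mono) auto
  then have "surface_measure (closure K \<inter> closure L) \<noteq> 0" using face_pos[OF assms(1)]
    by auto
  then have "closure K \<inter> closure L \<in> faces M" using contact_dichotomy assms by blast
  then show ?thesis using face_eq_of_subset assms by blast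
qed

text \<open>
  The three differences of centers would all be parallel to the normal of the face, and each two
  of the three cells would lie on opposite sides of it.
\<close>

lemma no_three_cells_at_face:
  assumes \<sigma>: "\<sigma> \<in> faces M"
      and c: "K \<in> cells M" "L \<in> cells M" "L' \<in> cells M" "K \<noteq> L" "K \<noteq> L'" "L \<noteq> L'"
    and sub: "\<sigma> \<subseteq> closure K" "\<sigma> \<subseteq> closure L" "\<sigma> \<subseteq>
        closure L'"
  shows False
proof -
  obtain n b where n: "norm n = 1" "\<sigma> \<subseteq> {x. n \<bullet> x = b}"
    using face_plane[OF \<sigma>] .
  obtain y where y: "y \<in> \<sigma>" using face_nonempty[OF \<sigma>] by blast
  obtain p q r where p: "p \<in> K" "q \<in> L" "r \<in> L'" using cell_nonempty c
    by (metis all_not_in_conv)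
  \<comment> \<open>\<open>a\<close> is the coefficient of the difference of the centers along
    \<open>n\<close>\<close>
  have side: "\<exists>a. a * (n \<bullet> (x - y)) < 0 \<and> a * (n \<bullet> (x' - y)) > 0"
    if C: "C \<in> cells M" "C' \<in> cells M" "C \<noteq> C'" "\<sigma> \<subseteq>
        closure C" "\<sigma> \<subseteq> closure C'" "x \<in> C" "x' \<in> C'" for C C' x x'
  proof -
    have e: "\<sigma> = closure C \<inter> closure C'" by (rule face_eq_contact[OF \<sigma> C(1-5)])
    define v where "v = center M C' - center M C"
    have v: "orthogonal_to_set v \<sigma>" "v \<bullet> (x - y) < 0" "v \<bullet> (x' - y) > 0"
      using contact_orthogonal[OF C(1-3)] C(6,7) y \<sigma> by (simp_all add: e v_def)
    have "v = (v \<bullet> n) *\<^sub>R n" by (rule normal_parallel[OF \<sigma> n v(1)])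
    then have "v \<bullet> z = (v \<bullet> n) * (n \<bullet> z)" for z by (metis inner_scaleR_left)
    then show ?thesis using v(2,3) by metis
  qed
  obtain a1 where 1: "a1 * (n \<bullet> (p - y)) < 0" "a1 * (n \<bullet> (q - y)) > 0"
    using side[OF c(1,2,4) sub(1,2) p(1,2)] by blast
  obtain a2 where 2: "a2 * (n \<bullet> (p - y)) < 0" "a2 * (n \<bullet> (r - y)) > 0"
    using side[OF c(1,3,5) sub(1,3) p(1,3)] by blast
  obtain a3 where 3: "a3 * (n \<bullet> (q - y)) < 0" "a3 * (n \<bullet> (r - y)) > 0"
    using side[OF c(2,3,6) sub(2,3) p(2,3)] by blast
  show False using 1 2 3 by (auto simp: mult_less_0_iff zero_less_mult_iff)
qed

lemma cell_face_sub_closure: "K \<in> cells M \<Longrightarrow>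
    \<sigma> \<in> cell_faces M K \<Longrightarrow> \<sigma> \<subseteq> closure K"
  using frontier_cell by (auto simp: frontier_def)

lemma ex1_neighbour:
  assumes K: "K \<in> cells M" "\<sigma> \<in> cell_faces M K" and int: "\<sigma> \<in> int_faces M"
  shows "\<exists>!L. L \<in> cells M \<and> L \<noteq> K \<and> \<sigma> = closure K \<inter> closure L"
proof -
  have \<sigma>: "\<sigma> \<in> faces M" using K cell_faces_sub by blast
  have sK: "\<sigma> \<subseteq> closure K" using cell_face_sub_closure[OF K] .
  obtain A B where AB: "A \<in> cells M" "B \<in> cells M" "A \<noteq> B" "\<sigma> =
      closure A \<inter> closure B"
    using int by (auto simp: int_faces_def)
  have "A = K \<or> B = K"
    using no_three_cells_at_face[OF \<sigma> K(1) AB(1,2)] AB(3,4) sK by blast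
  then have ex: "\<exists>L. L \<in> cells M \<and> L \<noteq> K \<and> \<sigma> =
      closure K \<inter> closure L"
    using AB by blast
  have uniq: "L = L'" if L: "L \<in> cells M \<and> L \<noteq> K \<and> \<sigma> =
      closure K \<inter> closure L"
     and L': "L' \<in> cells M \<and> L' \<noteq> K \<and> \<sigma> = closure K \<inter> closure L'"
         for L L'
  proof (rule ccontr)
    assume "L \<noteq> L'"
    moreover have "\<sigma> \<subseteq> closure L" "\<sigma> \<subseteq> closure L'" using L L' by blast+
    ultimately show False using no_three_cells_at_face[OF \<sigma> K(1), of L L'] L L' sK by metis
  qed
  from ex obtain L where L: "L \<in> cells M \<and> L \<noteq> K \<and> \<sigma> =
      closure K \<inter> closure L" ..
  show ?thesis by (rule ex1I[of _ L]) (use L uniq in metis)+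
qed

lemma
  assumes "K \<in> cells M" "\<sigma> \<in> cell_faces M K" "\<sigma> \<in> int_faces M"
  shows neighbour_cell: "neighbour M K \<sigma> \<in> cells M"
      and neighbour_neq: "neighbour M K \<sigma> \<noteq> K"
    and neighbour_contact: "\<sigma> = closure K \<inter> closure (neighbour M K \<sigma>)"
  using theI'[OF ex1_neighbour[OF assms]] unfolding neighbour_def by blast+

text \<open>
  If \<open>\<sigma>\<close> were not in the list of faces of \<open>L\<close>, it would be
  covered by its intersections with the listed faces. These have area zero, hence negligible
  slabs, and the slab of \<open>\<sigma>\<close> would be negligible.
\<close>

lemma face_in_cell_faces:
  assumes \<sigma>: "\<sigma> \<in> faces M" and L: "L \<in> cells M"
      and sub: "\<sigma> \<subseteq> frontier L"
  shows "\<sigma> \<in> cell_faces M L"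
proof (rule ccontr)
  assume no: "\<sigma> \<notin> cell_faces M L"
  obtain n b where n: "norm n = 1" "\<sigma> \<subseteq> {x. n \<bullet> x = b}"
    using face_plane[OF \<sigma>] .
  have "negligible (slab n (\<sigma> \<inter> \<sigma>'))"
      if "\<sigma>' \<in> cell_faces M L" for \<sigma>'
    using that no cell_faces_sub[OF L] \<sigma> by (intro negligible_slab faces_almost_disjoint) auto
  moreover have "finite (cell_faces M L)" using cell_faces_sub[OF L] finite_faces finite_subset by blast
  ultimately have "negligible (\<Union>\<sigma>'\<in>cell_faces M L. slab n (\<sigma> \<inter> \<sigma>'))"
    by (intro negligible_Union) auto
  moreover have "slab n \<sigma> \<subseteq>
      (\<Union>\<sigma>'\<in>cell_faces M L. slab n (\<sigma> \<inter> \<sigma>'))"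
  proof
    fix x assume "x \<in> slab n \<sigma>"
    then obtain s t where s: "s \<in> \<sigma>" "t \<in> {0..1}" "x = s + t *\<^sub>R n"
      by (auto simp: slab_def)
    then obtain \<sigma>' where "\<sigma>' \<in> cell_faces M L" "s \<in> \<sigma>'"
      using sub frontier_cell[OF L] by blast
    then show "x \<in> (\<Union>\<sigma>'\<in>cell_faces M L. slab n (\<sigma> \<inter> \<sigma>'))"
      using s by (force simp: slab_def)
  qed
  ultimately show False using face_slab_not_negligible[OF \<sigma> n] negligible_subset by blast
qed

lemma contact_sub_frontier:
  assumes "K \<in> cells M" "L \<in> cells M" "K \<noteq> L"
  shows "closure K \<inter> closure L \<subseteq> frontier L"
proof -
  have "L \<inter> closure K = {}"
    using open_Int_closure_eq_empty[OF cell_open[OF assms(2)], of K] cells_disjoint[OF assms] by blast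
  then show ?thesis using interior_subset[of L] by (auto simp: frontier_def)
qed

lemma contact_in_cell_faces:
  assumes "K \<in> cells M" "L \<in> cells M" "K \<noteq> L" "closure K \<inter> closure L \<in> faces M"
  shows "closure K \<inter> closure L \<in> cell_faces M L"
  using face_in_cell_faces contact_sub_frontier assms by blast

lemma
  assumes "K \<in> cells M" "\<sigma> \<in> cell_faces M K" "\<sigma> \<in> int_faces M"
  shows neighbour_cell_faces: "\<sigma> \<in> cell_faces M (neighbour M K \<sigma>)"
    and neighbour_neighbour: "neighbour M (neighbour M K \<sigma>) \<sigma> = K"
proof -
  let ?L = "neighbour M K \<sigma>"
  have \<sigma>: "\<sigma> \<in> faces M" using assms cell_faces_sub by blast
  have e: "\<sigma> = closure K \<inter> closure ?L" using neighbour_contact[OF assms] .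
  have L: "?L \<in> cells M" "?L \<noteq> K" using neighbour_cell[OF assms] neighbour_neq[OF assms]
    by auto
  show *: "\<sigma> \<in> cell_faces M ?L" using contact_in_cell_faces[OF assms(1) L(1)] L(2) e \<sigma>
    by auto
  show "neighbour M ?L \<sigma> = K"
    using ex1_neighbour[OF L(1) * assms(3)] neighbour_cell[OF L(1) * assms(3)]
      neighbour_neq[OF L(1) * assms(3)] neighbour_contact[OF L(1) * assms(3)] assms(1) L(2) e
    by (metis inf_commute)
qed

lemma neighbour_eq:
  assumes "K \<in> cells M" "L \<in> cells M" "K \<noteq> L" "closure K \<inter> closure L \<in> faces M"
  shows "closure K \<inter> closure L \<in> cell_faces M K \<inter> int_faces M"
    and "neighbour M K (closure K \<inter> closure L) = L"
proof -
  let ?\<sigma> = "closure K \<inter> closure L"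
  have i: "?\<sigma> \<in> int_faces M" using assms by (auto simp: int_faces_def)
  have f: "?\<sigma> \<in> cell_faces M K"
    using contact_in_cell_faces[OF assms(2,1)] assms(3,4) by (simp add: inf_commute)
  show "?\<sigma> \<in> cell_faces M K \<inter> int_faces M" using i f by blast
  show "neighbour M K ?\<sigma> = L"
    using the1_equality[OF ex1_neighbour[OF assms(1) f i]] assms unfolding neighbour_def by auto
qed

text \<open>
  The two cells at an interior face fill the two half balls around a suitable point of the face,
  so this point is interior to the closure of \<open>\<Omega>\<close>, that is, a point of
  \<open>\<Omega>\<close>. Consequently the boundary condition is imposed only where the flux is
  the one towards the boundary.
\<close>

lemma int_ext_disjoint: "int_faces M \<inter> ext_faces \<Omega> M = {}"
proof -
  have False if \<sigma>: "\<sigma> \<in> int_faces M" "\<sigma> \<in> ext_faces \<Omega> M" for \<sigma>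
  proof -
    have f: "\<sigma> \<in> faces M" using \<sigma> by (simp add: int_faces_def)
    obtain K L where KL: "K \<in> cells M" "L \<in> cells M" "K \<noteq> L" "\<sigma> =
        closure K \<inter> closure L"
      using \<sigma> by (auto simp: int_faces_def)
    obtain n b where n: "norm n = 1" "\<sigma> \<subseteq> {x. n \<bullet> x = b}"
      using face_plane[OF f] .
    have "convex \<sigma>" unfolding KL(4) using KL by (intro convex_Int convex_closure cell_convex)
    then obtain z r where z: "z \<in> \<sigma>" "0 < r" "\<And>x. n \<bullet> (x - z) =
        0 \<Longrightarrow> dist z x < r \<Longrightarrow> x \<in> \<sigma>"
      using disc_of_slab[OF _ n face_slab_not_negligible[OF f n]] by metis
    define v where "v = center M L - center M K"
    have v: "orthogonal_to_set v \<sigma>" "\<And>p. p \<in> K \<Longrightarrow>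
        v \<bullet> (p - z) < 0" "\<And>q. q \<in> L \<Longrightarrow> v \<bullet> (q - z) > 0"
      using contact_orthogonal[OF KL(1-3)] f z(1) by (simp_all add: KL(4) v_def)
    have vn: "v = (v \<bullet> n) *\<^sub>R n" by (rule normal_parallel[OF f n v(1)])
    have "v \<noteq> 0" using KL inj_center by (auto simp: v_def inj_on_def)
    then have "v \<bullet> n \<noteq> 0" using vn by auto
    moreover have vx: "v \<bullet> x = (v \<bullet> n) * (n \<bullet> x)" for x using vn
      by (metis inner_scaleR_left)
    ultimately have disc: "x \<in> \<sigma>" if "v \<bullet> (x - z) = 0" "dist z x < r" for x
      using z(3) that by (metis mult_eq_0_iff)
    obtain k l where k: "k \<in> K" "l \<in> L" using KL cell_nonempty by blast
    obtain e1 where e1: "e1 > 0" "\<And>y. v \<bullet> (y - z) \<le> 0 \<Longrightarrow>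
        dist z y < e1 \<Longrightarrow> y \<in> closure K"
      using halfball_subset_convex[of "closure K" r v z k] KL z(2) disc k v(2) closure_subset[of K]
        cell_convex by (auto simp: convex_closure)
    obtain e2 where e2: "e2 > 0" "\<And>y. (- v) \<bullet> (y - z) \<le> 0 \<Longrightarrow>
        dist z y < e2 \<Longrightarrow> y \<in> closure L"
      using halfball_subset_convex[of "closure L" r "- v" z l] KL z(2) disc k v(3) closure_subset[of L]
        cell_convex by (auto simp: convex_closure)
    have "ball z (min e1 e2) \<subseteq> closure K \<union> closure L"
    proof
      fix y assume "y \<in> ball z (min e1 e2)"
      then show "y \<in> closure K \<union> closure L"
        using e1(2)[of y] e2(2)[of y] by (cases "v \<bullet> (y - z) \<le> 0") auto
    qed
    also have "\<dots> \<subseteq> closure \<Omega>" using closure_cell_sub KL by auto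
    finally have "z \<in> interior (closure \<Omega>)" using e1(1) e2(1) unfolding mem_interior
      by (intro exI[of _ "min e1 e2"]) simp
    then have "z \<in> \<Omega>" using interior_closure_open_polyhedral[OF polyhedral_dom] by simp
    moreover have "z \<in> frontier \<Omega>" using z(1) \<sigma>(2) by (auto simp: ext_faces_def)
    ultimately show False using open_dom by (simp add: frontier_def interior_open)
  qed
  then show ?thesis by blast
qed

lemma ex1_owner:
  assumes "\<sigma> \<in> ext_faces \<Omega> M"
  shows "\<exists>!K. K \<in> cells M \<and> \<sigma> \<in> cell_faces M K"
proof -
  have \<sigma>: "\<sigma> \<in> faces M" using assms faces_Un by blast
  have "K = L" if "K \<in> cells M \<and> \<sigma> \<in> cell_faces M K" "L \<in> cells M \<and>
      \<sigma> \<in> cell_faces M L" for K L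
  proof (rule ccontr)
    assume "K \<noteq> L"
    then have "\<sigma> = closure K \<inter> closure L"
      using face_eq_contact[OF \<sigma>] that cell_face_sub_closure by blast
    then have "\<sigma> \<in> int_faces M" using that \<sigma> \<open>K \<noteq> L\<close>
      by (auto simp: int_faces_def)
    then show False using assms int_ext_disjoint by blast
  qed
  note uniq = this
  obtain K where K: "K \<in> cells M \<and> \<sigma> \<in> cell_faces M K" using \<sigma> all_faces
    by blast
  show ?thesis by (rule ex1I[of _ K]) (use K uniq in metis)+
qed

lemma
  assumes "\<sigma> \<in> ext_faces \<Omega> M"
  shows owner_cell: "owner M \<sigma> \<in> cells M"
      and owner_face: "\<sigma> \<in> cell_faces M (owner M \<sigma>)"
  using theI'[OF ex1_owner[OF assms]] unfolding owner_def by blast+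

lemma owner_eq: "K \<in> cells M \<Longrightarrow> \<sigma> \<in> cell_faces M K \<Longrightarrow>
    \<sigma> \<in> ext_faces \<Omega> M \<Longrightarrow> owner M \<sigma> = K"
  using ex1_owner[of \<sigma>] owner_cell[of \<sigma>] owner_face[of \<sigma>] by metis

text \<open>
  A ray in a direction \<open>e\<close> leaves the cell whose center is extreme in direction
  \<open>e\<close> through one of its faces. A neighbour across this face would have a center
  that is even more extreme, as the difference of the centers points out of the cell.
\<close>

lemma ex_ext_face:
  assumes "cells M \<noteq> {}"
  obtains \<sigma> where "\<sigma> \<in> ext_faces \<Omega> M"
proof -
  obtain e :: 'a where e: "e \<in> Basis" using nonempty_Basis by blast
  define f where "f K = e \<bullet> center M K" for K
  obtain K where K: "K \<in> cells M" "f K = Max (f ` cells M)"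
    using Max_in[of "f ` cells M"] assms finite_cells
      by (metis (no_types, lifting) finite_imageI image_iff image_is_empty)
  then have Kmax: "f L \<le> f K" if "L \<in> cells M" for L using that finite_cells by simp
  obtain p where p: "p \<in> K" using cell_nonempty[OF K(1)] by blast
  then have "p \<in> interior K" using cell_open[OF K(1)] by (simp add: interior_open)
  then obtain t where t: "0 < t" "p + t *\<^sub>R e \<in> frontier K"
    using ray_to_frontier[OF cell_bounded[OF K(1)], of p e] e by (metis nonzero_Basis)
  then obtain \<sigma> where \<sigma>: "\<sigma> \<in> cell_faces M K" "p + t *\<^sub>R e \<in> \<sigma>"
    using frontier_cell[OF K(1)] by blast
  have f: "\<sigma> \<in> faces M" using cell_faces_sub[OF K(1)] \<sigma>(1) by blast
  have "\<sigma> \<notin> int_faces M"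
  proof
    assume int: "\<sigma> \<in> int_faces M"
    let ?L = "neighbour M K \<sigma>"
    note L = neighbour_cell[OF K(1) \<sigma>(1) int] neighbour_neq[OF K(1) \<sigma>(1) int] neighbour_contact[OF K(1) \<sigma>(1) int]
    have "(center M ?L - center M K) \<bullet> (p - (p + t *\<^sub>R e)) < 0"
      by (rule contact_orthogonal(2)[OF K(1) L(1)]) (use L \<sigma>(2) f p in auto)
    then have "f ?L > f K" using t(1)
      by (simp add: f_def inner_commute[of e] inner_diff_left algebra_simps)
    then show False using Kmax[OF L(1)] by simp
  qed
  then show ?thesis using that f faces_Un by blast
qed

text \<open>
  Otherwise the cells split into two classes without a common face, whose closures cover
  \<open>\<Omega>\<close>. As \<open>\<Omega>\<close> is connected, the classes touch at some
  point of \<open>\<Omega>\<close>. Inside a ball around this point, almost every segment from a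
  cell of one class to a cell of the other avoids the contact sets of the two classes, which
  have surface measure zero; but a segment is connected, too.
\<close>

lemma adjacency_connected:
  assumes A: "A \<subseteq> cells M" "A \<noteq> {}"
    and adj: "\<And>K L. K \<in> A \<Longrightarrow> L \<in> cells M \<Longrightarrow>
        K \<noteq> L \<Longrightarrow> closure K \<inter> closure L \<in> faces M \<Longrightarrow>
   L \<in> A"
  shows "A = cells M"
proof (rule ccontr)
  define B where "B = cells M - A"
  assume "A \<noteq> cells M"
  then have B: "B \<noteq> {}" using A by (auto simp: B_def)
  define CA where "CA = (\<Union>K\<in>A. closure K)"
  define CB where "CB = (\<Union>K\<in>B. closure K)"
  have fin: "finite A" "finite B" using A finite_cells finite_subset by (auto simp: B_def)
  have cl: "closed CA" "closed CB" using fin by (auto simp: CA_def CB_def)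
  have cov: "\<Omega> \<subseteq> CA \<union> CB"
  proof
    fix x assume "x \<in> \<Omega>"
    then have "x \<in> (\<Union>K\<in>cells M. closure K)" unfolding cover using closure_subset by blast
    then obtain K where "K \<in> cells M" "x \<in> closure K" by blast
    then show "x \<in> CA \<union> CB" by (cases "K \<in> A") (auto simp: CA_def CB_def B_def)
  qed
  have meet: "CA \<inter> \<Omega> \<noteq> {}" "CB \<inter> \<Omega> \<noteq> {}"
  proof -
    obtain K L where KL: "K \<in> A" "L \<in> B" using A B by blast
    then have "K \<in> cells M" "L \<in> cells M" using A by (auto simp: B_def)
    then obtain x y where "x \<in> K" "y \<in> L" "x \<in> \<Omega>" "y \<in> \<Omega>"
      using cell_nonempty[of K] cell_nonempty[of L] cell_subset[of K] cell_subset[of L] by blast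
    moreover have "K \<subseteq> CA" "L \<subseteq> CB"
      unfolding CA_def CB_def using KL closure_subset[of K] closure_subset[of L] by blast+
    ultimately show "CA \<inter> \<Omega> \<noteq> {}" "CB \<inter> \<Omega> \<noteq> {}" by blast+
  qed
  have "CA \<inter> CB \<inter> \<Omega> \<noteq> {}"
    using connected_closedD[OF connected_dom _ cov cl] meet by blast
  then obtain x K L where x: "x \<in> \<Omega>" "K \<in> A" "L \<in> B" "x \<in> closure K" "x \<in> closure L"
    by (auto simp: CA_def CB_def)
  have KL: "K \<in> cells M" "L \<in> cells M" using x A by (auto simp: B_def)
  obtain r where r: "r > 0" "ball x r \<subseteq> \<Omega>" using open_dom x(1) openE by blast
  obtain p where p: "p \<in> K" "p \<in> ball x r" using x(4) r(1)
    by (metis closure_approachable dist_commute mem_ball)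
  obtain q0 where q0: "q0 \<in> L" "q0 \<in> ball x r" using x(5) r(1)
    by (metis closure_approachable dist_commute mem_ball)
  \<comment> \<open>the points \<open>q\<close> for which the segment from \<open>p\<close> meets
    a contact set of the two classes\<close>
  define N where "N = (\<Union>(K', L')\<in>A \<times> B. {q. \<exists>t\<in>{0<..1}. p + t *\<^sub>R (q - p) \<in> closure K' \<inter> closure L'})"
  have "negligible N" unfolding N_def
  proof (intro negligible_Union)
    show "finite ((\<lambda>(K', L'). {q. \<exists>t\<in>{0<..1}. p + t *\<^sub>R (q - p) \<in> closure K' \<inter> closure L'}) ` (A \<times> B))"
      using fin by simp
    fix Z assume "Z \<in> (\<lambda>(K', L'). {q. \<exists>t\<in>{0<..1}. p + t *\<^sub>R (q - p) \<in> closure K' \<inter> closure L'}) ` (A \<times> B)"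
    then obtain K' L' where Z: "K' \<in> A" "L' \<in> B"
      "Z = {q. \<exists>t\<in>{0<..1}. p + t *\<^sub>R (q - p) \<in> closure K' \<inter> closure L'}"
        by auto
    have "K' \<in> cells M" "L' \<in> cells M" "K' \<noteq> L'" using Z A by (auto simp: B_def)
    moreover have "closure K' \<inter> closure L' \<notin> faces M"
      using adj[OF Z(1) _ \<open>K' \<noteq> L'\<close>] Z(2) by (auto simp: B_def)
    ultimately have "surface_measure (closure K' \<inter> closure L') = 0"
      using contact_dichotomy by blast
    moreover have "bounded (closure K' \<inter> closure L')"
      using bounded_closure[OF cell_bounded[OF \<open>K' \<in> cells M\<close>]]
        by (rule bounded_subset) blast
    ultimately show "negligible Z" unfolding Z(3) by (rule negligible_shadow)
  qed
  moreover have "\<not> negligible (L \<inter> ball x r)"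
    by (rule open_not_negligible) (use cell_open[OF KL(2)] q0 in auto)
  ultimately obtain q where q: "q \<in> L" "q \<in> ball x r" "q \<notin> N"
    using negligible_subset[of N "L \<inter> ball x r"] by blast
  have "closed_segment p q \<subseteq> ball x r" using p q by (intro closed_segment_subset convex_ball)
  then have seg: "closed_segment p q \<subseteq> CA \<union> CB" using r(2) cov by blast
  have "CA \<inter> CB \<inter> closed_segment p q = {}"
  proof -
    have False if y: "y \<in> CA" "y \<in> CB" "y \<in> closed_segment p q" for y
    proof -
      obtain K' L' where KL': "K' \<in> A" "L' \<in> B" "y \<in> closure K'" "y \<in> closure L'"
        using y by (auto simp: CA_def CB_def)
      obtain t where t: "0 \<le> t" "t \<le> 1" "y = (1 - t) *\<^sub>R p + t *\<^sub>R q" using y(3)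
        by (auto simp: in_segment)
      have ye: "y = p + t *\<^sub>R (q - p)" using t by (simp add: algebra_simps)
      show False
      proof (cases "t = 0")
        case True
        have "L' \<in> cells M" "K \<noteq> L'" using KL' x by (auto simp: B_def)
        then have "K \<inter> closure L' = {}"
          using open_Int_closure_eq_empty[OF cell_open[OF KL(1)]] cells_disjoint[OF KL(1)] by blast
        then show False using True ye KL' p(1) by auto
      next
        case False
        then have "t \<in> {0<..1}" using t by simp
        moreover have "p + t *\<^sub>R (q - p) \<in> closure K' \<inter> closure L'" using KL'(3,4) ye
          by simp
        ultimately have "q \<in> {q. \<exists>t\<in>{0<..1}. p + t *\<^sub>R (q - p) \<in> closure K' \<inter> closure L'}"
          by blast
        then have "q \<in> N" unfolding N_def using KL'(1,2) by (intro UN_I[of "(K', L')"]) auto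
        then show False using q(3) by blast
      qed
    qed
    then show ?thesis by blast
  qed
  then have "CA \<inter> closed_segment p q = {} \<or> CB \<inter> closed_segment p q = {}"
    using connected_closedD[OF connected_segment(1) _ seg cl] by blast
  moreover have "p \<in> CA" "q \<in> CB"
    unfolding CA_def CB_def using p(1) q(1) x(2,3) closure_subset[of K] closure_subset[of L] by blast+
  ultimately show False using ends_in_segment[of p q] by blast
qed

end

section \<open>The area of the boundary faces\<close>

text \<open>
  The boundary of \<open>\<Omega>\<close> lies in finitely many hyperplanes. For each of them,
  the slabs over the parts of the boundary faces in this hyperplane overlap in negligible sets,
  since distinct faces do so in sets of area zero, and all of these slabs lie in the slab over
  the part of the boundary in this hyperplane. Its volume does not depend on the mesh.
\<close>

lemma boundary_area_bound:
  fixes \<Omega> :: "'a::euclidean_space set"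
  assumes "open \<Omega>" "connected \<Omega>" "bounded \<Omega>" "open_polyhedral \<Omega>"
  shows "\<exists>A\<ge>0. \<forall>M :: 'a mesh. admissible_mesh \<Omega> M \<longrightarrow>
      (\<Sum>\<sigma>\<in>ext_faces \<Omega> M. face_measure \<sigma>) \<le> A"
proof -
  from frontier_open_polyhedral_subset[OF assms(4)] obtain H where H': "finite H \<and>
      (\<forall>i\<in>H. norm (fst i) = 1) \<and>
     frontier \<Omega> \<subseteq> (\<Union>i\<in>H. {x. fst i \<bullet> x = snd i})" ..
  then have H: "finite H" "\<And>i. i \<in> H \<Longrightarrow> norm (fst i) = 1"
     "frontier \<Omega> \<subseteq> (\<Union>i\<in>H. {x. fst i \<bullet> x = snd i})"
       by (elim conjE; simp)+
  define P where "P i = {x. fst i \<bullet> x = snd i}" for i :: "'a \<times> real"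
  have Pcl: "closed (P i)" for i unfolding P_def by (rule closed_hyperplane)
  let ?C = "surface_const TYPE('a)"
  have C: "?C > 0" by (rule surface_const_pos)
  define m where "m i S = measure lebesgue (slab (fst i) (S \<inter> P i))" for i S
  have fc: "compact (frontier \<Omega>)" using assms(3) by (rule compact_frontier_bounded)
  have "(\<Sum>\<sigma>\<in>ext_faces \<Omega> M. face_measure \<sigma>) \<le>
      ?C * (\<Sum>i\<in>H. m i (frontier \<Omega>))"
    if M: "admissible_mesh \<Omega> M" for M :: "'a mesh"
  proof -
    interpret meshed_domain \<Omega> M by (rule meshed_domain.intro[OF assms M])
    let ?E = "ext_faces \<Omega> M"
    have E: "finite ?E" "\<And>\<sigma>. \<sigma> \<in> ?E \<Longrightarrow>
        \<sigma> \<in> faces M" "\<And>\<sigma>. \<sigma> \<in> ?E \<Longrightarrow>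
   \<sigma> \<subseteq> frontier \<Omega>"
      using finite_faces by (simp_all add: ext_faces_def)
    have cp: "compact (\<sigma> \<inter> P i)" if "\<sigma> \<in> ?E" for \<sigma> i
      using face_compact[OF E(2)[OF that]] Pcl by (rule compact_Int_closed)
    have "face_measure \<sigma> \<le> ?C * (\<Sum>i\<in>H. m i \<sigma>)"
        if \<sigma>: "\<sigma> \<in> ?E" for \<sigma>
    proof -
      have "surface_measure \<sigma> \<le> ennreal (?C * (\<Sum>i\<in>H. m i \<sigma>))"
        unfolding m_def
      proof (rule surface_measure_le_slabs[OF H(1)])
        show "\<sigma> \<subseteq> (\<Union>i\<in>H. \<sigma> \<inter> P i)" using E(3)[OF \<sigma>] H(3)
          by (auto simp: P_def)
      qed (use cp[OF \<sigma>] H(2) in \<open>auto simp: P_def\<close>)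
      then show ?thesis unfolding face_measure_def
        using C by (intro enn2real_leI) (auto intro!: mult_nonneg_nonneg sum_nonneg simp: m_def)
    qed
    then have "(\<Sum>\<sigma>\<in>?E. face_measure \<sigma>) \<le>
        (\<Sum>\<sigma>\<in>?E. ?C * (\<Sum>i\<in>H. m i \<sigma>))"
      by (rule sum_mono)
    also have "\<dots> = ?C * (\<Sum>i\<in>H. \<Sum>\<sigma>\<in>?E. m i \<sigma>)"
      by (simp add: sum_distrib_left) (rule sum.swap)
    also have "\<dots> \<le> ?C * (\<Sum>i\<in>H. m i (frontier \<Omega>))"
    proof (intro mult_left_mono sum_mono)
      fix i assume i: "i \<in> H"
      have nn: "fst i \<bullet> fst i = 1" using H(2)[OF i] by (simp add: norm_eq_1)
      have "(\<Sum>\<sigma>\<in>?E. m i \<sigma>) =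
          measure lebesgue (\<Union>\<sigma>\<in>?E. slab (fst i) (\<sigma> \<inter> P i))"
        unfolding m_def
      proof (rule measure_negligible_finite_Union_image[symmetric, OF E(1)])
        show "slab (fst i) (\<sigma> \<inter> P i) \<in> lmeasurable" if "\<sigma> \<in> ?E" for \<sigma>
          by (rule lmeasurable_slab[OF cp[OF that]])
        show "pairwise (\<lambda>\<sigma> \<sigma>'. negligible (slab (fst i) (\<sigma> \<inter> P i) \<inter> slab (fst i) (\<sigma>' \<inter> P i))) ?E"
        proof (rule pairwiseI)
          fix \<sigma> \<sigma>' assume s: "\<sigma> \<in> ?E" "\<sigma>' \<in> ?E" "\<sigma> \<noteq> \<sigma>'"
          have "negligible (slab (fst i) (\<sigma> \<inter> \<sigma>'))"
            using s E(2) by (intro negligible_slab faces_almost_disjoint) auto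
          moreover have "slab (fst i) (\<sigma> \<inter> P i) \<inter> slab (fst i) (\<sigma>' \<inter> P i) \<subseteq>
              slab (fst i) (\<sigma> \<inter> \<sigma>')"
          proof
            fix x assume "x \<in> slab (fst i) (\<sigma> \<inter> P i) \<inter> slab (fst i) (\<sigma>' \<inter> P i)"
            then have xs: "x \<in> slab (fst i) (\<sigma> \<inter> P i)" "x \<in> slab (fst i) (\<sigma>' \<inter> P i)"
              by auto
            obtain s t where s: "s \<in> \<sigma>" "s \<in> P i" "t \<in> {0..1}" "x =
                s + t *\<^sub>R fst i"
              using xs(1) by (auto simp: slab_def)
            obtain s' t' where s': "s' \<in> \<sigma>'" "s' \<in> P i" "x = s' + t' *\<^sub>R fst i"
              using xs(2) by (auto simp: slab_def)
            have x: "s + t *\<^sub>R fst i = s' + t' *\<^sub>R fst i" using s s' by simp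
            have "t = t'" using arg_cong[OF x, of "inner (fst i)"] s(2) s'(2) nn
              by (simp add: inner_add_right P_def)
            then have "s = s'" using x by simp
            then show "x \<in> slab (fst i) (\<sigma> \<inter> \<sigma>')" using s s'(1)
              by (auto simp: slab_def)
          qed
          ultimately show "negligible (slab (fst i) (\<sigma> \<inter> P i) \<inter> slab (fst i) (\<sigma>' \<inter> P i))"
            by (rule negligible_subset)
        qed
      qed
      also have "\<dots> \<le> m i (frontier \<Omega>)" unfolding m_def
      proof (rule measure_mono_fmeasurable)
        show "(\<Union>\<sigma>\<in>?E. slab (fst i) (\<sigma> \<inter> P i)) \<subseteq>
            slab (fst i) (frontier \<Omega> \<inter> P i)"
        proof (rule UN_least)
          fix \<sigma> assume "\<sigma> \<in> ?E"
          then have "\<sigma> \<inter> P i \<subseteq> frontier \<Omega> \<inter> P i" using E(3)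
            by blast
          then show "slab (fst i) (\<sigma> \<inter> P i) \<subseteq>
              slab (fst i) (frontier \<Omega> \<inter> P i)"
            unfolding slab_def by (intro image_mono Sigma_mono) auto
        qed
        show "(\<Union>\<sigma>\<in>?E. slab (fst i) (\<sigma> \<inter> P i)) \<in> sets lebesgue"
          by (intro sets.finite_UN E(1) fmeasurableD lmeasurable_slab cp)
        show "slab (fst i) (frontier \<Omega> \<inter> P i) \<in> lmeasurable"
          by (intro lmeasurable_slab compact_Int_closed fc Pcl)
      qed
      finally show "(\<Sum>\<sigma>\<in>?E. m i \<sigma>) \<le> m i (frontier \<Omega>)" .
    qed (use C in auto)
    finally show ?thesis .
  qed
  moreover have "?C * (\<Sum>i\<in>H. m i (frontier \<Omega>)) \<ge> 0"
    using C by (intro mult_nonneg_nonneg sum_nonneg) (auto simp: m_def)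
  ultimately show ?thesis by blast
qed

section \<open>The flux function and the entropy\<close>

lemma sqra_swap: "sqra d a b p q = - sqra d b a q p"
  by (simp add: sqra_def algebra_simps)

lemma sqra_zero [simp]: "sqra d 0 0 p q = 0" and sqra_one [simp]: "sqra d 1 1 p q = 0"
  by (simp_all add: sqra_def)

lemma sqra_mono:
  assumes "0 < d" "a \<in> {0..1}" "b \<in> {0..1}" "a' \<in> {0..1}" "b' \<in> {0..1}" "a \<le>
      a'" "b' \<le> b"
  shows "sqra d a b p q \<le> sqra d a' b' p q"
proof -
  have "a * (1 - b) \<le> a' * (1 - b')" "b' * (1 - a') \<le> b * (1 - a)"
    using assms by (auto intro!: mult_mono)
  then have "a * (1 - b) * exp ((p - q) / 2) - b * (1 - a) * exp ((q - p) / 2) \<le>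
     a' * (1 - b') * exp ((p - q) / 2) - b' * (1 - a') * exp ((q - p) / 2)"
    by (intro diff_mono mult_right_mono) auto
  then show ?thesis using assms(1) unfolding sqra_def by (intro mult_left_mono) auto
qed

lemma continuous_on_sqra:
  assumes "continuous_on S f" "continuous_on S g"
  shows "continuous_on S (\<lambda>t. sqra d (f t) (g t) p q)"
  unfolding sqra_def by (intro continuous_intros assms)

text \<open>
  The derivative of the entropy on the open unit interval.
\<close>

definition logit :: "real \<Rightarrow> real" where
  "logit r = ln (r / (1 - r))"

lemma exp_logit: "r \<in> {0<..<1} \<Longrightarrow> exp (logit r) = r / (1 - r)"
  by (simp add: logit_def)

text \<open>
  Up to the positive factor \<open>exp (- (p + q) / 2) (1 - a) (1 - b) / d\<close>, the flux is
  the difference of \<open>exp (logit a + p)\<close> and \<open>exp (logit b + q)\<close>.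
\<close>

lemma sqra_nonneg:
  assumes d: "0 < d" and a: "a \<in> {0<..<1}" and b: "b \<in> {0<..<1}"
      and le: "logit b + q \<le> logit a + p"
  shows "0 \<le> sqra d a b p q"
proof -
  have "exp (logit b + q) \<le> exp (logit a + p)" using le by simp
  then have "b / (1 - b) * exp q \<le> a / (1 - a) * exp p" using a b by (simp add: exp_add exp_logit)
  then have "(b / (1 - b) * exp q) * ((1 - a) * (1 - b)) \<le> (a / (1 - a) * exp p) * ((1 - a) * (1 - b))"
    using a b by (intro mult_right_mono) auto
  moreover have "(b / (1 - b) * exp q) * ((1 - a) * (1 - b)) = b * (1 - a) * exp q"
      "(a / (1 - a) * exp p) * ((1 - a) * (1 - b)) = a * (1 - b) * exp p"
    using a b by auto
  ultimately have "b * (1 - a) * exp q \<le> a * (1 - b) * exp p" by simp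
  then have "b * (1 - a) * exp q * exp (- (p + q) / 2) \<le> a * (1 - b) * exp p * exp (- (p + q) / 2)"
    by (intro mult_right_mono) auto
  moreover have "exp q * exp (- (p + q) / 2) = exp ((q - p) / 2)" "exp p * exp (- (p + q) / 2) =
      exp ((p - q) / 2)"
    by (simp_all add: exp_add[symmetric] field_simps)
  ultimately have "b * (1 - a) * exp ((q - p) / 2) \<le> a * (1 - b) * exp ((p - q) / 2)"
    by (simp only: mult.assoc)
  then show ?thesis using d by (simp add: sqra_def)
qed

lemma sqra_dissipative:
  assumes "0 < d" "a \<in> {0<..<1}" "b \<in> {0<..<1}"
  shows "0 \<le> ((logit a + p) - (logit b + q)) * sqra d a b p q"
proof (cases "logit b + q \<le> logit a + p")
  case True
  then show ?thesis using sqra_nonneg[OF assms] by simp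
next
  case False
  then have "0 \<le> sqra d b a q p" using sqra_nonneg[OF assms(1,3,2)] by simp
  then show ?thesis using False sqra_swap[of d a b p q] by (intro mult_nonpos_nonpos) auto
qed

text \<open>
  Both factors change sign where \<open>w = \<beta> / \<alpha>\<close>, the density in
  equilibrium with the boundary reservoir.
\<close>

lemma robin_dissipative:
  assumes ab: "0 < \<beta>" "\<beta> < \<alpha>" and w: "w \<in> {0<..<1}"
  shows "0 \<le> (logit w + ln (\<alpha> / \<beta> - 1)) * (\<alpha> * w - \<beta>)"
proof -
  have pos: "\<alpha> / \<beta> - 1 > 0" using ab by simp
  have wpos: "w / (1 - w) > 0" using w by simp
  have e: "logit w + ln (\<alpha> / \<beta> - 1) = ln (w / (1 - w) * (\<alpha> / \<beta> - 1))"
    unfolding logit_def by (rule ln_mult_pos[OF wpos pos, symmetric])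
  have q: "w / (1 - w) * (\<alpha> / \<beta> - 1) = 1 + (\<alpha> * w - \<beta>) / ((1 - w) * \<beta>)"
    using ab w by (simp add: field_simps)
  have D: "(1 - w) * \<beta> > 0" using ab w by simp
  show ?thesis
  proof (cases "0 \<le> \<alpha> * w - \<beta>")
    case True
    then have "0 \<le> (\<alpha> * w - \<beta>) / ((1 - w) * \<beta>)" using D
      by (intro divide_nonneg_pos)
    then have "0 \<le> logit w + ln (\<alpha> / \<beta> - 1)" unfolding e q by (intro ln_ge_zero) auto
    then show ?thesis using True by (rule mult_nonneg_nonneg)
  next
    case False
    then have "(\<alpha> * w - \<beta>) / ((1 - w) * \<beta>) \<le> 0" using D
      by (intro divide_nonpos_pos) auto
    moreover have "0 < w / (1 - w) * (\<alpha> / \<beta> - 1)" using pos wpos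
      by (rule mult_pos_pos[rotated])
    ultimately have "logit w + ln (\<alpha> / \<beta> - 1) \<le> 0" unfolding e using q
      by (simp add: ln_le_zero_iff)
    then show ?thesis using False by (intro mult_nonpos_nonpos) auto
  qed
qed

lemma relative_entropy_ge:
  assumes "0 \<le> s" "0 < (r::real)"
  shows "s - r \<le> s * ln s - s * ln r"
proof (cases "s = 0")
  case False
  then have s: "s > 0" using assms by simp
  have "ln (r / s) \<le> r / s - 1" using assms s by (intro ln_le_minus_one) auto
  then have "s * ln (r / s) \<le> s * (r / s - 1)" using s by (intro mult_left_mono) auto
  moreover have "s * ln (r / s) = s * ln r - s * ln s" using assms s by (simp add: ln_div algebra_simps)
  moreover have "s * (r / s - 1) = r - s" using s by (simp add: algebra_simps)
  ultimately show ?thesis by simp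
qed (use assms in simp)

text \<open>
  Convexity of the entropy, stated up to the end points of the unit interval for
  \<open>s\<close>, because the densities before the first time step may be \<open>0\<close> or
  \<open>1\<close>.
\<close>

lemma entropy_tangent:
  assumes r: "r \<in> {0<..<1}" and s: "s \<in> {0..1}"
  shows "entropy r + logit r * (s - r) \<le> entropy s"
proof -
  have l: "logit r = ln r - ln (1 - r)" using r by (simp add: logit_def ln_div)
  have "entropy s - (entropy r + logit r * (s - r)) =
    (s * ln s - s * ln r) + ((1 - s) * ln (1 - s) - (1 - s) * ln (1 - r))"
    unfolding entropy_def l by (simp add: algebra_simps)
  moreover have "\<dots> \<ge> (s - r) + ((1 - s) - (1 - r))"
    using r s by (intro add_mono relative_entropy_ge) auto
  ultimately show ?thesis by simp
qed

lemma entropy_nonneg: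
  assumes "s \<in> {0..1}"
  shows "0 \<le> entropy s"
proof -
  have "entropy (1/2) = 0" "logit (1/2) = 0" by (simp_all add: entropy_def logit_def ln_div)
  then show ?thesis using entropy_tangent[of "1/2" s] assms by simp
qed

section \<open>Solvability of monotone systems\<close>

text \<open>
  Perron's method. Lowering the other unknowns raises an equation, so the supremum
  \<open>X\<close> of all subsolutions is a subsolution as well; if an equation were strictly
  negative at \<open>X\<close>, its own unknown could be raised a little, which again gives a
  subsolution. At the upper end \<open>1\<close> there is no room for raising, but there the
  supersolution applies.
\<close>

lemma monotone_system_solvable:
  fixes E :: "'i \<Rightarrow> ('i \<Rightarrow> real) \<Rightarrow> real" and I :: "'i set"
  assumes offdiag: "\<And>i x y. i \<in> I \<Longrightarrow>
      \<forall>j\<in>I. x j \<in> {0..1} \<Longrightarrow>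
   \<forall>j\<in>I. y j \<in> {0..1} \<Longrightarrow>
      x i = y i \<Longrightarrow> \<forall>j\<in>I. x j \<le> y j \<Longrightarrow> E i y \<le> E i x"
    and cont: "\<And>i x. i \<in> I \<Longrightarrow> continuous_on {0..1} (\<lambda>t. E i (x(i := t)))"
    and lo: "\<And>i. i \<in> I \<Longrightarrow> E i (\<lambda>_. 0) \<le> 0"
        and hi: "\<And>i. i \<in> I \<Longrightarrow> 0 \<le> E i (\<lambda>_. 1)"
  shows "\<exists>x. (\<forall>i\<in>I. x i \<in> {0..1}) \<and> (\<forall>i\<in>I. E i x = 0)"
proof -
  define S where "S = {x. (\<forall>j\<in>I. x j \<in> {0..1}) \<and> (\<forall>i\<in>I. E i x \<le> 0)}"
  define X where "X i = (SUP x\<in>S. x i)" for i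
  have S0: "(\<lambda>_. 0) \<in> S" using lo by (simp add: S_def)
  have bdd: "bdd_above ((\<lambda>x. x i) ` S)" if "i \<in> I" for i
    using that by (intro bdd_aboveI[of _ 1]) (auto simp: S_def)
  have upper: "x i \<le> X i" if "x \<in> S" "i \<in> I" for x i
    unfolding X_def by (rule cSUP_upper[OF that(1) bdd[OF that(2)]])
  have X01: "\<forall>j\<in>I. X j \<in> {0..1}"
  proof
    fix j assume j: "j \<in> I"
    have "X j \<le> 1" unfolding X_def using S0 j by (intro cSUP_least) (auto simp: S_def)
    then show "X j \<in> {0..1}" using upper[OF S0 j] by simp
  qed
  have near: "\<exists>\<delta>>0. \<forall>t\<in>{0..1}. \<bar>t - X i\<bar> < \<delta> \<longrightarrow>
      \<bar>E i (X(i := t)) - E i X\<bar> < e"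
    if "i \<in> I" "e > 0" for i e
  proof -
    have "\<exists>\<delta>>0. \<forall>t\<in>{0..1}. dist t (X i) < \<delta> \<longrightarrow>
        dist (E i (X(i := t))) (E i (X(i := X i))) < e"
      using cont[OF that(1), of X] X01 that unfolding continuous_on_iff by blast
    then show ?thesis by (simp add: dist_real_def)
  qed
  have le0: "E i X \<le> 0" if i: "i \<in> I" for i
  proof (rule ccontr)
    assume "\<not> E i X \<le> 0"
    then obtain \<delta> where \<delta>: "\<delta> > 0" "\<And>t. t \<in> {0..1} \<Longrightarrow>
        \<bar>t - X i\<bar> < \<delta> \<Longrightarrow> \<bar>E i (X(i := t)) - E i X\<bar> < E i X"
      using near[OF i, of "E i X"] by auto
    have "X i - \<delta> < (SUP x\<in>S. x i)" using \<delta>(1) by (simp add: X_def)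
    then obtain y where y: "y \<in> S" "X i - \<delta> < y i"
      using less_cSUP_iff[of S "\<lambda>x. x i" "X i - \<delta>"] S0 bdd[OF i] by blast
    have y01: "\<forall>j\<in>I. y j \<in> {0..1}" using y(1) by (simp add: S_def)
    have "y i \<le> X i" using upper[OF y(1) i] .
    then have "E i (X(i := y i)) > 0" using \<delta>(2)[of "y i"] y(2) y01 i by force
    moreover have "E i (X(i := y i)) \<le> E i y"
      by (rule offdiag[OF i]) (use y01 X01 upper[OF y(1)] in auto)
    moreover have "E i y \<le> 0" using y(1) i by (simp add: S_def)
    ultimately show False by simp
  qed
  have "E i X = 0" if i: "i \<in> I" for i
  proof (rule ccontr)
    assume "E i X \<noteq> 0"
    then have neg: "E i X < 0" using le0[OF i] by simp
    have "X i \<noteq> 1"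
    proof
      assume "X i = 1"
      then have "E i (\<lambda>_. 1) \<le> E i X" by (intro offdiag[OF i X01]) (use X01 in auto)
      then show False using hi[OF i] neg by simp
    qed
    then have X1: "X i < 1" "0 \<le> X i" using X01 i by force+
    obtain \<delta> where \<delta>: "\<delta> > 0" "\<And>t. t \<in> {0..1} \<Longrightarrow>
        \<bar>t - X i\<bar> < \<delta> \<Longrightarrow> \<bar>E i (X(i := t)) - E i X\<bar> < - E i X"
      using near[OF i, of "- E i X"] neg by auto
    define t where "t = min 1 (X i + \<delta> / 2)"
    have t: "X i < t" "t \<in> {0..1}" "\<bar>t - X i\<bar> < \<delta>" using \<delta>(1) X1
      by (auto simp: t_def)
    have t01: "\<forall>j\<in>I. (X(i := t)) j \<in> {0..1}" using X01 t(2) by simp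
    have "E j (X(i := t)) \<le> 0" if j: "j \<in> I" for j
    proof (cases "j = i")
      case True
      then show ?thesis using \<delta>(2)[OF t(2,3)] by simp
    next
      case False
      then have "E j (X(i := t)) \<le> E j X" by (intro offdiag[OF j X01 t01]) (use t(1) in auto)
      then show ?thesis using le0[OF j] by simp
    qed
    then have "X(i := t) \<in> S" using t01 by (simp add: S_def)
    from upper[OF this i] show False using t(1) by simp
  qed
  then show ?thesis using X01 by blast
qed

section \<open>Fluxes on a mesh\<close>

locale sqra_scheme = meshed_domain \<Omega> M
  for \<Omega> :: "'a::euclidean_space set" and M :: "'a mesh" +
  fixes \<phi> \<alpha> \<beta> :: "'a \<Rightarrow> real" and \<tau> :: real
  assumes rates: "\<forall>x\<in>frontier \<Omega>. \<alpha> x > \<beta> x \<and> \<beta> x > 0"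
      and \<tau>: "\<tau> > 0"
begin

abbreviation \<beta>_face where "\<beta>_face \<sigma> \<equiv> \<beta> (face_center M \<sigma>)"
abbreviation \<alpha>_face where "\<alpha>_face \<sigma> \<equiv> \<alpha> (face_center M \<sigma>)"

lemma rates_face: "\<sigma> \<in> ext_faces \<Omega> M \<Longrightarrow>
    0 < \<beta>_face \<sigma> \<and> \<beta>_face \<sigma> < \<alpha>_face \<sigma>"
  using rates face_center_frontier by blast

lemma finite_cell_faces: "K \<in> cells M \<Longrightarrow> finite (cell_faces M K)"
  using cell_faces_sub finite_faces finite_subset by blast

lemma cell_face_cases:
  assumes "K \<in> cells M" "\<sigma> \<in> cell_faces M K"
  obtains (int) "\<sigma> \<in> int_faces M" "\<sigma> \<notin> ext_faces \<Omega> M" | (ext) "\<sigma> \<in> ext_faces \<Omega> M" "\<sigma> \<notin> int_faces M"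
  using assms cell_faces_sub faces_Un int_ext_disjoint by blast

lemma cell_face_measure_pos: "K \<in> cells M \<Longrightarrow>
    \<sigma> \<in> cell_faces M K \<Longrightarrow> face_measure \<sigma> > 0"
  using face_measure_pos cell_faces_sub by blast

text \<open>
  Hides the distance of the centers, of which only the positivity is used.
\<close>

lemma flux_int:
  assumes "K \<in> cells M" "\<sigma> \<in> cell_faces M K" "\<sigma> \<in> int_faces M"
  shows "\<exists>d>0. \<forall>u w. flux M \<phi> u w K \<sigma> =
     sqra d (u K) (u (neighbour M K \<sigma>)) (\<phi> (center M K)) (\<phi> (center M (neighbour M K \<sigma>)))"
proof -
  have "center M K \<noteq> center M (neighbour M K \<sigma>)"
    using inj_center neighbour_cell[OF assms] neighbour_neq[OF assms] assms(1) by (metis inj_onD)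
  then have "dist (center M K) (center M (neighbour M K \<sigma>)) > 0" by simp
  then show ?thesis using assms(3)
    by (intro exI[of _ "dist (center M K) (center M (neighbour M K \<sigma>))"]) (simp add: flux_def Let_def)
qed

lemma flux_ext:
  assumes "K \<in> cells M" "\<sigma> \<in> ext_faces \<Omega> M"
  shows "\<exists>d>0. \<forall>u w. flux M \<phi> u w K \<sigma> =
     sqra d (u K) (w \<sigma>) (\<phi> (center M K)) (\<phi> (face_center M \<sigma>))"
proof -
  have "center M K \<noteq> face_center M \<sigma>"
    using center_in[OF assms(1)] face_center_frontier[OF assms(2)] open_dom
      by (auto simp: frontier_def interior_open)
  then have "dist (center M K) (face_center M \<sigma>) > 0" by simp
  moreover have "\<sigma> \<notin> int_faces M" using assms(2) int_ext_disjoint by blast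
  ultimately show ?thesis
    by (intro exI[of _ "dist (center M K) (face_center M \<sigma>)"]) (simp add: flux_def)
qed

lemma flux_neighbour:
  assumes "K \<in> cells M" "\<sigma> \<in> cell_faces M K" "\<sigma> \<in> int_faces M"
  shows "flux M \<phi> u w (neighbour M K \<sigma>) \<sigma> = - flux M \<phi> u w K \<sigma>"
  using assms(3) neighbour_neighbour[OF assms]
    sqra_swap[of "dist (center M K) (center M (neighbour M K \<sigma>))" "u (neighbour M K \<sigma>)" "u K"]
  by (simp add: flux_def Let_def dist_commute)

lemma flux_mono:
  assumes K: "K \<in> cells M" "\<sigma> \<in> cell_faces M K"
    and u: "\<forall>K\<in>cells M. u K \<in> {0..1}" "\<forall>K\<in>cells M. u' K \<in> {0..1}"
    and w: "\<forall>\<sigma>\<in>ext_faces \<Omega> M. w \<sigma> \<in> {0..1}" "\<forall>\<sigma>\<in>ext_faces \<Omega> M. w' \<sigma> \<in> {0..1}"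
    and le: "u K \<le> u' K" "\<sigma> \<in> int_faces M \<Longrightarrow>
        u' (neighbour M K \<sigma>) \<le> u (neighbour M K \<sigma>)"
      "\<sigma> \<in> ext_faces \<Omega> M \<Longrightarrow> w' \<sigma> \<le> w \<sigma>"
  shows "flux M \<phi> u w K \<sigma> \<le> flux M \<phi> u' w' K \<sigma>"
  using K
proof (cases rule: cell_face_cases)
  case int
  obtain d where d: "d > 0" "\<And>u w. flux M \<phi> u w K \<sigma> =
      sqra d (u K) (u (neighbour M K \<sigma>)) (\<phi> (center M K)) (\<phi> (center M (neighbour M K \<sigma>)))"
    using flux_int[OF K int(1)] by blast
  show ?thesis unfolding d(2)
    using u neighbour_cell[OF K int(1)] K(1) le(1) le(2)[OF int(1)] by (intro sqra_mono d(1)) auto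
next
  case ext
  obtain d where d: "d > 0" "\<And>u w. flux M \<phi> u w K \<sigma> =
      sqra d (u K) (w \<sigma>) (\<phi> (center M K)) (\<phi> (face_center M \<sigma>))"
    using flux_ext[OF K(1) ext(1)] by blast
  show ?thesis unfolding d(2)
    using u w K(1) ext(1) le(1) le(3)[OF ext(1)] by (intro sqra_mono d(1)) auto
qed

lemma flux_cong:
  assumes K: "K \<in> cells M" "\<sigma> \<in> cell_faces M K"
    and "\<forall>K\<in>cells M. u K = u' K" "\<forall>\<sigma>\<in>ext_faces \<Omega> M. w \<sigma> =
        w' \<sigma>"
  shows "flux M \<phi> u w K \<sigma> = flux M \<phi> u' w' K \<sigma>"
  using K
proof (cases rule: cell_face_cases)
  case int
  then show ?thesis using flux_int[OF K int(1)] neighbour_cell[OF K int(1)] assms by metis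
next
  case ext
  then show ?thesis using flux_ext[OF K(1) ext(1)] assms by metis
qed

lemma sum_cell_faces:
  assumes "K \<in> cells M"
  shows "(\<Sum>\<sigma>\<in>cell_faces M K. g \<sigma> :: real) =
     (\<Sum>\<sigma>\<in>cell_faces M K \<inter> int_faces M. g \<sigma>) + (\<Sum>\<sigma>\<in>cell_faces M K \<inter> ext_faces \<Omega> M. g \<sigma>)"
proof -
  have "cell_faces M K = (cell_faces M K \<inter> int_faces M) \<union> (cell_faces M K \<inter> ext_faces \<Omega> M)"
    using cell_faces_sub[OF assms] faces_Un by blast
  moreover have "(cell_faces M K \<inter> int_faces M) \<inter> (cell_faces M K \<inter> ext_faces \<Omega> M) =
      {}"
    using int_ext_disjoint by blast
  ultimately show ?thesis
    using sum.union_disjoint[of "cell_faces M K \<inter> int_faces M" "cell_faces M K \<inter> ext_faces \<Omega> M" g]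
      finite_cell_faces[OF assms] by auto
qed

lemma sum_ext_by_owner:
  "(\<Sum>K\<in>cells M. \<Sum>\<sigma>\<in>cell_faces M K \<inter> ext_faces \<Omega> M. g K \<sigma> :: real) =
      (\<Sum>\<sigma>\<in>ext_faces \<Omega> M. g (owner M \<sigma>) \<sigma>)"
proof -
  have "(\<Sum>K\<in>cells M. \<Sum>\<sigma>\<in>cell_faces M K \<inter> ext_faces \<Omega> M. g K \<sigma>) =
    (\<Sum>(K, \<sigma>)\<in>Sigma (cells M) (\<lambda>K. cell_faces M K \<inter> ext_faces \<Omega> M). g K \<sigma>)"
    using finite_cells finite_cell_faces by (intro sum.Sigma) auto
  also have "\<dots> = (\<Sum>\<sigma>\<in>ext_faces \<Omega> M. g (owner M \<sigma>) \<sigma>)"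
    by (rule sum.reindex_bij_witness[of _ "\<lambda>\<sigma>. (owner M \<sigma>, \<sigma>)" snd])
       (auto simp: owner_eq owner_cell owner_face)
  finally show ?thesis .
qed

text \<open>
  Summation by parts over the interior faces: the involution that passes from a cell and one of
  its faces to the neighbour across this face turns the sum into half of a sum over differences
  of the weights. It is applied with the indicator of a set of cells (uniqueness) and with the
  chemical potential (dissipation).
\<close>

lemma sum_int_nonneg:
  assumes anti: "\<And>K \<sigma>. K \<in> cells M \<Longrightarrow>
      \<sigma> \<in> cell_faces M K \<Longrightarrow> \<sigma> \<in> int_faces M \<Longrightarrow>
   G (neighbour M K \<sigma>) \<sigma> = - G K \<sigma>"
    and diss: "\<And>K \<sigma>. K \<in> cells M \<Longrightarrow>
        \<sigma> \<in> cell_faces M K \<Longrightarrow> \<sigma> \<in> int_faces M \<Longrightarrow>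
       0 \<le> (\<psi> K - \<psi> (neighbour M K \<sigma>)) * G K \<sigma>"
  shows "0 \<le> (\<Sum>K\<in>cells M. \<Sum>\<sigma>\<in>cell_faces M K \<inter> int_faces M. \<psi> K * G K \<sigma> :: real)"
proof -
  let ?D = "Sigma (cells M) (\<lambda>K. cell_faces M K \<inter> int_faces M)"
  let ?h = "\<lambda>(K, \<sigma>). (neighbour M K \<sigma>, \<sigma>)"
  have e: "(\<Sum>K\<in>cells M. \<Sum>\<sigma>\<in>cell_faces M K \<inter> int_faces M. \<psi> K * G K \<sigma>) =
      (\<Sum>(K, \<sigma>)\<in>?D. \<psi> K * G K \<sigma>)"
    using finite_cells finite_cell_faces by (intro sum.Sigma) auto
  have "(\<Sum>(K, \<sigma>)\<in>?D. \<psi> K * G K \<sigma>) =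
      (\<Sum>(K, \<sigma>)\<in>?D. - (\<psi> (neighbour M K \<sigma>) * G K \<sigma>))"
    by (rule sum.reindex_bij_witness[of _ ?h ?h])
       (auto simp: neighbour_neighbour neighbour_cell neighbour_cell_faces anti)
  then have "2 * (\<Sum>(K, \<sigma>)\<in>?D. \<psi> K * G K \<sigma>) =
      (\<Sum>(K, \<sigma>)\<in>?D. \<psi> K * G K \<sigma>) + (\<Sum>(K, \<sigma>)\<in>?D. - (\<psi> (neighbour M K \<sigma>) * G K \<sigma>))" by simp
  also have "\<dots> = (\<Sum>(K, \<sigma>)\<in>?D. (\<psi> K - \<psi> (neighbour M K \<sigma>)) * G K \<sigma>)"
    unfolding sum.distrib[symmetric] by (rule sum.cong) (auto simp: algebra_simps)
  also have "\<dots> \<ge> 0" by (rule sum_nonneg) (use diss in auto)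
  finally show ?thesis unfolding e by simp
qed

section \<open>Uniqueness of the time step\<close>

lemma step_cell:
  assumes "sqra_step \<Omega> \<phi> \<alpha> \<beta> M \<tau> v u w" "K \<in> cells M"
  shows "(\<Sum>\<sigma>\<in>cell_faces M K. face_measure \<sigma> * flux M \<phi> u w K \<sigma>) =
      (v K - u K) / \<tau> * cell_measure K"
proof -
  have "(u K - v K) / \<tau> * cell_measure K + (\<Sum>\<sigma>\<in>cell_faces M K. face_measure \<sigma> * flux M \<phi> u w K \<sigma>) =
      0"
    using assms by (simp add: sqra_step_def)
  moreover have "(v K - u K) / \<tau> * cell_measure K = - ((u K - v K) / \<tau> * cell_measure K)"
    by (simp add: algebra_simps diff_divide_distrib)
  ultimately show ?thesis by simp
qed

lemma step_face:
  assumes "sqra_step \<Omega> \<phi> \<alpha> \<beta> M \<tau> v u w" "K \<in> cells M" "\<sigma> \<in> cell_faces M K" "\<sigma> \<in> ext_faces \<Omega> M"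
  shows "flux M \<phi> u w K \<sigma> = \<alpha>_face \<sigma> * w \<sigma> - \<beta>_face \<sigma>"
  using assms unfolding sqra_step_def by blast

lemma step_cong:
  assumes "\<forall>K\<in>cells M. u K =
      u' K" "\<forall>\<sigma>\<in>ext_faces \<Omega> M. w \<sigma> =
   w' \<sigma>" "sqra_step \<Omega> \<phi> \<alpha> \<beta> M \<tau> v u w"
  shows "sqra_step \<Omega> \<phi> \<alpha> \<beta> M \<tau> v u' w'"
  using assms(3) flux_cong[OF _ _ assms(1,2)] assms(1,2) unfolding sqra_step_def by simp

text \<open>
  The weight is the indicator \<open>\<psi>\<close> of the cells where the claim fails. At a
  boundary face of such a cell the difference of the fluxes is nonnegative in either case: if
  the first boundary value is not larger, then by monotonicity of \<open>sqra\<close>, and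
  otherwise by the boundary condition.
\<close>

lemma step_le:
  assumes s: "sqra_step \<Omega> \<phi> \<alpha> \<beta> M \<tau> v u w" "sqra_step \<Omega> \<phi> \<alpha> \<beta> M \<tau> v u' w'"
    and u: "\<forall>K\<in>cells M. u K \<in> {0..1}" "\<forall>K\<in>cells M. u' K \<in> {0..1}"
    and w: "\<forall>\<sigma>\<in>ext_faces \<Omega> M. w \<sigma> \<in> {0..1}" "\<forall>\<sigma>\<in>ext_faces \<Omega> M. w' \<sigma> \<in> {0..1}"
  shows "\<forall>K\<in>cells M. u K \<le> u' K"
proof -
  define \<psi> where "\<psi> K = (if u' K < u K then 1 else 0 :: real)" for K
  define G where "G K \<sigma> =
      face_measure \<sigma> * (flux M \<phi> u w K \<sigma> - flux M \<phi> u' w' K \<sigma>)"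
      for K \<sigma>
  note fm = cell_face_measure_pos[THEN less_imp_le]
  have int: "0 \<le> (\<Sum>K\<in>cells M. \<Sum>\<sigma>\<in>cell_faces M K \<inter> int_faces M. \<psi> K * G K \<sigma>)"
  proof (rule sum_int_nonneg)
    fix K \<sigma> assume K: "K \<in> cells M" "\<sigma> \<in> cell_faces M K" "\<sigma> \<in> int_faces M"
    show "G (neighbour M K \<sigma>) \<sigma> = - G K \<sigma>" using flux_neighbour[OF K]
      by (simp add: G_def algebra_simps)
    let ?L = "neighbour M K \<sigma>"
    have ne: "\<sigma> \<notin> ext_faces \<Omega> M" using K(3) int_ext_disjoint by blast
    \<comment> \<open>only faces between a cell in the indicated set and one outside of it
      contribute\<close>
    consider "\<psi> K = \<psi> ?L" | "u' K < u K" "u ?L \<le> u' ?L" | "u K \<le> u' K" "u' ?L < u ?L"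
      unfolding \<psi>_def by force
    then show "0 \<le> (\<psi> K - \<psi> ?L) * G K \<sigma>"
    proof cases
      case 2
      then have "flux M \<phi> u' w' K \<sigma> \<le> flux M \<phi> u w K \<sigma>"
        using ne by (intro flux_mono[OF K(1,2) u(2,1) w(2,1)]) auto
      then show ?thesis using 2 fm[OF K(1,2)] by (simp add: \<psi>_def G_def)
    next
      case 3
      then have "flux M \<phi> u w K \<sigma> \<le> flux M \<phi> u' w' K \<sigma>"
        using ne by (intro flux_mono[OF K(1,2) u w]) auto
      then show ?thesis using 3 fm[OF K(1,2)] by (simp add: \<psi>_def G_def mult_nonneg_nonpos)
    qed simp
  qed
  have ext: "0 \<le> (\<Sum>K\<in>cells M. \<Sum>\<sigma>\<in>cell_faces M K \<inter> ext_faces \<Omega> M. \<psi> K * G K \<sigma>)"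
  proof (intro sum_nonneg)
    fix K \<sigma> assume K: "K \<in> cells M"
        and "\<sigma> \<in> cell_faces M K \<inter> ext_faces \<Omega> M"
    then have \<sigma>: "\<sigma> \<in> cell_faces M K" "\<sigma> \<in> ext_faces \<Omega> M" by auto
    have "flux M \<phi> u' w' K \<sigma> \<le> flux M \<phi> u w K \<sigma>" if "u' K < u K"
    proof (cases "w \<sigma> \<le> w' \<sigma>")
      case True
      then show ?thesis using that \<sigma>(2) int_ext_disjoint
        by (intro flux_mono[OF K \<sigma>(1) u(2,1) w(2,1)]) auto
    next
      case False
      then show ?thesis using step_face[OF s(1) K \<sigma>] step_face[OF s(2) K \<sigma>] rates_face[OF \<sigma>(2)]
        by (simp add: mult_left_mono)
    qed
    then show "0 \<le> \<psi> K * G K \<sigma>" using fm[OF K \<sigma>(1)]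
      by (simp add: \<psi>_def G_def)
  qed
  define D where "D K = \<psi> K * ((u K - u' K) / \<tau> * cell_measure K)" for K
  have Dnn: "0 \<le> D K" if "K \<in> cells M" for K
    using \<tau> cell_measure_pos[OF that] by (simp add: D_def \<psi>_def)
  have "(\<Sum>\<sigma>\<in>cell_faces M K. \<psi> K * G K \<sigma>) = - D K"
      if K: "K \<in> cells M" for K
  proof -
    have "(\<Sum>\<sigma>\<in>cell_faces M K. G K \<sigma>) =
        (v K - u K) / \<tau> * cell_measure K - (v K - u' K) / \<tau> * cell_measure K"
      unfolding step_cell[OF s(1) K, symmetric] step_cell[OF s(2) K, symmetric] G_def sum_subtractf[symmetric]
      by (simp add: algebra_simps)
    also have "\<dots> = - ((u K - u' K) / \<tau> * cell_measure K)"
      using \<tau> by (simp add: field_simps)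
    finally show ?thesis by (simp add: D_def sum_distrib_left[symmetric])
  qed
  then have "- (\<Sum>K\<in>cells M. D K) =
      (\<Sum>K\<in>cells M. \<Sum>\<sigma>\<in>cell_faces M K. \<psi> K * G K \<sigma>)"
    by (simp add: sum_negf)
  also have "\<dots> \<ge> 0" using int ext by (simp add: sum_cell_faces sum.distrib)
  finally have "(\<Sum>K\<in>cells M. D K) = 0" using sum_nonneg[of "cells M" D] Dnn by simp
  then have D0: "\<forall>K\<in>cells M. D K = 0" using sum_nonneg_eq_0_iff[OF finite_cells Dnn] by simp
  show ?thesis
  proof (rule ballI, rule ccontr)
    fix K assume K: "K \<in> cells M" "\<not> u K \<le> u' K"
    then have "D K > 0" using \<tau> cell_measure_pos[OF K(1)] by (simp add: D_def \<psi>_def)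
    then show False using D0 K(1) by simp
  qed
qed

text \<open>
  Equal cell values force equal boundary values: for fixed cell value the flux decreases in the
  boundary value, and \<open>\<alpha> w - \<beta>\<close> increases strictly.
\<close>

lemma step_unique:
  assumes s: "sqra_step \<Omega> \<phi> \<alpha> \<beta> M \<tau> v u w" "sqra_step \<Omega> \<phi> \<alpha> \<beta> M \<tau> v u' w'"
    and u: "\<forall>K\<in>cells M. u K \<in> {0..1}" "\<forall>K\<in>cells M. u' K \<in> {0..1}"
    and w: "\<forall>\<sigma>\<in>ext_faces \<Omega> M. w \<sigma> \<in> {0..1}" "\<forall>\<sigma>\<in>ext_faces \<Omega> M. w' \<sigma> \<in> {0..1}"
  shows "(\<forall>K\<in>cells M. u K = u' K) \<and>
      (\<forall>\<sigma>\<in>ext_faces \<Omega> M. w \<sigma> = w' \<sigma>)"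
proof -
  have eq: "\<forall>K\<in>cells M. u K = u' K"
    using step_le[OF s u w] step_le[OF s(2,1) u(2,1) w(2,1)] by force
  have le: "w1 \<sigma> \<le> w2 \<sigma>" if \<sigma>: "\<sigma> \<in> ext_faces \<Omega> M"
    and s: "sqra_step \<Omega> \<phi> \<alpha> \<beta> M \<tau> v u1 w1" "sqra_step \<Omega> \<phi> \<alpha> \<beta> M \<tau> v u2 w2"
    and u: "\<forall>K\<in>cells M. u1 K \<in> {0..1}" "\<forall>K\<in>cells M. u2 K \<in> {0..1}" "\<forall>K\<in>cells M. u1 K =
        u2 K"
    and w: "\<forall>\<sigma>\<in>ext_faces \<Omega> M. w1 \<sigma> \<in> {0..1}" "\<forall>\<sigma>\<in>ext_faces \<Omega> M. w2 \<sigma> \<in> {0..1}"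
        for \<sigma> u1 w1 u2 w2
  proof (rule ccontr)
    assume n: "\<not> w1 \<sigma> \<le> w2 \<sigma>"
    note K = owner_cell[OF \<sigma>] owner_face[OF \<sigma>]
    have "flux M \<phi> u1 w1 (owner M \<sigma>) \<sigma> \<le>
        flux M \<phi> u2 w2 (owner M \<sigma>) \<sigma>"
      using n K u(3) \<sigma> int_ext_disjoint by (intro flux_mono[OF K u(1,2) w]) auto
    then have "\<alpha>_face \<sigma> * w1 \<sigma> \<le> \<alpha>_face \<sigma> * w2 \<sigma>"
      using step_face[OF s(1) K \<sigma>] step_face[OF s(2) K \<sigma>] by simp
    then show False using n rates_face[OF \<sigma>] by (simp add: mult_le_cancel_left)
  qed
  have "w \<sigma> = w' \<sigma>" if "\<sigma> \<in> ext_faces \<Omega> M" for \<sigma>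
    using le[OF that s u eq w] le[OF that s(2,1) u(2,1) _ w(2,1)] eq by force
  then show ?thesis using eq by blast
qed

section \<open>Existence of the time step\<close>

text \<open>
  The unknowns on cells and boundary faces are collected in one function on a sum type. Keeping
  the boundary values as unknowns, rather than eliminating them, makes the whole system
  monotone.
\<close>

lemma step_exists_closed:
  assumes v: "\<forall>K\<in>cells M. v K \<in> {0..1}"
  shows "\<exists>u w. (\<forall>K\<in>cells M. u K \<in> {0..1}) \<and>
      (\<forall>\<sigma>\<in>ext_faces \<Omega> M. w \<sigma> \<in> {0..1}) \<and>
    sqra_step \<Omega> \<phi> \<alpha> \<beta> M \<tau> v u w"
proof -
  define I where "I = Inl ` cells M \<union> Inr ` ext_faces \<Omega> M"
  define F where "F x K \<sigma> = flux M \<phi> (x \<circ> Inl) (x \<circ> Inr) K \<sigma>"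
      for x :: "'a set + 'a set \<Rightarrow> real" and K \<sigma>
  define Ec where "Ec K x = (x (Inl K) - v K) / \<tau> * cell_measure K +
      (\<Sum>\<sigma>\<in>cell_faces M K. face_measure \<sigma> * F x K \<sigma>)" for K x
  define Ef where "Ef \<sigma> x =
      \<alpha>_face \<sigma> * x (Inr \<sigma>) - \<beta>_face \<sigma> - F x (owner M \<sigma>) \<sigma>"
      for \<sigma> x
  define E where "E i = (case i of Inl K \<Rightarrow> Ec K | Inr \<sigma> \<Rightarrow> Ef \<sigma>)"
      for i
  have ball_I: "(\<forall>j\<in>I. P j) \<longleftrightarrow>
      (\<forall>K\<in>cells M. P (Inl K)) \<and>
   (\<forall>\<sigma>\<in>ext_faces \<Omega> M. P (Inr \<sigma>))"
      for P
    by (auto simp: I_def)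
  have Fconst: "F (\<lambda>_. c) K \<sigma> = 0" if "c = 0 \<or> c = 1" for c K \<sigma>
    using that by (auto simp: F_def flux_def Let_def)
  have contx: "continuous_on S (\<lambda>t. (x(i := t)) j)" for S :: "real set"
      and x :: "'a set + 'a set \<Rightarrow> real" and i j
    by (cases "j = i") auto
  have contF: "continuous_on S (\<lambda>t. F (x(i := t)) K \<sigma>)" for S :: "real set"
      and x i K \<sigma>
    unfolding F_def flux_def Let_def
    by (cases "\<sigma> \<in> int_faces M") (simp_all add: continuous_on_sqra contx del: fun_upd_apply)
  have "\<exists>x. (\<forall>i\<in>I. x i \<in> {0..1}) \<and> (\<forall>i\<in>I. E i x = 0)"
  proof (rule monotone_system_solvable)
    fix i and x y :: "'a set + 'a set \<Rightarrow> real" assume i: "i \<in> I"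
        and x: "\<forall>j\<in>I. x j \<in> {0..1}" and y: "\<forall>j\<in>I. y j \<in> {0..1}"
      and eq: "x i = y i" and le: "\<forall>j\<in>I. x j \<le> y j"
    note x' = x[unfolded ball_I] and y' = y[unfolded ball_I] and le' = le[unfolded ball_I]
    from i consider (cell) K where "i = Inl K" "K \<in> cells M" | (face) \<sigma> where "i =
        Inr \<sigma>" "\<sigma> \<in> ext_faces \<Omega> M"
      by (auto simp: I_def)
    then show "E i y \<le> E i x"
    proof cases
      case cell
      have "F y K \<sigma> \<le> F x K \<sigma>" if "\<sigma> \<in> cell_faces M K" for \<sigma>
        unfolding F_def
      proof (rule flux_mono[OF cell(2) that])
        show "\<sigma> \<in> int_faces M \<Longrightarrow>
            (x \<circ> Inl) (neighbour M K \<sigma>) \<le> (y \<circ> Inl) (neighbour M K \<sigma>)"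
          using le' neighbour_cell[OF cell(2) that] by simp
      qed (use x' y' le' eq cell in simp_all)
      then have "(\<Sum>\<sigma>\<in>cell_faces M K. face_measure \<sigma> * F y K \<sigma>) \<le>
          (\<Sum>\<sigma>\<in>cell_faces M K. face_measure \<sigma> * F x K \<sigma>)"
        using cell_face_measure_pos[OF cell(2)]
          by (intro sum_mono mult_left_mono) (auto intro: less_imp_le)
      then show ?thesis using eq cell by (simp add: E_def Ec_def)
    next
      case face
      have "F x (owner M \<sigma>) \<sigma> \<le> F y (owner M \<sigma>) \<sigma>"
        unfolding F_def
      proof (rule flux_mono[OF owner_cell[OF face(2)] owner_face[OF face(2)]])
        show "\<sigma> \<in> int_faces M \<Longrightarrow>
            (y \<circ> Inl) (neighbour M (owner M \<sigma>) \<sigma>) \<le>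
   (x \<circ> Inl) (neighbour M (owner M \<sigma>) \<sigma>)"
          using face(2) int_ext_disjoint by blast
      qed (use x' y' le' eq face owner_cell[OF face(2)] in simp_all)
      then show ?thesis using eq face by (simp add: E_def Ef_def)
    qed
  next
    fix i and x :: "'a set + 'a set \<Rightarrow> real" assume "i \<in> I"
    show "continuous_on {0..1} (\<lambda>t. E i (x(i := t)))"
      unfolding E_def Ec_def Ef_def
      using \<tau> by (cases i) (auto simp del: fun_upd_apply intro!: continuous_intros contF contx)
  next
    fix i assume "i \<in> I"
    then consider (cell) K where "i = Inl K" "K \<in> cells M" | (face) \<sigma> where "i =
        Inr \<sigma>" "\<sigma> \<in> ext_faces \<Omega> M"
      by (auto simp: I_def)
    then have "E i (\<lambda>_. 0) \<le> 0 \<and> 0 \<le> E i (\<lambda>_. 1)"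
    proof cases
      case cell
      have "0 \<le> v K / \<tau> * cell_measure K" "0 \<le> (1 - v K) / \<tau> * cell_measure K"
        using v cell(2) \<tau> cell_measure_pos[OF cell(2)]
          by (auto intro!: mult_nonneg_nonneg divide_nonneg_pos)
      then show ?thesis using cell(1) by (simp add: E_def Ec_def Fconst)
    next
      case face
      then show ?thesis using rates_face[OF face(2)] by (simp add: E_def Ef_def Fconst)
    qed
    then show "E i (\<lambda>_. 0) \<le> 0" "0 \<le> E i (\<lambda>_. 1)" by auto
  qed
  then obtain x where x: "\<forall>i\<in>I. x i \<in> {0..1}" "\<forall>i\<in>I. E i x = 0" by blast
  note x' = x[unfolded ball_I]
  have "sqra_step \<Omega> \<phi> \<alpha> \<beta> M \<tau> v (x \<circ> Inl) (x \<circ> Inr)"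
    unfolding sqra_step_def
  proof (intro conjI ballI)
    fix K assume "K \<in> cells M"
    then show "((x \<circ> Inl) K - v K) / \<tau> * cell_measure K +
        (\<Sum>\<sigma>\<in>cell_faces M K. face_measure \<sigma> * flux M \<phi> (x \<circ> Inl) (x \<circ> Inr) K \<sigma>) = 0"
      using x'(2) by (simp add: E_def Ec_def F_def)
  next
    fix K \<sigma> assume K: "K \<in> cells M" "\<sigma> \<in> cell_faces M K \<inter> ext_faces \<Omega> M"
    then have "owner M \<sigma> = K" using owner_eq by blast
    then show "flux M \<phi> (x \<circ> Inl) (x \<circ> Inr) K \<sigma> =
        \<alpha>_face \<sigma> * (x \<circ> Inr) \<sigma> - \<beta>_face \<sigma>"
      using x'(2) K by (simp add: E_def Ef_def F_def)
  qed
  moreover have "\<forall>K\<in>cells M. (x \<circ> Inl) K \<in> {0..1}" "\<forall>\<sigma>\<in>ext_faces \<Omega> M. (x \<circ> Inr) \<sigma> \<in> {0..1}"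
    using x'(1) by auto
  ultimately show ?thesis by blast
qed

section \<open>Solutions avoid the extreme densities\<close>

text \<open>
  Treats the two extreme densities together; \<open>s\<close> is the sign of the flux out of a
  cell with density \<open>c\<close>.
\<close>

lemma sqra_extreme:
  assumes d: "0 < d" and c: "c = 0 \<and> s = - 1 \<or> c = 1 \<and> s = (1 :: real)"
      and b: "b \<in> {0..1}"
  shows "0 \<le> s * sqra d c b p q" and "sqra d c b p q = 0 \<Longrightarrow> b = c"
  using c
proof (atomize (full), elim disjE conjE)
  assume "c = 0" "s = - 1"
  then show "0 \<le> s * sqra d c b p q \<and> (sqra d c b p q = 0 \<longrightarrow> b = c)"
    using d b by (simp add: sqra_def)
next
  assume "c = 1" "s = 1"
  then show "0 \<le> s * sqra d c b p q \<and> (sqra d c b p q = 0 \<longrightarrow> b = c)"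
    using d b by (simp add: sqra_def)
qed

text \<open>
  In a cell with extreme density, the time difference and all outward fluxes have the same sign,
  and they sum to zero. So all fluxes vanish and the neighbours have the same extreme density.
  By connectedness this density reaches a cell with a boundary face, where the flux vanishes and
  the boundary density is extreme, too, in contradiction to the boundary condition.
\<close>

lemma step_avoids_extreme:
  assumes v: "\<forall>K\<in>cells M. v K \<in> {0..1}" and u: "\<forall>K\<in>cells M. u K \<in> {0..1}"
    and w: "\<forall>\<sigma>\<in>ext_faces \<Omega> M. w \<sigma> \<in> {0..1}"
        and st: "sqra_step \<Omega> \<phi> \<alpha> \<beta> M \<tau> v u w"
    and c: "c = 0 \<and> s = - 1 \<or> c = 1 \<and> s = (1 :: real)"
  shows "\<forall>K\<in>cells M. u K \<noteq> c"
proof (rule ccontr)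
  define A where "A = {K \<in> cells M. u K = c}"
  assume "\<not> (\<forall>K\<in>cells M. u K \<noteq> c)"
  then have A: "A \<subseteq> cells M" "A \<noteq> {}" by (auto simp: A_def)
  have sgn: "0 \<le> s * flux M \<phi> u w K \<sigma>"
      if K: "K \<in> A" "\<sigma> \<in> cell_faces M K" for K \<sigma>
  proof -
    have KA: "K \<in> cells M" "u K = c" using K by (auto simp: A_def)
    show ?thesis using KA(1) K(2)
    proof (cases rule: cell_face_cases)
      case int
      then show ?thesis using flux_int[OF KA(1) K(2) int(1)] u neighbour_cell[OF KA(1) K(2) int(1)] KA(2)
        sqra_extreme(1)[OF _ c] by metis
    next
      case ext
      then show ?thesis using flux_ext[OF KA(1) ext(1)] w KA(2) sqra_extreme(1)[OF _ c] by metis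
    qed
  qed
  have zero: "flux M \<phi> u w K \<sigma> = 0"
      if K: "K \<in> A" "\<sigma> \<in> cell_faces M K" for K \<sigma>
  proof -
    have KA: "K \<in> cells M" "u K = c" using K by (auto simp: A_def)
    have vK: "v K \<in> {0..1}" using v KA(1) by blast
    have nn: "0 \<le> face_measure \<sigma> * (s * flux M \<phi> u w K \<sigma>)"
        if "\<sigma> \<in> cell_faces M K" for \<sigma>
      using cell_face_measure_pos[OF KA(1) that] sgn[OF K(1) that] by simp
    have "s * (v K - c) \<le> 0" using c vK by auto
    then have "s * (v K - c) / \<tau> * cell_measure K \<le> 0"
      using divide_nonpos_pos[OF _ \<tau>] cell_measure_pos[OF KA(1)] by (intro mult_nonpos_nonneg) auto
    moreover have "s * (v K - c) / \<tau> * cell_measure K =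
        (\<Sum>\<sigma>\<in>cell_faces M K. face_measure \<sigma> * (s * flux M \<phi> u w K \<sigma>))"
      using arg_cong[OF step_cell[OF st KA(1)], of "(*) s"] KA(2)
      by (simp add: sum_distrib_left mult_ac)
    ultimately have le: "(\<Sum>\<sigma>\<in>cell_faces M K. face_measure \<sigma> * (s * flux M \<phi> u w K \<sigma>)) \<le>
        0"
      by simp
    have "(\<Sum>\<sigma>\<in>cell_faces M K. face_measure \<sigma> * (s * flux M \<phi> u w K \<sigma>)) =
        0"
      by (rule order_antisym[OF le sum_nonneg]) (rule nn)
    then have "\<forall>\<sigma>\<in>cell_faces M K. face_measure \<sigma> * (s * flux M \<phi> u w K \<sigma>) =
        0"
      by (subst (asm) sum_nonneg_eq_0_iff) (use finite_cell_faces[OF KA(1)] nn in auto)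
    then have "face_measure \<sigma> * (s * flux M \<phi> u w K \<sigma>) = 0" using K(2) by blast
    then show ?thesis using cell_face_measure_pos[OF KA(1) K(2)] c by auto
  qed
  have "A = cells M"
  proof (rule adjacency_connected[OF A])
    fix K L assume KL: "K \<in> A" "L \<in> cells M" "K \<noteq> L" "closure K \<inter> closure L \<in> faces M"
    have KA: "K \<in> cells M" "u K = c" using KL by (auto simp: A_def)
    let ?\<sigma> = "closure K \<inter> closure L"
    have \<sigma>: "?\<sigma> \<in> cell_faces M K" "?\<sigma> \<in> int_faces M" "neighbour M K ?\<sigma> =
        L"
      using neighbour_eq[OF KA(1) KL(2-4)] by auto
    obtain d where d: "d > 0" "\<And>u w. flux M \<phi> u w K ?\<sigma> =
        sqra d (u K) (u L) (\<phi> (center M K)) (\<phi> (center M L))"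
      using flux_int[OF KA(1) \<sigma>(1,2)] unfolding \<sigma>(3) by blast
    have "u L = c"
      using sqra_extreme(2)[OF d(1) c, of "u L"] zero[OF KL(1) \<sigma>(1)] u KL(2) unfolding d(2) KA(2)
        by blast
    then show "L \<in> A" using KL(2) by (simp add: A_def)
  qed
  moreover obtain \<sigma> where \<sigma>: "\<sigma> \<in> ext_faces \<Omega> M" using ex_ext_face A
    by blast
  ultimately have K: "owner M \<sigma> \<in> A" using owner_cell by blast
  have KA: "owner M \<sigma> \<in> cells M" "u (owner M \<sigma>) = c" using K by (auto simp: A_def)
  obtain d where d: "d > 0" "\<And>u w. flux M \<phi> u w (owner M \<sigma>) \<sigma> =
      sqra d (u (owner M \<sigma>)) (w \<sigma>) (\<phi> (center M (owner M \<sigma>))) (\<phi> (face_center M \<sigma>))"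
    using flux_ext[OF KA(1) \<sigma>] by blast
  have z: "flux M \<phi> u w (owner M \<sigma>) \<sigma> = 0"
    by (rule zero[OF K owner_face[OF \<sigma>]])
  then have "w \<sigma> = c" using sqra_extreme(2)[OF d(1) c, of "w \<sigma>"] w \<sigma>
    unfolding d(2) KA(2) by blast
  then have "\<alpha>_face \<sigma> * c - \<beta>_face \<sigma> = 0"
    using step_face[OF st KA(1) owner_face[OF \<sigma>] \<sigma>] z by simp
  then show False using c rates_face[OF \<sigma>] by auto
qed

lemma step_interior:
  assumes v: "\<forall>K\<in>cells M. v K \<in> {0..1}" and u: "\<forall>K\<in>cells M. u K \<in> {0..1}"
    and w: "\<forall>\<sigma>\<in>ext_faces \<Omega> M. w \<sigma> \<in> {0..1}"
        and st: "sqra_step \<Omega> \<phi> \<alpha> \<beta> M \<tau> v u w"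
  shows "(\<forall>K\<in>cells M. u K \<in> {0<..<1}) \<and>
      (\<forall>\<sigma>\<in>ext_faces \<Omega> M. w \<sigma> \<in> {0<..<1})"
proof -
  have u1: "u K \<in> {0<..<1}" if K: "K \<in> cells M" for K
  proof -
    have "u K \<noteq> 0" using step_avoids_extreme[OF v u w st, of 0 "-1"] K by blast
    moreover have "u K \<noteq> 1" using step_avoids_extreme[OF v u w st, of 1 1] K by blast
    moreover have "0 \<le> u K" "u K \<le> 1" using u K by auto
    ultimately show ?thesis by simp
  qed
  moreover have "w \<sigma> \<in> {0<..<1}"
      if \<sigma>: "\<sigma> \<in> ext_faces \<Omega> M" for \<sigma>
  proof -
    note K = owner_cell[OF \<sigma>] owner_face[OF \<sigma>]
    obtain d where d: "d > 0" "\<And>u w. flux M \<phi> u w (owner M \<sigma>) \<sigma> =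
        sqra d (u (owner M \<sigma>)) (w \<sigma>) (\<phi> (center M (owner M \<sigma>))) (\<phi> (face_center M \<sigma>))"
      using flux_ext[OF K(1) \<sigma>] by blast
    have eq: "sqra d (u (owner M \<sigma>)) (w \<sigma>) (\<phi> (center M (owner M \<sigma>))) (\<phi> (face_center M \<sigma>)) =
        \<alpha>_face \<sigma> * w \<sigma> - \<beta>_face \<sigma>"
      using step_face[OF st K \<sigma>] unfolding d(2) .
    have "w \<sigma> \<noteq> 0"
    proof
      assume "w \<sigma> = 0"
      moreover have "0 < sqra d (u (owner M \<sigma>)) 0 p q" for p q
        using d(1) u1[OF K(1)] by (simp add: sqra_def)
      ultimately show False using eq rates_face[OF \<sigma>]
        by (metis diff_0 mult_zero_right neg_less_0_iff_less order_less_asym)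
    qed
    moreover have "w \<sigma> \<noteq> 1"
    proof
      assume "w \<sigma> = 1"
      moreover have "0 < - sqra d (u (owner M \<sigma>)) 1 p q" for p q
        using d(1) u1[OF K(1)] by (simp add: sqra_def)
      ultimately show False using eq rates_face[OF \<sigma>]
        by (metis diff_gt_0_iff_gt mult_1_right neg_0_less_iff_less order_less_asym)
    qed
    moreover have "0 \<le> w \<sigma>" "w \<sigma> \<le> 1" using w \<sigma> by auto
    ultimately show ?thesis by simp
  qed
  ultimately show ?thesis by blast
qed

lemma step_ex1:
  assumes v: "\<forall>K\<in>cells M. v K \<in> {0..1}"
  shows "\<exists>!(u, w). u \<in> cells M \<rightarrow>\<^sub>E {0<..<1} \<and>
      w \<in> ext_faces \<Omega> M \<rightarrow>\<^sub>E {0<..<1} \<and>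
    sqra_step \<Omega> \<phi> \<alpha> \<beta> M \<tau> v u w"
proof -
  obtain u w where uw: "\<forall>K\<in>cells M. u K \<in> {0..1}" "\<forall>\<sigma>\<in>ext_faces \<Omega> M. w \<sigma> \<in> {0..1}"
      "sqra_step \<Omega> \<phi> \<alpha> \<beta> M \<tau> v u w"
    using step_exists_closed[OF v] by blast
  define u0 where "u0 = restrict u (cells M)"
  define w0 where "w0 = restrict w (ext_faces \<Omega> M)"
  have int: "\<forall>K\<in>cells M. u K \<in> {0<..<1}" "\<forall>\<sigma>\<in>ext_faces \<Omega> M. w \<sigma> \<in> {0<..<1}"
    using step_interior[OF v uw] by auto
  have ex: "u0 \<in> cells M \<rightarrow>\<^sub>E {0<..<1}" "w0 \<in> ext_faces \<Omega> M \<rightarrow>\<^sub>E {0<..<1}"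
    using int by (auto simp: u0_def w0_def)
  have st: "sqra_step \<Omega> \<phi> \<alpha> \<beta> M \<tau> v u0 w0"
    by (rule step_cong[OF _ _ uw(3)]) (auto simp: u0_def w0_def)
  have uniq: "u1 = u0 \<and> w1 = w0"
    if 1: "u1 \<in> cells M \<rightarrow>\<^sub>E {0<..<1}" "w1 \<in> ext_faces \<Omega> M \<rightarrow>\<^sub>E {0<..<1}" "sqra_step \<Omega> \<phi> \<alpha> \<beta> M \<tau> v u1 w1" for u1 w1
  proof -
    have b: "\<forall>K\<in>cells M. u' K \<in> {0..1}"
        if "u' \<in> cells M \<rightarrow>\<^sub>E {0<..<1::real}" for u'
      using PiE_mem[OF that] by (auto intro: less_imp_le)
    have b': "\<forall>K\<in>ext_faces \<Omega> M. u' K \<in> {0..1}"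
        if "u' \<in> ext_faces \<Omega> M \<rightarrow>\<^sub>E {0<..<1::real}" for u'
      using PiE_mem[OF that] by (auto intro: less_imp_le)
    have "(\<forall>K\<in>cells M. u1 K = u0 K) \<and>
        (\<forall>\<sigma>\<in>ext_faces \<Omega> M. w1 \<sigma> = w0 \<sigma>)"
      by (rule step_unique[OF 1(3) st b[OF 1(1)] b[OF ex(1)] b'[OF 1(2)] b'[OF ex(2)]])
    then show ?thesis using PiE_ext[OF 1(1) ex(1)] PiE_ext[OF 1(2) ex(2)] by blast
  qed
  show ?thesis
  proof (rule ex1I[of _ "(u0, w0)"])
    show "case (u0, w0) of (u, w) \<Rightarrow> u \<in> cells M \<rightarrow>\<^sub>E {0<..<1} \<and>
        w \<in> ext_faces \<Omega> M \<rightarrow>\<^sub>E {0<..<1} \<and>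
        sqra_step \<Omega> \<phi> \<alpha> \<beta> M \<tau> v u w"
      unfolding prod.case using ex st by (intro conjI)
  next
    fix p assume p: "case p of (u, w) \<Rightarrow> u \<in> cells M \<rightarrow>\<^sub>E {0<..<1} \<and>
        w \<in> ext_faces \<Omega> M \<rightarrow>\<^sub>E {0<..<1} \<and>
        sqra_step \<Omega> \<phi> \<alpha> \<beta> M \<tau> v u w"
    obtain u1 w1 where e: "p = (u1, w1)" by (cases p)
    show "p = (u0, w0)" using p uniq[of u1 w1] unfolding e prod.case by (elim conjE) simp
  qed
qed

section \<open>Energy dissipation and the lower energy bound\<close>

text \<open>
  Testing the scheme with the chemical potential \<open>\<xi>\<close> at the new time, as
  convexity of the entropy suggests for an implicit scheme. Each interior face contributes a
  drop of \<open>\<xi>\<close> times a flux. At a boundary face the drop from the cell to the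
  reservoir is split at the value on the face.
\<close>

lemma energy_step:
  assumes v: "\<forall>K\<in>cells M. v K \<in> {0..1}"
      and u: "\<forall>K\<in>cells M. u K \<in> {0<..<1}"
    and w: "\<forall>\<sigma>\<in>ext_faces \<Omega> M. w \<sigma> \<in> {0<..<1}"
        and st: "sqra_step \<Omega> \<phi> \<alpha> \<beta> M \<tau> v u w"
  shows "energy \<phi> M u + \<tau> * (\<Sum>\<sigma>\<in>ext_faces \<Omega> M. face_measure \<sigma> * boundary_potential \<phi> \<alpha> \<beta> M \<sigma> *
      flux M \<phi> u w (owner M \<sigma>) \<sigma>) \<le> energy \<phi> M v"
proof -
  define \<xi> where "\<xi> K = logit (u K) + \<phi> (center M K)" for K
  let ?F = "\<lambda>K \<sigma>. face_measure \<sigma> * flux M \<phi> u w K \<sigma>"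
  have int: "0 \<le> (\<Sum>K\<in>cells M. \<Sum>\<sigma>\<in>cell_faces M K \<inter> int_faces M. \<xi> K * ?F K \<sigma>)"
  proof (rule sum_int_nonneg)
    fix K \<sigma> assume K: "K \<in> cells M" "\<sigma> \<in> cell_faces M K" "\<sigma> \<in> int_faces M"
    show "?F (neighbour M K \<sigma>) \<sigma> = - ?F K \<sigma>" using flux_neighbour[OF K] by simp
    obtain d where d: "d > 0" "\<And>u w. flux M \<phi> u w K \<sigma> =
        sqra d (u K) (u (neighbour M K \<sigma>)) (\<phi> (center M K)) (\<phi> (center M (neighbour M K \<sigma>)))"
      using flux_int[OF K] by blast
    have "0 \<le> (\<xi> K - \<xi> (neighbour M K \<sigma>)) * flux M \<phi> u w K \<sigma>"
      unfolding d(2) \<xi>_def using u K(1) neighbour_cell[OF K] by (intro sqra_dissipative d(1)) auto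
    then have "0 \<le> face_measure \<sigma> * ((\<xi> K - \<xi> (neighbour M K \<sigma>)) * flux M \<phi> u w K \<sigma>)"
      using cell_face_measure_pos[OF K(1,2)] by simp
    then show "0 \<le> (\<xi> K - \<xi> (neighbour M K \<sigma>)) * ?F K \<sigma>" by (simp add: mult_ac)
  qed
  have ext: "face_measure \<sigma> * boundary_potential \<phi> \<alpha> \<beta> M \<sigma> * flux M \<phi> u w (owner M \<sigma>) \<sigma> \<le>
      \<xi> (owner M \<sigma>) * ?F (owner M \<sigma>) \<sigma>" if \<sigma>: "\<sigma> \<in> ext_faces \<Omega> M" for \<sigma>
  proof -
    note K = owner_cell[OF \<sigma>] owner_face[OF \<sigma>]
    let ?f = "flux M \<phi> u w (owner M \<sigma>) \<sigma>"
    obtain d where d: "d > 0" "\<And>u w. flux M \<phi> u w (owner M \<sigma>) \<sigma> =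
        sqra d (u (owner M \<sigma>)) (w \<sigma>) (\<phi> (center M (owner M \<sigma>))) (\<phi> (face_center M \<sigma>))"
      using flux_ext[OF K(1) \<sigma>] by blast
    have w\<sigma>: "w \<sigma> \<in> {0<..<1}" using w \<sigma> by blast
    have 1: "0 \<le> (\<xi> (owner M \<sigma>) - (logit (w \<sigma>) + \<phi> (face_center M \<sigma>))) * ?f"
      unfolding d(2) \<xi>_def using u K(1) w\<sigma> by (intro sqra_dissipative d(1)) auto
    have 2: "0 \<le> (logit (w \<sigma>) + ln (\<alpha>_face \<sigma> / \<beta>_face \<sigma> - 1)) * ?f"
      unfolding step_face[OF st K \<sigma>] using rates_face[OF \<sigma>] w\<sigma>
        by (intro robin_dissipative) auto
    have "boundary_potential \<phi> \<alpha> \<beta> M \<sigma> * ?f \<le> \<xi> (owner M \<sigma>) * ?f"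
      using 1 2 by (simp add: boundary_potential_def algebra_simps)
    then have "face_measure \<sigma> * (boundary_potential \<phi> \<alpha> \<beta> M \<sigma> * ?f) \<le>
        face_measure \<sigma> * (\<xi> (owner M \<sigma>) * ?f)"
      using cell_face_measure_pos[OF K] by (intro mult_left_mono) auto
    then show ?thesis by (simp add: mult_ac)
  qed
  have "(\<Sum>\<sigma>\<in>ext_faces \<Omega> M. face_measure \<sigma> * boundary_potential \<phi> \<alpha> \<beta> M \<sigma> * flux M \<phi> u w (owner M \<sigma>) \<sigma>)
      \<le> (\<Sum>K\<in>cells M. \<Sum>\<sigma>\<in>cell_faces M K. \<xi> K * ?F K \<sigma>)"
  proof -
    have "(\<Sum>\<sigma>\<in>ext_faces \<Omega> M. face_measure \<sigma> * boundary_potential \<phi> \<alpha> \<beta> M \<sigma> * flux M \<phi> u w (owner M \<sigma>) \<sigma>)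
        \<le> (\<Sum>\<sigma>\<in>ext_faces \<Omega> M. \<xi> (owner M \<sigma>) * ?F (owner M \<sigma>) \<sigma>)"
      by (rule sum_mono[OF ext])
    also have "\<dots> = (\<Sum>K\<in>cells M. \<Sum>\<sigma>\<in>cell_faces M K \<inter> ext_faces \<Omega> M. \<xi> K * ?F K \<sigma>)"
      by (rule sum_ext_by_owner[symmetric])
    also have "\<dots> \<le> (\<Sum>K\<in>cells M. \<Sum>\<sigma>\<in>cell_faces M K. \<xi> K * ?F K \<sigma>)"
      using int by (simp add: sum_cell_faces sum.distrib)
    finally show ?thesis .
  qed
  also have "\<dots> = (\<Sum>K\<in>cells M. \<xi> K * ((v K - u K) / \<tau> * cell_measure K))"
    using step_cell[OF st] by (intro sum.cong refl) (simp add: sum_distrib_left[symmetric])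
  finally have "\<tau> * (\<Sum>\<sigma>\<in>ext_faces \<Omega> M. face_measure \<sigma> * boundary_potential \<phi> \<alpha> \<beta> M \<sigma> * flux M \<phi> u w (owner M \<sigma>) \<sigma>)
      \<le> \<tau> * (\<Sum>K\<in>cells M. \<xi> K * ((v K - u K) / \<tau> * cell_measure K))"
    using \<tau> by (intro mult_left_mono) auto
  also have "\<dots> = (\<Sum>K\<in>cells M. cell_measure K * (\<xi> K * (v K - u K)))"
    using \<tau> by (simp add: sum_distrib_left mult_ac)
  also have "\<dots> \<le> (\<Sum>K\<in>cells M. cell_measure K * ((entropy (v K) + \<phi> (center M K) * v K) -
      (entropy (u K) + \<phi> (center M K) * u K)))"
  proof (intro sum_mono mult_left_mono)
    fix K assume K: "K \<in> cells M"
    have "entropy (u K) + logit (u K) * (v K - u K) \<le> entropy (v K)" using u v K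
      by (intro entropy_tangent) auto
    then show "\<xi> K * (v K - u K) \<le>
        (entropy (v K) + \<phi> (center M K) * v K) - (entropy (u K) + \<phi> (center M K) * u K)"
      by (simp add: \<xi>_def algebra_simps)
    show "0 \<le> cell_measure K" using cell_measure_pos[OF K] by simp
  qed
  also have "\<dots> = energy \<phi> M v - energy \<phi> M u"
    by (simp add: energy_def sum_subtractf right_diff_distrib)
  finally show ?thesis by simp
qed

lemma total_energy_Suc:
  "total_energy \<Omega> \<phi> \<alpha> \<beta> M \<tau> u w (Suc n) =
      total_energy \<Omega> \<phi> \<alpha> \<beta> M \<tau> u w n - energy \<phi> M (u n) +
    (energy \<phi> M (u (Suc n)) + \<tau> * (\<Sum>\<sigma>\<in>ext_faces \<Omega> M. face_measure \<sigma> * boundary_potential \<phi> \<alpha> \<beta> M \<sigma> *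
      flux M \<phi> (u (Suc n)) (w (Suc n)) (owner M \<sigma>) \<sigma>))"
  by (simp add: total_energy_def)

lemma total_energy_ge:
  assumes pos: "\<forall>K\<in>cells M. u n K \<in> {0..1}"
      and \<phi>: "\<forall>x\<in>\<Omega>. \<phi> x \<ge> 0"
    and area: "(\<Sum>\<sigma>\<in>ext_faces \<Omega> M. face_measure \<sigma>) \<le> A"
    and B: "\<And>p \<sigma>. p \<ge> 1 \<Longrightarrow>
        \<sigma> \<in> ext_faces \<Omega> M \<Longrightarrow>
      \<bar>boundary_potential \<phi> \<alpha> \<beta> M \<sigma> * flux M \<phi> (u p) (w p) (owner M \<sigma>) \<sigma>\<bar> \<le> B" and B0: "0 \<le> B"
  shows "- (A * B) * (real n * \<tau>) \<le> total_energy \<Omega> \<phi> \<alpha> \<beta> M \<tau> u w n"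
proof -
  have "0 \<le> energy \<phi> M (u n)" unfolding energy_def
  proof (intro sum_nonneg mult_nonneg_nonneg add_nonneg_nonneg)
    fix K assume K: "K \<in> cells M"
    show "0 \<le> cell_measure K" using cell_measure_pos[OF K] by simp
    show "0 \<le> entropy (u n K)" using pos K by (intro entropy_nonneg) blast
    show "0 \<le> \<phi> (center M K)" using \<phi> center_in[OF K] by blast
    show "0 \<le> u n K" using pos K by auto
  qed
  moreover have "(\<Sum>p=1..n. \<tau> * (- (A * B))) \<le>
      (\<Sum>p=1..n. \<tau> * (\<Sum>\<sigma>\<in>ext_faces \<Omega> M.
        face_measure \<sigma> * boundary_potential \<phi> \<alpha> \<beta> M \<sigma> * flux M \<phi> (u p) (w p) (owner M \<sigma>) \<sigma>))"
  proof (intro sum_mono mult_left_mono)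
    fix p assume p: "p \<in> {1..n}"
    have "- (A * B) \<le> - ((\<Sum>\<sigma>\<in>ext_faces \<Omega> M. face_measure \<sigma>) * B)"
      using area B0 by (simp add: mult_right_mono)
    also have "\<dots> = (\<Sum>\<sigma>\<in>ext_faces \<Omega> M. face_measure \<sigma> * (- B))"
      by (simp add: sum_distrib_right sum_negf)
    also have "\<dots> \<le> (\<Sum>\<sigma>\<in>ext_faces \<Omega> M.
        face_measure \<sigma> * (boundary_potential \<phi> \<alpha> \<beta> M \<sigma> * flux M \<phi> (u p) (w p) (owner M \<sigma>) \<sigma>))"
    proof (intro sum_mono mult_left_mono)
      fix \<sigma> assume \<sigma>: "\<sigma> \<in> ext_faces \<Omega> M"
      show "- B \<le> boundary_potential \<phi> \<alpha> \<beta> M \<sigma> * flux M \<phi> (u p) (w p) (owner M \<sigma>) \<sigma>"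
        using B[of p \<sigma>] p \<sigma> by auto
      show "0 \<le> face_measure \<sigma>" by (simp add: face_measure_def)
    qed
    finally show "- (A * B) \<le> (\<Sum>\<sigma>\<in>ext_faces \<Omega> M.
        face_measure \<sigma> * boundary_potential \<phi> \<alpha> \<beta> M \<sigma> * flux M \<phi> (u p) (w p) (owner M \<sigma>) \<sigma>)"
      by (simp add: mult.assoc)
    show "0 \<le> \<tau>" using \<tau> by simp
  qed
  moreover have "(\<Sum>p=1..n. \<tau> * (- (A * B))) = - (A * B) * (real n * \<tau>)" by simp
  ultimately show ?thesis unfolding total_energy_def by linarith
qed

text \<open>
  If \<open>\<rho>\<close> is not integrable over \<open>K\<close>, the integral is
  \<open>0\<close> by convention and the claim holds as well.
\<close>

lemma initial_average:
  assumes "AE x in lebesgue. x \<in> \<Omega> \<longrightarrow> \<rho> x \<in> {0..(1::real)}"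
      and K: "K \<in> cells M"
  shows "1 / cell_measure K * (LINT x:K|lebesgue. \<rho> x) \<in> {0..1}"
proof -
  have AE: "AE x in lebesgue. 0 \<le> indicator K x *\<^sub>R \<rho> x \<and>
      indicator K x *\<^sub>R \<rho> x \<le> indicator K x"
    using assms(1) by eventually_elim (use cell_subset[OF K] in \<open>auto simp: indicator_def\<close>)
  have Km: "K \<in> lmeasurable" using cell_open[OF K] cell_bounded[OF K] by (simp add: lmeasurable_open)
  have 1: "0 \<le> (LINT x:K|lebesgue. \<rho> x)"
    unfolding set_lebesgue_integral_def by (rule integral_nonneg_AE) (use AE in auto)
  have 2: "(LINT x:K|lebesgue. \<rho> x) \<le> cell_measure K"
  proof (cases "integrable lebesgue (\<lambda>x. indicator K x *\<^sub>R \<rho> x)")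
    case True
    have "(LINT x:K|lebesgue. \<rho> x) \<le> (LINT x|lebesgue. indicator K x)"
      unfolding set_lebesgue_integral_def
      by (rule integral_mono_AE[OF True]) (use AE Km in \<open>auto simp: fmeasurable_def\<close>)
    also have "\<dots> = cell_measure K" using Km by (simp add: cell_measure_def)
    finally show ?thesis .
  next
    case False
    then have "(LINT x:K|lebesgue. \<rho> x) = 0"
      unfolding set_lebesgue_integral_def by (rule not_integrable_integral_eq)
    then show ?thesis using cell_measure_pos[OF K] by simp
  qed
  show ?thesis using 1 2 cell_measure_pos[OF K] by (simp add: field_simps)
qed

end

section \<open>Well-posedness and energy estimate\<close>

theorem theorem2p3:
  fixes \<Omega> :: "'a::euclidean_space set" and \<phi> \<alpha> \<beta> :: "'a \<Rightarrow> real"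
  assumes "open \<Omega>" and "connected \<Omega>" and "bounded \<Omega>" and "open_polyhedral \<Omega>"
    and "W1_inf \<Omega> \<phi>" and "continuous_on (closure \<Omega>) \<phi>"
        and "\<forall>x\<in>\<Omega>. \<phi> x \<ge> 0"
    and "W1_inf_boundary (frontier \<Omega>) \<alpha>" and "W1_inf_boundary (frontier \<Omega>) \<beta>"
    and "\<forall>x\<in>frontier \<Omega>. \<alpha> x > \<beta> x \<and> \<beta> x > 0"
  shows "(\<forall>(M :: 'a mesh) \<tau> u\<^sub>p\<^sub>r\<^sub>e\<^sub>v.
            admissible_mesh \<Omega> M \<and> \<tau> > 0 \<and> (\<forall>K\<in>cells M. u\<^sub>p\<^sub>r\<^sub>e\<^sub>v K \<in> {0..1}) \<longrightarrow>
            (\<exists>!(u, w). u \<in> cells M \<rightarrow>\<^sub>E {0<..<1} \<and> w \<in> ext_faces \<Omega> M \<rightarrow>\<^sub>E {0<..<1} \<and>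
               sqra_step \<Omega> \<phi> \<alpha> \<beta> M \<tau> u\<^sub>p\<^sub>r\<^sub>e\<^sub>v u w))
       \<and> (\<exists>C::real. \<forall>(M :: 'a mesh) \<tau> \<rho>\<^sub>0 u w.
            admissible_mesh \<Omega> M \<and> \<tau> > 0 \<and>
            set_borel_measurable lebesgue \<Omega> \<rho>\<^sub>0 \<and>
            (AE x in lebesgue. x \<in> \<Omega> \<longrightarrow> \<rho>\<^sub>0 x \<in> {0..1}) \<and>
            sqra_solution \<Omega> \<phi> \<alpha> \<beta> M \<tau> \<rho>\<^sub>0 u w \<longrightarrow>
            (\<forall>n\<ge>1. total_energy \<Omega> \<phi> \<alpha> \<beta> M \<tau> u w (n - 1) \<ge> total_energy \<Omega> \<phi> \<alpha> \<beta> M \<tau> u w n \<and>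
               total_energy \<Omega> \<phi> \<alpha> \<beta> M \<tau> u w n \<ge> - C * (real n * \<tau>)))"
proof (intro conjI allI impI)
  fix M :: "'a mesh" and \<tau> :: real
      and u\<^sub>p\<^sub>r\<^sub>e\<^sub>v :: "'a set \<Rightarrow> real"
  assume *: "admissible_mesh \<Omega> M \<and> \<tau> > 0 \<and>
      (\<forall>K\<in>cells M. u\<^sub>p\<^sub>r\<^sub>e\<^sub>v K \<in> {0..1})"
  interpret sqra_scheme \<Omega> M \<phi> \<alpha> \<beta> \<tau>
    by (intro sqra_scheme.intro meshed_domain.intro sqra_scheme_axioms.intro assms) (use * in simp_all)
  show "\<exists>!(u, w). u \<in> cells M \<rightarrow>\<^sub>E {0<..<1} \<and>
      w \<in> ext_faces \<Omega> M \<rightarrow>\<^sub>E {0<..<1} \<and>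
               sqra_step \<Omega> \<phi> \<alpha> \<beta> M \<tau> u\<^sub>p\<^sub>r\<^sub>e\<^sub>v u w"
    by (rule step_ex1) (use * in blast)
next
  have fc: "compact (frontier \<Omega>)" using assms(3) by (rule compact_frontier_bounded)
  have cont: "continuous_on (frontier \<Omega>) \<alpha>" "continuous_on (frontier \<Omega>) \<beta>" "continuous_on (frontier \<Omega>) \<phi>"
    using assms(6,8,9) by (auto simp: W1_inf_boundary_def frontier_def intro: continuous_on_subset)
  have pos: "\<beta> x > 0" "\<alpha> x / \<beta> x - 1 > 0" if "x \<in> frontier \<Omega>" for x
    using assms(10) that by auto
  have bdd: "\<exists>B\<ge>0. \<forall>x\<in>frontier \<Omega>. \<bar>f x\<bar> \<le> B"
      if "continuous_on (frontier \<Omega>) f" for f :: "'a \<Rightarrow> real"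
  proof -
    have "bounded (f ` frontier \<Omega>)" using compact_continuous_image[OF that fc]
      by (rule compact_imp_bounded)
    then obtain B where "\<forall>x\<in>frontier \<Omega>. \<bar>f x\<bar> \<le> B"
      by (auto simp: bounded_iff)
    then show ?thesis by (intro exI[of _ "max B 0"]) auto
  qed
  have "continuous_on (frontier \<Omega>) (\<lambda>x. \<phi> x - ln (\<alpha> x / \<beta> x - 1))"
    using pos by (intro continuous_intros cont) force+
  from bdd[OF this] obtain X where X: "X \<ge> 0" "\<And>x. x \<in> frontier \<Omega> \<Longrightarrow>
      \<bar>\<phi> x - ln (\<alpha> x / \<beta> x - 1)\<bar> \<le> X"
    by blast
  obtain Y where Y: "Y \<ge> 0" "\<And>x. x \<in> frontier \<Omega> \<Longrightarrow>
      \<bar>\<alpha> x\<bar> \<le> Y"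
    using bdd[OF cont(1)] by blast
  obtain A where A: "A \<ge> 0" "\<And>M :: 'a mesh. admissible_mesh \<Omega> M \<Longrightarrow>
      (\<Sum>\<sigma>\<in>ext_faces \<Omega> M. face_measure \<sigma>) \<le> A"
    using boundary_area_bound[OF assms(1-4)] by blast
  show "\<exists>C::real. \<forall>(M :: 'a mesh) \<tau> \<rho>\<^sub>0 u w.
            admissible_mesh \<Omega> M \<and> \<tau> > 0 \<and>
            set_borel_measurable lebesgue \<Omega> \<rho>\<^sub>0 \<and>
            (AE x in lebesgue. x \<in> \<Omega> \<longrightarrow> \<rho>\<^sub>0 x \<in> {0..1}) \<and>
            sqra_solution \<Omega> \<phi> \<alpha> \<beta> M \<tau> \<rho>\<^sub>0 u w \<longrightarrow>
            (\<forall>n\<ge>1. total_energy \<Omega> \<phi> \<alpha> \<beta> M \<tau> u w (n - 1) \<ge> total_energy \<Omega> \<phi> \<alpha> \<beta> M \<tau> u w n \<and>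
               total_energy \<Omega> \<phi> \<alpha> \<beta> M \<tau> u w n \<ge> - C * (real n * \<tau>))"
  proof (intro exI[of _ "A * (X * Y)"] allI impI)
    fix M :: "'a mesh" and \<tau> :: real and \<rho>\<^sub>0 :: "'a \<Rightarrow> real" and u w
        and n :: nat
    assume *: "admissible_mesh \<Omega> M \<and> \<tau> > 0 \<and>
        set_borel_measurable lebesgue \<Omega> \<rho>\<^sub>0 \<and>
            (AE x in lebesgue. x \<in> \<Omega> \<longrightarrow> \<rho>\<^sub>0 x \<in> {0..1}) \<and>
            sqra_solution \<Omega> \<phi> \<alpha> \<beta> M \<tau> \<rho>\<^sub>0 u w" and n: "n \<ge> 1"
    then have adm: "admissible_mesh \<Omega> M" and \<tau>: "\<tau> > 0"
        and AE: "AE x in lebesgue. x \<in> \<Omega> \<longrightarrow> \<rho>\<^sub>0 x \<in> {0..1}"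
      and sol: "sqra_solution \<Omega> \<phi> \<alpha> \<beta> M \<tau> \<rho>\<^sub>0 u w" by blast+
    interpret sqra_scheme \<Omega> M \<phi> \<alpha> \<beta> \<tau>
      by (intro sqra_scheme.intro meshed_domain.intro sqra_scheme_axioms.intro assms adm \<tau>)
    have u: "\<forall>K\<in>cells M. u p K \<in> {0<..<1}"
        and w: "\<forall>\<sigma>\<in>ext_faces \<Omega> M. w p \<sigma> \<in> {0<..<1}"
      and st: "sqra_step \<Omega> \<phi> \<alpha> \<beta> M \<tau> (u (p - 1)) (u p) (w p)"
          if "p \<ge> 1" for p
      using sol that unfolding sqra_solution_def by blast+
    have u01: "\<forall>K\<in>cells M. u p K \<in> {0..1}" for p
    proof (cases "p = 0")
      case True
      then show ?thesis using sol initial_average[OF AE] by (simp add: sqra_solution_def)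
    next
      case False
      then show ?thesis using u[of p] by (auto intro: less_imp_le)
    qed
    obtain m where m: "n = Suc m" using n by (cases n) auto
    have "total_energy \<Omega> \<phi> \<alpha> \<beta> M \<tau> u w n \<le>
        total_energy \<Omega> \<phi> \<alpha> \<beta> M \<tau> u w (n - 1)"
      using energy_step[OF u01[of m] u[of n] w[of n]] st[of n] n
      unfolding m total_energy_Suc by simp
    moreover have "- (A * (X * Y)) * (real n * \<tau>) \<le>
        total_energy \<Omega> \<phi> \<alpha> \<beta> M \<tau> u w n"
    proof (rule total_energy_ge[OF u01 assms(7) A(2)[OF adm]])
      fix p :: nat and \<sigma> assume p: "p \<ge> 1" and \<sigma>: "\<sigma> \<in> ext_faces \<Omega> M"
      note K = owner_cell[OF \<sigma>] owner_face[OF \<sigma>]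
      have "\<bar>boundary_potential \<phi> \<alpha> \<beta> M \<sigma>\<bar> \<le> X"
        unfolding boundary_potential_def by (rule X(2)[OF face_center_frontier[OF \<sigma>]])
      moreover have "\<bar>flux M \<phi> (u p) (w p) (owner M \<sigma>) \<sigma>\<bar> \<le> Y"
      proof -
        have w1: "0 < w p \<sigma>" "w p \<sigma> < 1" using w[OF p] \<sigma> by auto
        have r: "0 < \<beta>_face \<sigma>" "\<beta>_face \<sigma> < \<alpha>_face \<sigma>"
          using rates_face[OF \<sigma>] by auto
        have "\<alpha>_face \<sigma> * w p \<sigma> \<le> \<alpha>_face \<sigma> * 1" "0 \<le>
            \<alpha>_face \<sigma> * w p \<sigma>"
          using w1 r by (intro mult_left_mono mult_nonneg_nonneg; simp)+
        then have "\<bar>\<alpha>_face \<sigma> * w p \<sigma> - \<beta>_face \<sigma>\<bar> \<le>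
            \<bar>\<alpha>_face \<sigma>\<bar>"
          using r by linarith
        then show ?thesis using step_face[OF st[OF p] K \<sigma>] Y(2)[OF face_center_frontier[OF \<sigma>]]
          by simp
      qed
      ultimately show "\<bar>boundary_potential \<phi> \<alpha> \<beta> M \<sigma> * flux M \<phi> (u p) (w p) (owner M \<sigma>) \<sigma>\<bar> \<le>
          X * Y"
        unfolding abs_mult using X(1) by (intro mult_mono) auto
    qed (use X Y in simp)
    ultimately show "total_energy \<Omega> \<phi> \<alpha> \<beta> M \<tau> u w (n - 1) \<ge> total_energy \<Omega> \<phi> \<alpha> \<beta> M \<tau> u w n \<and>
               total_energy \<Omega> \<phi> \<alpha> \<beta> M \<tau> u w n \<ge> - (A * (X * Y)) * (real n * \<tau>)" by blast
  qed
qed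

end
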